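(* Let $2\le m<n$ be integers such that $\log m/\log n$ is irrational, and let $E,F\in\mathcal M_{t,v,d}(n,m)$. If $E\sim F$ (i.e. $E$ and $F$ are Lipschitz equivalent), then the distribution sequence of $E$ is a permutation of that of $F$.
   Context: For integers $2\le m<n$ and a non-empty digit set $\mathcal D\subset\{0,1,\dots,n-1\}\times\{0,1,\dots,m-1\}$, let $S_d(z)=\mathrm{diag}(n^{-1},m^{-1})(z+d)$ for $d\in\mathcal D$, $z\in\mathbb R^2$. The self-affine carpet $E=K(n,m,\mathcal D)$ is the unique non-empty compact set with $E=\bigcup_{d\in\mathcal D}S_d(E)$. The distribution sequence of $\mathcal D$, or of $K(n,m,\mathcal D)$, is $(a_j)_{j=0}^{m-1}$ with $a_j=\#\{i:(i,j)\in\mathcal D\}$; the $j$-th row is vacant if $a_j=0$. The uniform Bernoulli measure $\mu_E$ is the unique Borel probability measure on $E$ satisfying $\mu_E=\sum_{d\in\mathcal D}\frac{1}{\#\mathcal D}\,\mu_E\circ S_d^{-1}$. A measure $\mu$ on a metric space $X$ is doubling if there is $C\ge1$ such that $0<\mu(B(x,2r))\le C\mu(B(x,r))<\infty$ for all balls $B(x,r)\subset X$ of radius $r$. $\mathcal M_{t,v,d}(n,m)$ is the set of self-affine carpets $E=K(n,m,\mathcal D)$ that are totally disconnected, possess vacant rows (i.e. $a_j=0$ for at least one $j\in\{0,\dots,m-1\}$), and whose uniform Bernoulli measure $\mu_E$ is doubling (as a measure on $E$). Lipschitz equivalence: metric spaces $X,Y$ satisfy $X\sim Y$ if there are a surjective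 map $f:X\to Y$ and a constant $C>0$ with $C^{-1}d_X(x,y)\le d_Y(f(x),f(y))\le C\,d_X(x,y)$ for all $x,y\in X$. Carpets carry the Euclidean metric. *)

theory Defs
  imports "HOL-Probability.Probability" "HOL-Combinatorics.Permutations"
begin

text \<open>The plane is \<^typ>\<open>real \<times> real\<close>, whose product metric is the Euclidean one.\<close>

definition digit_set :: "nat \<Rightarrow> nat \<Rightarrow> (nat \<times> nat) set \<Rightarrow> bool" where
  "digit_set n m D \<longleftrightarrow> D \<noteq> {} \<and> D \<subseteq> {0..<n} \<times> {0..<m}"

definition affine_contraction :: "nat \<Rightarrow> nat \<Rightarrow> nat \<times> nat \<Rightarrow> real \<times> real \<Rightarrow> real \<times> real" where
  "affine_contraction n m d z =
     ((fst z + real (fst d)) / real n, (snd z + real (snd d)) / real m)"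

text \<open>For \<open>n, m \<ge> 2\<close> and a digit set \<open>D\<close>, the descriptions below determine a unique set and a unique
  measure (Hutchinson), so the definite descriptions are proper; otherwise they may be junk.\<close>

definition carpet :: "nat \<Rightarrow> nat \<Rightarrow> (nat \<times> nat) set \<Rightarrow> (real \<times> real) set" where
  "carpet n m D =
     (THE E. E \<noteq> {} \<and> compact E \<and> E = (\<Union>d\<in>D. affine_contraction n m d ` E))"

text \<open>A measure on the subspace \<open>carpet n m D\<close>, so that its space is the carpet and not the plane.\<close>

definition uniform_Bernoulli_measure ::
    "nat \<Rightarrow> nat \<Rightarrow> (nat \<times> nat) set \<Rightarrow> (real \<times> real) measure" where
  "uniform_Bernoulli_measure n m D =
     (THE M. prob_space M \<and> sets M = sets (restrict_space borel (carpet n m D)) \<and>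
        (\<forall>A\<in>sets M. emeasure M A =
           (\<Sum>d\<in>D. ennreal (1 / real (card D)) *
                   emeasure M (affine_contraction n m d -` A \<inter> space M))))"

definition distribution_seq :: "(nat \<times> nat) set \<Rightarrow> nat \<Rightarrow> nat" where
  "distribution_seq D j = card {i. (i, j) \<in> D}"

text \<open>Balls are those of the metric subspace \<open>space M\<close>.\<close>

definition doubling_measure :: "'a::metric_space measure \<Rightarrow> bool" where
  "doubling_measure M \<longleftrightarrow>
     (\<exists>C::real. C \<ge> 1 \<and> (\<forall>x\<in>space M. \<forall>r>0.
        0 < emeasure M (ball x (2 * r) \<inter> space M) \<and>
        emeasure M (ball x (2 * r) \<inter> space M) \<le> ennreal C * emeasure M (ball x r \<inter> space M) \<and>
        ennreal C * emeasure M (ball x r \<inter> space M) < \<infinity>))"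

definition totally_disconnected :: "'a::topological_space set \<Rightarrow> bool" where
  "totally_disconnected S \<longleftrightarrow> (\<forall>x\<in>S. connected_component_set S x = {x})"

definition carpets_tvd :: "nat \<Rightarrow> nat \<Rightarrow> (real \<times> real) set set" where
  "carpets_tvd n m =
     {E. \<exists>D. digit_set n m D \<and> E = carpet n m D \<and> totally_disconnected E \<and>
             (\<exists>j\<in>{0..<m}. distribution_seq D j = 0) \<and>
             doubling_measure (uniform_Bernoulli_measure n m D)}"

definition lipschitz_equivalent :: "'a::metric_space set \<Rightarrow> 'b::metric_space set \<Rightarrow> bool" where
  "lipschitz_equivalent X Y \<longleftrightarrow>
     (\<exists>f C. f ` X = Y \<and> C > 0 \<and>
        (\<forall>x\<in>X. \<forall>y\<in>X. inverse C * dist x y \<le> dist (f x) (f y) \<and> dist (f x) (f y) \<le> C * dist x y))"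

end

theory Submission
  imports Defs
begin

text \<open>
  The horizontal contraction \<open>1 / n\<close> is stronger than the vertical one \<open>1 / m\<close>, so the sets that
  look round at scale \<open>m ^ - k\<close> are not cylinders but \<^emph>\<open>approximate squares\<close>: they fix the first
  \<open>k\<close> vertical digits and the first \<open>lv k\<close> horizontal digits, where \<open>lv k\<close> is the integer part of
  \<open>k * \<sigma>\<close> and \<open>\<sigma> = ln m / ln n\<close>. With \<open>N\<close> digits and row counts \<open>a\<close>, such a square has mass
  \<open>N ^ - k\<close> times the product of the counts of the rows at the places from \<open>lv k\<close> to \<open>k - 1\<close>.

  This mass is metric information: at fine levels it is the proportion of all approximate squares
  that lie in the given one (\<open>card_subsquares\<close>). A bi-Lipschitz map changes numbers of squares by
  bounded factors only, hence also masses of corresponding squares (\<open>weight_le_image_weight\<close>). If both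
  carpets have the same number of digits, comparing the sums of the powers of these masses
  over all squares of a level, as the level grows, shows that all power sums of the two distribution
  sequences agree, so the sequences agree up to order.

  It remains to see that the numbers of digits agree, and bounded factors are too coarse for this.
  The three hypotheses on the carpets give a finer comparison. Doubling makes the bottom
  and the top row equally full whenever a carry in the vertical digits can occur
  (\<open>extreme_rows_eq\<close>); therefore the masses of nearby squares have ratios in a \<^emph>\<open>finite\<close> set
  (\<open>near_weight_ratio\<close>). A vacant row, and rows that are not full because the carpet is totally
  disconnected, confine chains with steps below \<open>m ^ - k\<close> to regions of diameter comparable to
  \<open>m ^ - k\<close> (\<open>cluster_diameter\<close>). The bi-Lipschitz map sends such a cluster to a union of
  boundedly many squares of nearly the same level, so the factor by which it distorts the mass of a
  cluster is bounded, and it changes by one of finitely many factors on passing to a subcluster. Below a cluster where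
  this distortion nearly attains its supremum it must be constant (\<open>cluster_with_constant_ratio\<close>).

  In that cluster, follow a point whose digits eventually stay in a fullest row. Its squares are the
  heaviest ones of the first carpet, those of its image are comparable to the heaviest ones of the
  second, and the quotient of the two maximal masses at level \<open>k\<close> lies in a finite set. This quotient is
  \<open>u ^ k * v ^ (k - lv k)\<close>, where \<open>u\<close> is the quotient of the numbers of digits and \<open>v\<close> that of the maximal
  counts. As \<open>\<sigma>\<close> is irrational, the fractional parts of \<open>k * \<sigma>\<close> are pairwise different, and
  finiteness forces \<open>u = v = 1\<close> (\<open>power_floor_finite_imp_one\<close>).
\<close>

section \<open>Expansions in an integer base\<close>

fun place_value :: "nat \<Rightarrow> (nat \<Rightarrow> nat) \<Rightarrow> nat \<Rightarrow> nat" where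
  "place_value b f 0 = 0"
| "place_value b f (Suc k) = b * place_value b f k + f k"

definition expansion :: "nat \<Rightarrow> (nat \<Rightarrow> nat) \<Rightarrow> real" where
  "expansion b f = (\<Sum>l. real (f l) / real b ^ Suc l)"

lemma place_value_less:
  assumes "\<And>l. l < k \<Longrightarrow> f l < b"
  shows "place_value b f k < b ^ k"
  using assms
proof (induction k)
  case (Suc k)
  then have "place_value b f k + 1 \<le> b ^ k" "f k < b"
    by (auto simp: Suc_le_eq)
  then have "b * (place_value b f k + 1) \<le> b * b ^ k"
    by (intro mult_left_mono) auto
  with \<open>f k < b\<close> show ?case
    by simp
qed simp

lemma place_value_cong:
  "(\<And>l. l < k \<Longrightarrow> f l = g l) \<Longrightarrow> place_value b f k = place_value b g k"
  by (induction k) auto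

lemma place_value_inj:
  assumes "\<And>l. l < k \<Longrightarrow> f l < b" "\<And>l. l < k \<Longrightarrow> g l < b"
    and "place_value b f k = place_value b g k" "l < k"
  shows "f l = g l"
  using assms
proof (induction k)
  case (Suc k)
  have "f k < b" "g k < b"
    using Suc.prems by auto
  have *: "b * place_value b f k + f k = b * place_value b g k + g k"
    using Suc.prems by simp
  have "f k = g k"
    using arg_cong[OF *, of "\<lambda>t. t mod b"] \<open>f k < b\<close> \<open>g k < b\<close> by simp
  moreover have "place_value b f k = place_value b g k"
    using * \<open>f k = g k\<close> \<open>f k < b\<close> by simp
  ultimately have "l < k \<Longrightarrow> f l = g l"
    using Suc.IH Suc.prems(1,2) by simp
  with \<open>f k = g k\<close> show ?case
    using Suc.prems(4) by (auto simp: less_Suc_eq)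
qed simp

lemma place_value_eq_iff:
  assumes "\<forall>l. f l < b" "\<forall>l. g l < b"
  shows "place_value b f k = place_value b g k \<longleftrightarrow> (\<forall>l<k. f l = g l)"
  using place_value_inj[of k f b g] place_value_cong[of k f g b] assms by blast

lemma place_value_div:
  assumes "\<forall>l. f l < b" "i \<le> k"
  shows "place_value b f k div b ^ (k - i) = place_value b f i"
  using \<open>i \<le> k\<close>
proof (induction k rule: dec_induct)
  case (step k)
  have "place_value b f (Suc k) div b ^ (Suc k - i)
      = (b * place_value b f k + f k) div b div b ^ (k - i)"
    using step by (simp add: Suc_diff_le div_mult2_eq)
  also have "(b * place_value b f k + f k) div b = place_value b f k"
    using spec[OF assms(1), of k] by simp
  also note step.IH
  finally show ?case .
qed simp

context
  fixes b :: nat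
  assumes b: "2 \<le> b"
begin

lemma expansion_terms_sums: "(\<lambda>l. real (b - 1) / real b ^ Suc l) sums 1"
proof -
  have "(\<lambda>l. real (b - 1) / real b * (1 / real b) ^ l) sums (real (b - 1) / real b * (1 / (1 - 1 / real b)))"
    using b by (intro sums_mult geometric_sums) auto
  moreover have "real (b - 1) / real b * (1 / (1 - 1 / real b)) = 1"
    using b by (simp add: of_nat_diff field_simps)
  moreover have "real (b - 1) / real b * (1 / real b) ^ l = real (b - 1) / real b ^ Suc l" for l
    by (simp add: power_one_over)
  ultimately show ?thesis
    by (simp only:)
qed

lemma expansion_term_le:
  assumes "\<forall>l. f l < b"
  shows "real (f l) / real b ^ Suc l \<le> real (b - 1) / real b ^ Suc l"
  using spec[OF assms, of l] by (intro divide_right_mono) auto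

lemma expansion_summable:
  assumes "\<forall>l. f l < b"
  shows "summable (\<lambda>l. real (f l) / real b ^ Suc l)"
  using expansion_term_le[OF assms]
  by (intro summable_comparison_test'[OF sums_summable[OF expansion_terms_sums], of 0]) simp

lemma expansion_nonneg:
  assumes "\<forall>l. f l < b"
  shows "0 \<le> expansion b f"
  unfolding expansion_def by (intro suminf_nonneg expansion_summable assms) auto

lemma expansion_le_1:
  assumes "\<forall>l. f l < b"
  shows "expansion b f \<le> 1"
  unfolding expansion_def
  by (rule order_trans[OF suminf_le[OF expansion_term_le[OF assms] expansion_summable[OF assms]
          sums_summable[OF expansion_terms_sums]]])
     (use sums_unique[OF expansion_terms_sums] in simp)

lemma expansion_Suc:
  assumes "\<forall>l. f l < b"
  shows "expansion b f = (real (f 0) + expansion b (\<lambda>l. f (Suc l))) / real b"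
proof -
  have "expansion b f = real (f 0) / b + (\<Sum>l. real (f (Suc l)) / real b ^ Suc (Suc l))"
    unfolding expansion_def
    using suminf_split_head[OF expansion_summable[OF assms]] by simp
  also have "(\<Sum>l. real (f (Suc l)) / real b ^ Suc (Suc l)) = expansion b (\<lambda>l. f (Suc l)) / b"
    unfolding expansion_def
    by (subst suminf_divide[symmetric]) (use expansion_summable[of "\<lambda>l. f (Suc l)"] assms in \<open>auto simp: field_simps\<close>)
  finally show ?thesis
    by (simp add: add_divide_distrib)
qed

lemma expansion_shift:
  assumes "\<forall>l. f l < b"
  shows "real b ^ k * expansion b f = real (place_value b f k) + expansion b (\<lambda>l. f (l + k))"
proof (induction k)
  case (Suc k)
  have "real b ^ Suc k * expansion b f = real b * (real b ^ k * expansion b f)"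
    by simp
  also have "\<dots> = real b * real (place_value b f k) + real b * expansion b (\<lambda>l. f (l + k))"
    by (simp only: Suc distrib_left)
  also have "real b * expansion b (\<lambda>l. f (l + k)) = real (f k) + expansion b (\<lambda>l. f (l + Suc k))"
    using expansion_Suc[of "\<lambda>l. f (l + k)"] assms b by simp
  finally show ?case
    by simp
qed simp

lemma expansion_bounds:
  assumes "\<forall>l. f l < b"
  shows "real (place_value b f k) \<le> real b ^ k * expansion b f"
    and "real b ^ k * expansion b f \<le> real (place_value b f k) + 1"
  using expansion_shift[OF assms, of k] expansion_nonneg[of "\<lambda>l. f (l + k)"]
    expansion_le_1[of "\<lambda>l. f (l + k)"] assms by simp_all

lemma expansion_pos:
  assumes "\<forall>l. f l < b" "f i \<noteq> 0"
  shows "0 < expansion b f"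
proof -
  have "1 \<le> place_value b f (Suc i)"
    using assms by simp
  then have "1 \<le> real b ^ Suc i * expansion b f"
    using expansion_bounds(1)[OF assms(1), of "Suc i"] by linarith
  then have "0 < real b ^ Suc i * expansion b f"
    by linarith
  then show ?thesis
    using expansion_nonneg[OF assms(1)] by (auto simp: zero_less_mult_iff)
qed

lemma expansion_complement:
  assumes "\<forall>l. f l < b"
  shows "expansion b (\<lambda>l. b - 1 - f l) = 1 - expansion b f"
proof -
  have "(\<Sum>l. real (b - 1) / real b ^ Suc l - real (f l) / real b ^ Suc l) = 1 - expansion b f"
    unfolding expansion_def
    by (subst suminf_diff[symmetric])
       (use sums_unique[OF expansion_terms_sums] sums_summable[OF expansion_terms_sums]
         expansion_summable[OF assms] in auto)
  moreover have "real (b - 1) / real b ^ Suc l - real (f l) / real b ^ Suc l = real (b - 1 - f l) / real b ^ Suc l" for l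
    using spec[OF assms, of l] by (simp add: of_nat_diff flip: diff_divide_distrib)
  ultimately show ?thesis
    unfolding expansion_def by simp
qed

lemma expansion_less_1:
  assumes "\<forall>l. f l < b" "f i \<noteq> b - 1"
  shows "expansion b f < 1"
proof -
  have "0 < expansion b (\<lambda>l. b - 1 - f l)"
  proof (rule expansion_pos)
    show "b - 1 - f i \<noteq> 0"
      using spec[OF assms(1), of i] assms(2) by linarith
    show "\<forall>l. b - 1 - f l < b"
      using b by auto
  qed
  then show ?thesis
    using expansion_complement assms by simp
qed

end

section \<open>Coding of carpets by digit sequences\<close>

definition codes :: "(nat \<times> nat) set \<Rightarrow> (nat \<Rightarrow> nat \<times> nat) set" where
  "codes D = {\<omega>. \<forall>l. \<omega> l \<in> D}"

definition coding_map :: "nat \<Rightarrow> nat \<Rightarrow> (nat \<Rightarrow> nat \<times> nat) \<Rightarrow> real \<times> real" where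
  "coding_map n m \<omega> = (expansion n (\<lambda>l. fst (\<omega> l)), expansion m (\<lambda>l. snd (\<omega> l)))"

lemma codesD: "\<omega> \<in> codes D \<Longrightarrow> \<omega> l \<in> D"
  by (simp add: codes_def)

lemma codes_shift: "\<omega> \<in> codes D \<Longrightarrow> (\<lambda>l. \<omega> (l + k)) \<in> codes D"
  by (simp add: codes_def)

lemma codes_Suc: "\<omega> \<in> codes D \<Longrightarrow> (\<lambda>l. \<omega> (Suc l)) \<in> codes D"
  by (simp add: codes_def)

lemma codes_case_nat: "case_nat d \<omega> \<in> codes D \<longleftrightarrow> d \<in> D \<and> \<omega> \<in> codes D"
  unfolding codes_def mem_Collect_eq by (metis nat.case(1,2) not0_implies_Suc)

locale carpet_digits =
  fixes n m :: nat and D :: "(nat \<times> nat) set"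
  assumes m: "2 \<le> m" and m_less_n: "m < n" and digit_set: "digit_set n m D"
begin

abbreviation "pt \<equiv> coding_map n m"

lemma n: "2 \<le> n"
  using m m_less_n by simp

lemma D_nonempty: "D \<noteq> {}"
  using digit_set by (simp add: digit_set_def)

lemma D_bounds: "d \<in> D \<Longrightarrow> fst d < n" "d \<in> D \<Longrightarrow> snd d < m"
  using digit_set by (auto simp: digit_set_def)

lemma finite_D: "finite D"
  using digit_set unfolding digit_set_def by (meson finite_SigmaI finite_atLeastLessThan finite_subset)

lemma codes_bounds:
  assumes "\<omega> \<in> codes D"
  shows "\<forall>l. fst (\<omega> l) < n" "\<forall>l. snd (\<omega> l) < m"
  using assms D_bounds by (auto simp: codes_def)

lemma codes_nonempty: "codes D \<noteq> {}"
proof -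
  obtain d where "d \<in> D"
    using D_nonempty by blast
  then have "(\<lambda>_. d) \<in> codes D"
    by (simp add: codes_def)
  then show ?thesis
    by blast
qed

lemma pt_Suc:
  assumes "\<omega> \<in> codes D"
  shows "pt \<omega> = affine_contraction n m (\<omega> 0) (pt (\<lambda>l. \<omega> (Suc l)))"
  using expansion_Suc[OF n codes_bounds(1)[OF assms]] expansion_Suc[OF m codes_bounds(2)[OF assms]]
  by (simp add: coding_map_def affine_contraction_def add.commute)

lemma pt_case_nat:
  assumes "d \<in> D" "\<omega> \<in> codes D"
  shows "pt (case_nat d \<omega>) = affine_contraction n m d (pt \<omega>)"
  using pt_Suc[of "case_nat d \<omega>"] assms by (simp add: codes_case_nat)

lemma codes_image_self_affine: "pt ` codes D = (\<Union>d\<in>D. affine_contraction n m d ` pt ` codes D)"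
proof (intro equalityI subsetI)
  fix z assume "z \<in> pt ` codes D"
  then obtain \<omega> where "z = pt \<omega>" "\<omega> \<in> codes D"
    by blast
  then show "z \<in> (\<Union>d\<in>D. affine_contraction n m d ` pt ` codes D)"
    using pt_Suc[of \<omega>] codes_Suc[of \<omega> D] codesD[of \<omega> D 0]
    by (intro UN_I[of "\<omega> 0"] image_eqI[where x = "pt (\<lambda>l. \<omega> (Suc l))"]) simp_all
next
  fix z assume "z \<in> (\<Union>d\<in>D. affine_contraction n m d ` pt ` codes D)"
  then obtain d \<omega> where "z = affine_contraction n m d (pt \<omega>)" "d \<in> D" "\<omega> \<in> codes D"
    by blast
  then show "z \<in> pt ` codes D"
    by (intro image_eqI[of _ _ "case_nat d \<omega>"]) (simp_all only: pt_case_nat codes_case_nat simp_thms)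
qed

lemma continuous_on_affine_contraction: "continuous_on A (affine_contraction n m d)"
  unfolding affine_contraction_def using m n by (intro continuous_intros) auto

lemma pt_bounds:
  assumes "\<omega> \<in> codes D"
  shows "0 \<le> fst (pt \<omega>)" "fst (pt \<omega>) \<le> 1" "0 \<le> snd (pt \<omega>)" "snd (pt \<omega>) \<le> 1"
  using expansion_nonneg[OF n] expansion_le_1[OF n] expansion_nonneg[OF m] expansion_le_1[OF m]
    codes_bounds[OF assms] by (auto simp: coding_map_def)

text \<open>Running the contractions backwards from a point of a bounded self-affine set expands the
  distance between that point and the point with the resulting code, so this distance vanishes.\<close>

lemma bounded_self_affine_coded:
  assumes K: "bounded K" "K \<subseteq> (\<Union>d\<in>D. affine_contraction n m d ` K)" and "z \<in> K"
  shows "z \<in> pt ` codes D"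
proof -
  have zero: "u 0 = 0" if B: "\<And>l. \<bar>u l\<bar> \<le> B" and u: "\<And>l. u l = u (Suc l) / real b" and b: "2 \<le> b"
    for u :: "nat \<Rightarrow> real" and B b
  proof (rule ccontr)
    assume "u 0 \<noteq> 0"
    have unfold: "u 0 = u l / real b ^ l" for l
    proof (induction l)
      case (Suc l)
      then show ?case
        using u[of l] by (simp add: divide_divide_eq_left)
    qed simp
    have "\<bar>u 0\<bar> * real b ^ l \<le> B" for l
      using B[of l] b arg_cong[OF unfold[of l], of abs] by (simp add: abs_divide)
    moreover obtain l where "B / \<bar>u 0\<bar> < real b ^ l"
      using real_arch_pow[of "real b" "B / \<bar>u 0\<bar>"] b by auto
    moreover from this have "B < \<bar>u 0\<bar> * real b ^ l"
      using \<open>u 0 \<noteq> 0\<close> by (simp add: pos_divide_less_eq mult.commute)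
    ultimately show False
      by (meson linorder_not_less)
  qed
  obtain p where p: "fst (p 0) = z" "\<And>l. fst (p l) \<in> K"
    "\<And>l. snd (p (Suc l)) \<in> D \<and> fst (p l) = affine_contraction n m (snd (p (Suc l))) (fst (p (Suc l)))"
  proof -
    have "\<exists>y. (fst y \<in> K \<and> (Suc l = 0 \<longrightarrow> fst y = z)) \<and> snd y \<in> D \<and> x = affine_contraction n m (snd y) (fst y)"
      if x: "x \<in> K" for x and l :: nat
    proof -
      obtain d w where "d \<in> D" "w \<in> K" "x = affine_contraction n m d w"
        using K(2) x by blast
      then show ?thesis
        by (intro exI[of _ "(w, d)"]) simp
    qed
    moreover have "\<exists>x::(real \<times> real) \<times> nat \<times> nat. fst x \<in> K \<and> ((0::nat) = 0 \<longrightarrow> fst x = z)"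
      by (rule exI[of _ "(z, _)"]) (use \<open>z \<in> K\<close> in simp)
    ultimately obtain p where "\<And>l. fst (p l) \<in> K \<and> (l = 0 \<longrightarrow> fst (p l) = z)"
      "\<And>l. snd (p (Suc l)) \<in> D \<and> fst (p l) = affine_contraction n m (snd (p (Suc l))) (fst (p (Suc l)))"
      using dependent_nat_choice[of "\<lambda>l x. fst x \<in> K \<and> (l = 0 \<longrightarrow> fst x = z)"
          "\<lambda>l x y. snd y \<in> D \<and> fst x = affine_contraction n m (snd y) (fst y)"] by metis
    then show ?thesis
      using that by blast
  qed
  define \<omega> where "\<omega> l = snd (p (Suc l))" for l
  have \<omega>: "\<omega> \<in> codes D"
    using p(3) by (simp add: codes_def \<omega>_def)
  define q where "q l = pt (\<lambda>i. \<omega> (i + l))" for l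
  have q: "q l = affine_contraction n m (\<omega> l) (q (Suc l))" for l
    using pt_Suc[OF codes_shift[OF \<omega>, of l]] by (simp add: q_def)
  obtain B where B: "norm x \<le> B" if "x \<in> K" for x
    using K(1) bounded_iff by blast
  have "norm (q l) \<le> 2" for l
    using pt_bounds[OF codes_shift[OF \<omega>, of l]] norm_Pair_le[of "fst (q l)" "snd (q l)"]
    by (simp add: q_def)
  then have le: "norm (fst (p l) - q l) \<le> B + 2" for l
    using B[OF p(2)[of l]] norm_triangle_ineq4[of "fst (p l)" "q l"] by (smt (verit))
  have "fst (fst (p 0) - q 0) = 0"
  proof (rule zero[of "\<lambda>l. fst (fst (p l) - q l)" "B + 2" n])
    show "\<bar>fst (fst (p l) - q l)\<bar> \<le> B + 2" for l
      using le[of l] norm_fst_le[of "fst (fst (p l) - q l)" "snd (fst (p l) - q l)"]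
      by (simp add: minus_prod_def)
    show "fst (fst (p l) - q l) = fst (fst (p (Suc l)) - q (Suc l)) / real n" for l
      using p(3)[of l] q[of l] by (simp add: affine_contraction_def \<omega>_def diff_divide_distrib[symmetric])
  qed (rule n)
  moreover have "snd (fst (p 0) - q 0) = 0"
  proof (rule zero[of "\<lambda>l. snd (fst (p l) - q l)" "B + 2" m])
    show "\<bar>snd (fst (p l) - q l)\<bar> \<le> B + 2" for l
      using le[of l] norm_snd_le[of "snd (fst (p l) - q l)" "fst (fst (p l) - q l)"]
      by (simp add: minus_prod_def)
    show "snd (fst (p l) - q l) = snd (fst (p (Suc l)) - q (Suc l)) / real m" for l
      using p(3)[of l] q[of l] by (simp add: affine_contraction_def \<omega>_def diff_divide_distrib[symmetric])
  qed (rule m)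
  ultimately have "z = pt \<omega>"
    using p(1) by (simp add: prod_eq_iff q_def)
  then show ?thesis
    using \<omega> by blast
qed

lemma coded_in_closed_self_affine:
  assumes K: "closed K" "K \<noteq> {}" "(\<Union>d\<in>D. affine_contraction n m d ` K) \<subseteq> K"
    and "\<omega> \<in> codes D"
  shows "pt \<omega> \<in> K"
proof -
  obtain z where "z \<in> K"
    using K(2) by blast
  define B where "B = norm z + 2"
  have B: "\<bar>fst z - fst (pt \<omega>)\<bar> \<le> B" "\<bar>snd z - snd (pt \<omega>)\<bar> \<le> B" if "\<omega> \<in> codes D" for \<omega>
    using pt_bounds[OF that] norm_fst_le[of "fst z" "snd z"] norm_snd_le[of "snd z" "fst z"] by (auto simp: B_def)
  have halve: "\<bar>u / real b\<bar> \<le> B / 2 ^ Suc l" if "\<bar>u\<bar> \<le> B / 2 ^ l" "2 \<le> b" for u b l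
  proof -
    have "\<bar>u\<bar> / real b \<le> \<bar>u\<bar> / 2"
      using that by (intro divide_left_mono) auto
    also have "\<dots> \<le> B / 2 ^ l / 2"
      using that by (intro divide_right_mono) auto
    finally show ?thesis
      by (simp add: field_simps)
  qed
  have approx: "\<exists>z'\<in>K. \<bar>fst z' - fst (pt \<omega>)\<bar> \<le> B / 2 ^ l \<and> \<bar>snd z' - snd (pt \<omega>)\<bar> \<le> B / 2 ^ l"
    if "\<omega> \<in> codes D" for l \<omega>
    using that
  proof (induction l arbitrary: \<omega>)
    case 0
    then show ?case
      using B[OF 0] \<open>z \<in> K\<close> by auto
  next
    case (Suc l)
    then obtain z' where z': "z' \<in> K" "\<bar>fst z' - fst (pt (\<lambda>l. \<omega> (Suc l)))\<bar> \<le> B / 2 ^ l"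
      "\<bar>snd z' - snd (pt (\<lambda>l. \<omega> (Suc l)))\<bar> \<le> B / 2 ^ l"
      using codes_Suc by blast
    have "affine_contraction n m (\<omega> 0) z' \<in> K"
      using K(3) z'(1) codesD[OF Suc.prems] by blast
    moreover have "fst (affine_contraction n m (\<omega> 0) z') - fst (pt \<omega>)
        = (fst z' - fst (pt (\<lambda>l. \<omega> (Suc l)))) / real n"
      "snd (affine_contraction n m (\<omega> 0) z') - snd (pt \<omega>)
        = (snd z' - snd (pt (\<lambda>l. \<omega> (Suc l)))) / real m"
      using pt_Suc[OF Suc.prems] by (auto simp: affine_contraction_def diff_divide_distrib[symmetric])
    ultimately show ?case
      using halve[OF z'(2) n] halve[OF z'(3) m] by (metis (no_types))
  qed
  have "\<exists>z'\<in>K. dist z' (pt \<omega>) < e" if "e > 0" for e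
  proof -
    obtain l where "2 * B / e < 2 ^ l"
      using real_arch_pow[of 2 "2 * B / e"] by auto
    then have l: "B / 2 ^ l < e / 2"
      using that by (simp add: field_simps)
    obtain z' where z': "z' \<in> K" "\<bar>fst z' - fst (pt \<omega>)\<bar> \<le> B / 2 ^ l" "\<bar>snd z' - snd (pt \<omega>)\<bar> \<le> B / 2 ^ l"
      using approx[OF \<open>\<omega> \<in> codes D\<close>] by blast
    have "dist z' (pt \<omega>) \<le> \<bar>fst z' - fst (pt \<omega>)\<bar> + \<bar>snd z' - snd (pt \<omega>)\<bar>"
      using norm_Pair_le[of "fst (z' - pt \<omega>)" "snd (z' - pt \<omega>)"] by (simp add: dist_norm minus_prod_def)
    then show ?thesis
      using z' l by (intro bexI[OF _ z'(1)]) linarith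
  qed
  then show ?thesis
    using K(1) closure_approachable[of "pt \<omega>" K] by (simp add: closure_closed)
qed

lemma codes_image_compact: "compact (pt ` codes D)"
proof -
  let ?C = "pt ` codes D" and ?S = "affine_contraction n m"
  have "norm z \<le> 2" if "z \<in> ?C" for z
    using that pt_bounds norm_Pair_le[of "fst z" "snd z"] by fastforce
  then have bounded: "bounded ?C"
    unfolding bounded_iff by blast
  then have compact: "compact (closure ?C)"
    by (simp add: compact_eq_bounded_closed bounded_closure)
  have "compact (\<Union>d\<in>D. ?S d ` closure ?C)"
    by (intro compact_UN finite_D ballI compact_continuous_image continuous_on_affine_contraction compact)
  moreover have "?C \<subseteq> (\<Union>d\<in>D. ?S d ` closure ?C)"
    using codes_image_self_affine closure_subset[of ?C] by blast
  ultimately have "closure ?C \<subseteq> (\<Union>d\<in>D. ?S d ` closure ?C)"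
    by (intro closure_minimal compact_imp_closed)
  then have "closure ?C \<subseteq> ?C"
    using bounded_self_affine_coded[of "closure ?C"] bounded by blast
  then show ?thesis
    using compact closure_subset[of ?C] by (metis subset_antisym)
qed

theorem carpet_eq: "carpet n m D = pt ` codes D"
  unfolding carpet_def
proof (rule the_equality)
  show "pt ` codes D \<noteq> {} \<and> compact (pt ` codes D)
      \<and> pt ` codes D = (\<Union>d\<in>D. affine_contraction n m d ` pt ` codes D)"
    using codes_nonempty codes_image_compact codes_image_self_affine by blast
next
  fix K assume K: "K \<noteq> {} \<and> compact K \<and> K = (\<Union>d\<in>D. affine_contraction n m d ` K)"
  then show "K = pt ` codes D"
    using bounded_self_affine_coded[of K] coded_in_closed_self_affine[of K]
    by (auto simp: compact_imp_bounded compact_imp_closed)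
qed

lemma carpet_compact: "compact (carpet n m D)"
  using codes_image_compact carpet_eq by simp

lemma carpet_nonempty: "carpet n m D \<noteq> {}"
  using codes_nonempty carpet_eq by simp

text \<open>A full row of digits generates a horizontal segment, which no totally disconnected set contains.\<close>

lemma totally_disconnected_row_less:
  assumes "totally_disconnected (carpet n m D)" and "j < m"
  shows "distribution_seq D j < n"
proof (rule ccontr)
  assume "\<not> distribution_seq D j < n"
  have "{i. (i, j) \<in> D} \<subseteq> {..<n}"
    using D_bounds by auto
  moreover from this have "card {i. (i, j) \<in> D} = card {..<n}"
    using \<open>\<not> distribution_seq D j < n\<close> card_mono[of "{..<n}" "{i. (i, j) \<in> D}"]
    by (simp add: distribution_seq_def)
  ultimately have "{i. (i, j) \<in> D} = {..<n}"
    by (intro card_subset_eq) auto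
  then have row: "(i, j) \<in> D" if "i < n" for i
    using that by blast
  define R where "R = {..<n} \<times> {j}"
  interpret R: carpet_digits n m R
    using m m_less_n \<open>j < m\<close> by unfold_locales (auto simp: R_def digit_set_def)
  define y where "y = real j / (real m - 1)"
  define L :: "(real \<times> real) set" where "L = {0..1} \<times> {y}"
  have y: "(y + real j) / real m = y"
    using m by (simp add: y_def field_simps)
  have "L \<subseteq> (\<Union>d\<in>R. affine_contraction n m d ` L)"
  proof
    fix z assume "z \<in> L"
    then obtain x where x: "z = (x, y)" "0 \<le> x" "x \<le> 1"
      by (auto simp: L_def)
    define i where "i = min (nat \<lfloor>real n * x\<rfloor>) (n - 1)"
    have i: "i < n" "0 \<le> real n * x - real i" "real n * x - real i \<le> 1"
    proof -
      show "i < n"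
        using n by (simp add: i_def)
      have "real n * x \<le> real n"
        using x(3) by (simp add: mult_left_le)
      then show "0 \<le> real n * x - real i" "real n * x - real i \<le> 1"
        using x(2) n unfolding i_def by (auto simp: min_def of_nat_diff) linarith+
    qed
    have "z = affine_contraction n m (i, j) (real n * x - real i, y)"
      using x(1) y n by (simp add: affine_contraction_def)
    then show "z \<in> (\<Union>d\<in>R. affine_contraction n m d ` L)"
      using i by (intro UN_I[of "(i, j)"] image_eqI[of _ _ "(real n * x - real i, y)"]) (auto simp: R_def L_def)
  qed
  moreover have "bounded L"
    by (auto simp: L_def intro!: bounded_Times)
  ultimately have "L \<subseteq> pt ` codes R"
    using R.bounded_self_affine_coded by blast
  moreover have "codes R \<subseteq> codes D"
  proof -
    have "R \<subseteq> D"
      using row by (auto simp: R_def)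
    then show ?thesis
      by (auto simp: codes_def)
  qed
  ultimately have sub: "L \<subseteq> carpet n m D"
    using carpet_eq by blast
  have "connected L"
    by (simp add: L_def connected_Times)
  moreover have "(0, y) \<in> L" "(1, y) \<in> L"
    by (auto simp: L_def)
  ultimately have "(1, y) \<in> connected_component_set (carpet n m D) (0, y)"
    using sub connected_component_maximal[of "(0, y)" L "carpet n m D"] by blast
  moreover have "connected_component_set (carpet n m D) (0, y) = {(0, y)}"
    using assms(1) sub \<open>(0, y) \<in> L\<close> unfolding totally_disconnected_def by blast
  ultimately show False
    by simp
qed

end

text \<open>The fixed point of a contraction has a constant code. Each of its coordinates is 0, is 1, or lies
  strictly inside its digit interval, so no other code of the same point can begin differently. This
  is why a carpet determines its digit set.\<close>

lemma expansion_const_first_digit: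
  assumes b: "2 \<le> b" and c: "c < b" and g: "\<forall>l. g l < b"
    and eq: "expansion b (\<lambda>_. c) = expansion b g"
  shows "g 0 = c"
proof -
  have const: "\<forall>l. (\<lambda>_::nat. c) l < b" and tail: "\<forall>l. (\<lambda>l. g (Suc l)) l < b"
    using c g by auto
  consider "c = 0" | "c = b - 1" | "c \<noteq> 0" "c \<noteq> b - 1"
    by blast
  then show ?thesis
  proof cases
    case 1
    then have "expansion b g = 0"
      using eq by (simp add: expansion_def)
    then show ?thesis
      using expansion_pos[OF b g, of 0] 1 by auto
  next
    case 2
    then have "expansion b g = 1"
      using eq sums_unique[OF expansion_terms_sums[OF b]] by (simp add: expansion_def)
    then show ?thesis
      using expansion_less_1[OF b g, of 0] 2 by auto
  next
    case 3
    then have "0 < expansion b (\<lambda>_. c)" "expansion b (\<lambda>_. c) < 1"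
      using expansion_pos[OF b const] expansion_less_1[OF b const] by auto
    moreover have "real c + expansion b (\<lambda>_. c) = real (g 0) + expansion b (\<lambda>l. g (Suc l))"
      using eq expansion_Suc[OF b const] expansion_Suc[OF b g] b by simp
    moreover have "0 \<le> expansion b (\<lambda>l. g (Suc l))" "expansion b (\<lambda>l. g (Suc l)) \<le> 1"
      using expansion_nonneg[OF b tail] expansion_le_1[OF b tail] by auto
    ultimately show ?thesis
      by linarith
  qed
qed

lemma carpet_digits_subset:
  assumes "carpet_digits n m D" "carpet_digits n m D'" and eq: "carpet n m D = carpet n m D'"
  shows "D \<subseteq> D'"
proof
  interpret carpet_digits n m D by fact
  interpret D': carpet_digits n m D' by fact
  fix d assume "d \<in> D"
  define \<omega> where "\<omega> = (\<lambda>_::nat. d)"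
  have "\<omega> \<in> codes D"
    using \<open>d \<in> D\<close> by (simp add: \<omega>_def codes_def)
  then obtain \<omega>' where \<omega>': "\<omega>' \<in> codes D'" "pt \<omega> = pt \<omega>'"
    using eq carpet_eq D'.carpet_eq by blast
  have "fst (\<omega>' 0) = fst d"
    using \<omega>'(2) expansion_const_first_digit[OF n D_bounds(1)[OF \<open>d \<in> D\<close>] D'.codes_bounds(1)[OF \<omega>'(1)]]
    by (simp add: coding_map_def \<omega>_def)
  moreover have "snd (\<omega>' 0) = snd d"
    using \<omega>'(2) expansion_const_first_digit[OF m D_bounds(2)[OF \<open>d \<in> D\<close>] D'.codes_bounds(2)[OF \<omega>'(1)]]
    by (simp add: coding_map_def \<omega>_def)
  ultimately have "\<omega>' 0 = d"
    by (simp add: \<omega>_def prod_eq_iff)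
  then show "d \<in> D'"
    using codesD[OF \<omega>'(1), of 0] by simp
qed

lemma carpet_inj:
  assumes "carpet_digits n m D" "carpet_digits n m D'" "carpet n m D = carpet n m D'"
  shows "D = D'"
  using carpet_digits_subset[OF assms] carpet_digits_subset[OF assms(2,1) assms(3)[symmetric]]
  by (rule equalityI)

section \<open>Approximate squares\<close>

definition depth_ratio :: "nat \<Rightarrow> nat \<Rightarrow> real" where
  "depth_ratio n m = ln (real m) / ln (real n)"

text \<open>At level \<open>k\<close>, rows have height \<open>m ^ - k\<close>; \<open>x_level n m k\<close> is the number of horizontal digits for
  which columns have about this width, between \<open>m ^ - k\<close> and \<open>n * m ^ - k\<close>.\<close>

definition x_level :: "nat \<Rightarrow> nat \<Rightarrow> nat \<Rightarrow> nat" where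
  "x_level n m k = nat \<lfloor>real k * depth_ratio n m\<rfloor>"

lemma abs_mult_diff_pos: "0 < p \<Longrightarrow> \<bar>p * x - p * y\<bar> = p * \<bar>x - y\<bar>" for p x y :: real
  by (simp add: abs_mult flip: right_diff_distrib)

context carpet_digits
begin

abbreviation "lv \<equiv> x_level n m"
abbreviation "\<sigma> \<equiv> depth_ratio n m"

lemma \<sigma>_bounds: "0 < \<sigma>" "\<sigma> < 1"
  using m m_less_n by (auto simp: depth_ratio_def divide_simps)

lemma lv_bounds: "real (lv k) \<le> real k * \<sigma>" "real k * \<sigma> < real (lv k) + 1"
  using \<sigma>_bounds unfolding x_level_def by (simp_all add: of_nat_nat)

lemma
  shows lv_le_power: "real n ^ lv k \<le> real m ^ k"
    and power_less_lv: "real m ^ k < real n * real n ^ lv k"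
proof -
  have ln: "0 < ln (real n)" "0 < real n" "0 < real m"
    using n m by auto
  have "real (lv k) * ln (real n) \<le> real k * ln (real m)" "real k * ln (real m) < (real (lv k) + 1) * ln (real n)"
    using lv_bounds[of k] ln by (simp_all add: depth_ratio_def field_simps)
  then have "ln (real n ^ lv k) \<le> ln (real m ^ k)" "ln (real m ^ k) < ln (real n * real n ^ lv k)"
    using ln by (simp_all add: ln_realpow ln_mult algebra_simps)
  then show "real n ^ lv k \<le> real m ^ k" "real m ^ k < real n * real n ^ lv k"
    using ln by (simp_all only: ln_le_cancel_iff ln_less_cancel_iff zero_less_power mult_pos_pos)
qed

lemma lv_le: "lv k \<le> k"
proof -
  have "real k * \<sigma> \<le> real k * 1"
    using \<sigma>_bounds by (intro mult_left_mono) auto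
  then show ?thesis
    using lv_bounds(1)[of k] by linarith
qed

lemma lv_less: "0 < k \<Longrightarrow> lv k < k"
proof -
  assume "0 < k"
  then have "real k * \<sigma> < real k * 1"
    using \<sigma>_bounds by (intro mult_strict_left_mono) auto
  then show ?thesis
    using lv_bounds(1)[of k] by linarith
qed

lemma lv_mono: "k \<le> k' \<Longrightarrow> lv k \<le> lv k'"
  unfolding x_level_def using \<sigma>_bounds by (intro nat_mono floor_mono mult_right_mono) auto

lemma lv_add_le: "lv (k + c) \<le> lv k + c"
proof -
  have "real c * \<sigma> \<le> real c * 1"
    using \<sigma>_bounds by (intro mult_left_mono) auto
  then have "real (lv (k + c)) < real (lv k) + 1 + real c"
    using lv_bounds(1)[of "k + c"] lv_bounds(2)[of k] by (simp add: distrib_right)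
  then show ?thesis
    by linarith
qed

lemma lv_unbounded: "\<exists>k0. \<forall>k\<ge>k0. l \<le> lv k"
proof (intro exI allI impI)
  fix k assume "nat \<lceil>real l / \<sigma>\<rceil> \<le> k"
  then have "real l / \<sigma> \<le> real k"
    by linarith
  then have "real l \<le> real k * \<sigma>"
    using \<sigma>_bounds by (simp only: pos_divide_le_eq)
  then have "real l < real (lv k) + 1"
    using lv_bounds(2)[of k] by linarith
  then show "l \<le> lv k"
    by linarith
qed

lemma gap_unbounded: "\<exists>k0. \<forall>k\<ge>k0. l \<le> k - lv k"
proof (intro exI allI impI)
  fix k assume "nat \<lceil>real l / (1 - \<sigma>)\<rceil> \<le> k"
  then have "real l / (1 - \<sigma>) \<le> real k"
    by linarith
  then have "real l \<le> real k * (1 - \<sigma>)"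
    using \<sigma>_bounds by (simp only: pos_divide_le_eq diff_gt_0_iff_gt)
  then show "l \<le> k - lv k"
    using lv_bounds(1)[of k] by (simp add: right_diff_distrib)
qed

definition x_index :: "nat \<Rightarrow> (nat \<Rightarrow> nat \<times> nat) \<Rightarrow> nat" where
  "x_index k \<omega> = place_value n (\<lambda>l. fst (\<omega> l)) (lv k)"

definition y_index :: "nat \<Rightarrow> (nat \<Rightarrow> nat \<times> nat) \<Rightarrow> nat" where
  "y_index k \<omega> = place_value m (\<lambda>l. snd (\<omega> l)) k"

definition square :: "nat \<Rightarrow> (nat \<Rightarrow> nat \<times> nat) \<Rightarrow> nat \<times> nat" where
  "square k \<omega> = (x_index k \<omega>, y_index k \<omega>)"

lemma square_eq_iff:
  assumes "\<omega> \<in> codes D" "\<omega>' \<in> codes D"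
  shows "square k \<omega> = square k \<omega>' \<longleftrightarrow> (\<forall>l<k. snd (\<omega> l) = snd (\<omega>' l) \<and> (l < lv k \<longrightarrow> \<omega> l = \<omega>' l))"
  using place_value_eq_iff[OF codes_bounds(1)[OF assms(1)] codes_bounds(1)[OF assms(2)], of "lv k"]
    place_value_eq_iff[OF codes_bounds(2)[OF assms(1)] codes_bounds(2)[OF assms(2)], of k] lv_le[of k]
  by (auto simp: square_def x_index_def y_index_def prod_eq_iff)

lemma finite_squares: "finite (square k ` A)" if "A \<subseteq> codes D"
proof (rule finite_subset)
  show "square k ` A \<subseteq> {..<n ^ lv k} \<times> {..<m ^ k}"
  proof (rule image_subsetI)
    fix \<omega> assume "\<omega> \<in> A"
    then have "\<omega> \<in> codes D"
      using that by blast
    then show "square k \<omega> \<in> {..<n ^ lv k} \<times> {..<m ^ k}"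
      using codes_bounds by (simp add: square_def x_index_def y_index_def place_value_less)
  qed
qed simp

lemma x_index_bounds:
  assumes "\<omega> \<in> codes D"
  shows "real (x_index k \<omega>) \<le> real n ^ lv k * fst (pt \<omega>)" "real n ^ lv k * fst (pt \<omega>) \<le> real (x_index k \<omega>) + 1"
  using expansion_bounds[OF n codes_bounds(1)[OF assms], of "lv k"] by (simp_all add: x_index_def coding_map_def)

lemma y_index_bounds:
  assumes "\<omega> \<in> codes D"
  shows "real (y_index k \<omega>) \<le> real m ^ k * snd (pt \<omega>)" "real m ^ k * snd (pt \<omega>) \<le> real (y_index k \<omega>) + 1"
  using expansion_bounds[OF m codes_bounds(2)[OF assms], of k] by (simp_all add: y_index_def coding_map_def)

lemma dist_coordinates:
  fixes z w :: "real \<times> real"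
  shows "\<bar>fst z - fst w\<bar> \<le> dist z w" "\<bar>snd z - snd w\<bar> \<le> dist z w"
    "dist z w \<le> \<bar>fst z - fst w\<bar> + \<bar>snd z - snd w\<bar>"
  using norm_fst_le[of "fst z - fst w" "snd z - snd w"] norm_snd_le[of "snd z - snd w" "fst z - fst w"]
    norm_Pair_le[of "fst z - fst w" "snd z - snd w"]
  by (simp_all add: dist_norm minus_prod_def)

lemma index_dist:
  assumes "\<omega> \<in> codes D" "\<omega>' \<in> codes D" and d: "dist (pt \<omega>) (pt \<omega>') \<le> c / real m ^ k"
  shows "\<bar>real (x_index k \<omega>) - real (x_index k \<omega>')\<bar> \<le> c + 1"
    and "\<bar>real (y_index k \<omega>) - real (y_index k \<omega>')\<bar> \<le> c + 1"
proof -
  have pos: "0 < real m ^ k" "0 < real n ^ lv k"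
    using m n by simp_all
  have "\<bar>snd (pt \<omega>) - snd (pt \<omega>')\<bar> * real m ^ k \<le> c"
    using dist_coordinates(2)[of "pt \<omega>" "pt \<omega>'"] d pos by (simp add: pos_le_divide_eq[symmetric])
  then have "\<bar>real m ^ k * snd (pt \<omega>) - real m ^ k * snd (pt \<omega>')\<bar> \<le> c"
    unfolding abs_mult_diff_pos[OF pos(1)] abs_mult_diff_pos[OF pos(2)] by (simp add: mult.commute)
  then show "\<bar>real (y_index k \<omega>) - real (y_index k \<omega>')\<bar> \<le> c + 1"
    using y_index_bounds[OF assms(1), of k] y_index_bounds[OF assms(2), of k] by linarith
  have "\<bar>fst (pt \<omega>) - fst (pt \<omega>')\<bar> * real n ^ lv k \<le> \<bar>fst (pt \<omega>) - fst (pt \<omega>')\<bar> * real m ^ k"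
    using lv_le_power by (intro mult_left_mono) auto
  also have "\<dots> \<le> c"
    using dist_coordinates(1)[of "pt \<omega>" "pt \<omega>'"] d pos by (simp add: pos_le_divide_eq[symmetric])
  finally have "\<bar>real n ^ lv k * fst (pt \<omega>) - real n ^ lv k * fst (pt \<omega>')\<bar> \<le> c"
    unfolding abs_mult_diff_pos[OF pos(1)] abs_mult_diff_pos[OF pos(2)] by (simp add: mult.commute)
  then show "\<bar>real (x_index k \<omega>) - real (x_index k \<omega>')\<bar> \<le> c + 1"
    using x_index_bounds[OF assms(1), of k] x_index_bounds[OF assms(2), of k] by linarith
qed

lemma dist_index:
  assumes "\<omega> \<in> codes D" "\<omega>' \<in> codes D"
    and "\<bar>real (x_index k \<omega>) - real (x_index k \<omega>')\<bar> \<le> c"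
    and "\<bar>real (y_index k \<omega>) - real (y_index k \<omega>')\<bar> \<le> c"
  shows "dist (pt \<omega>) (pt \<omega>') \<le> (c + 1) * (real n + 1) / real m ^ k"
proof -
  have pos: "0 < real m ^ k" "0 < real n ^ lv k"
    using m n by simp_all
  have c: "0 \<le> c"
    using assms(3) by linarith
  have "\<bar>real m ^ k * snd (pt \<omega>) - real m ^ k * snd (pt \<omega>')\<bar> \<le> c + 1"
    using assms(4) y_index_bounds[OF assms(1), of k] y_index_bounds[OF assms(2), of k] by linarith
  then have y: "\<bar>snd (pt \<omega>) - snd (pt \<omega>')\<bar> \<le> (c + 1) / real m ^ k"
    unfolding abs_mult_diff_pos[OF pos(1)] abs_mult_diff_pos[OF pos(2)]
    using pos by (simp add: pos_le_divide_eq mult.commute)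
  have "\<bar>real n ^ lv k * fst (pt \<omega>) - real n ^ lv k * fst (pt \<omega>')\<bar> \<le> c + 1"
    using assms(3) x_index_bounds[OF assms(1), of k] x_index_bounds[OF assms(2), of k] by linarith
  then have x: "\<bar>fst (pt \<omega>) - fst (pt \<omega>')\<bar> \<le> (c + 1) / real n ^ lv k"
    unfolding abs_mult_diff_pos[OF pos(1)] abs_mult_diff_pos[OF pos(2)]
    using pos by (simp add: pos_le_divide_eq mult.commute)
  have "(c + 1) / real n ^ lv k \<le> (c + 1) * real n / real m ^ k"
    using power_less_lv[of k] pos c n by (simp add: divide_simps mult_left_mono mult.assoc less_imp_le)
  then have "dist (pt \<omega>) (pt \<omega>') \<le> (c + 1) * real n / real m ^ k + (c + 1) / real m ^ k"
    using dist_coordinates(3)[of "pt \<omega>" "pt \<omega>'"] x y by linarith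
  then show ?thesis
    by (simp add: add_divide_distrib distrib_left)
qed

lemma square_eq_dist:
  assumes "\<omega> \<in> codes D" "\<omega>' \<in> codes D" "square k \<omega> = square k \<omega>'"
  shows "dist (pt \<omega>) (pt \<omega>') \<le> (real n + 1) / real m ^ k"
  using dist_index[OF assms(1,2), of k 0] assms(3) by (simp add: square_def)

section \<open>The uniform measure on digit sequences\<close>

definition code_measure :: "(nat \<times> nat) stream measure" where
  "code_measure = stream_space (uniform_count_measure D)"

definition mass :: "(real \<times> real) set \<Rightarrow> real" where
  "mass A = measure code_measure {s \<in> space code_measure. pt (snth s) \<in> A}"

definition square_mass :: "nat \<Rightarrow> nat \<times> nat \<Rightarrow> real" where
  "square_mass k Q = measure code_measure {s \<in> space code_measure. square k (snth s) = Q}"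

definition saturated :: "nat \<Rightarrow> (real \<times> real) set \<Rightarrow> bool" where
  "saturated k A \<longleftrightarrow>
     (\<forall>\<omega>\<in>codes D. \<forall>\<omega>'\<in>codes D. square k \<omega> = square k \<omega>' \<longrightarrow> pt \<omega> \<in> A \<longrightarrow> pt \<omega>' \<in> A)"

definition weight :: "nat \<Rightarrow> (nat \<Rightarrow> nat \<times> nat) \<Rightarrow> real" where
  "weight k \<omega> = (\<Prod>l<k. if l < lv k then 1 else real (distribution_seq D (snd (\<omega> l)))) / real (card D) ^ k"

sublocale digit: prob_space "uniform_count_measure D"
  by (rule prob_space_uniform_count_measure[OF finite_D D_nonempty])

sublocale code: prob_space code_measure
  unfolding code_measure_def by (rule digit.prob_space_stream_space)

lemma space_code_measure: "space code_measure = streams D"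
  by (simp add: code_measure_def space_stream_space space_uniform_count_measure)

lemma snth_codes: "s \<in> space code_measure \<Longrightarrow> snth s \<in> codes D"
  by (auto simp: space_code_measure codes_def snth_in)

lemma card_D_pos: "0 < card D"
  using finite_D D_nonempty by (simp add: card_gt_0_iff)

lemma measurable_cylinder: "{s \<in> space code_measure. \<forall>l<k. s !! l \<in> B l} \<in> sets code_measure"
proof -
  have "(\<lambda>s. s !! l) \<in> measurable code_measure (uniform_count_measure D)" for l
    unfolding code_measure_def by measurable
  then have "(\<lambda>s. s !! l) -` (B l \<inter> D) \<inter> space code_measure \<in> sets code_measure" for l
    by (rule measurable_sets) (simp add: sets_uniform_count_measure)
  moreover have "(\<lambda>s. s !! l) -` (B l \<inter> D) \<inter> space code_measure = {s \<in> space code_measure. s !! l \<in> B l}" for l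
    by (auto simp: space_code_measure snth_in)
  ultimately have "{s \<in> space code_measure. s !! l \<in> B l} \<in> sets code_measure" for l
    by simp
  then have "{s \<in> space code_measure. \<forall>l\<in>{..<k}. s !! l \<in> B l} \<in> sets code_measure"
    by (intro sets.sets_Collect_finite_All) auto
  then show ?thesis
    by (simp only: Ball_def lessThan_iff)
qed

lemma measure_cylinder:
  "measure code_measure {s \<in> space code_measure. \<forall>l<k. s !! l \<in> B l}
     = (\<Prod>l<k. real (card (B l \<inter> D)) / real (card D))"
proof (induction k arbitrary: B)
  case 0
  have "{s \<in> space code_measure. \<forall>l<0. s !! l \<in> B l} = space code_measure"
    by blast
  then show ?case
    by (simp only: code.prob_space lessThan_0 prod.empty)
next
  case (Suc k)
  let ?c = "\<Prod>l<k. real (card (B (Suc l) \<inter> D)) / real (card D)"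
  let ?A = "\<lambda>k B. {s \<in> space code_measure. \<forall>l<k. s !! l \<in> B l}"
  have "emeasure code_measure (?A (Suc k) B)
      = (\<integral>\<^sup>+t. emeasure code_measure {s \<in> space code_measure. t ## s \<in> ?A (Suc k) B} \<partial>uniform_count_measure D)"
    using digit.emeasure_stream_space[folded code_measure_def, OF measurable_cylinder[of "Suc k" B]] .
  also have "\<dots> = (\<integral>\<^sup>+t. ennreal ?c * indicator (B 0 \<inter> D) t \<partial>uniform_count_measure D)"
  proof (rule nn_integral_cong)
    fix t assume "t \<in> space (uniform_count_measure D)"
    then have t: "t \<in> D"
      by (simp add: space_uniform_count_measure)
    have "{s \<in> space code_measure. t ## s \<in> ?A (Suc k) B} = (if t \<in> B 0 then ?A k (\<lambda>l. B (Suc l)) else {})"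
      using t by (auto simp: space_code_measure streams_Stream less_Suc_eq_0_disj)
    then show "emeasure code_measure {s \<in> space code_measure. t ## s \<in> ?A (Suc k) B}
        = ennreal ?c * indicator (B 0 \<inter> D) t"
      using Suc[of "\<lambda>l. B (Suc l)"] t by (simp add: code.emeasure_eq_measure)
  qed
  also have "\<dots> = ennreal ?c * emeasure (uniform_count_measure D) (B 0 \<inter> D)"
    by (rule nn_integral_cmult_indicator) (simp add: sets_uniform_count_measure)
  also have "\<dots> = ennreal (?c * (real (card (B 0 \<inter> D)) / real (card D)))"
    using finite_D by (simp add: emeasure_uniform_count_measure ennreal_mult'' del: times_divide_eq_right)
  also have "?c * (real (card (B 0 \<inter> D)) / real (card D)) = (\<Prod>l<Suc k. real (card (B l \<inter> D)) / real (card D))"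
    by (subst prod.lessThan_Suc_shift) (simp add: mult.commute)
  finally show ?case
    by (simp add: code.emeasure_eq_measure prod_nonneg)
qed

lemma distribution_seq_row: "card ({d. snd d = j} \<inter> D) = distribution_seq D j"
proof -
  have "{d. snd d = j} \<inter> D = (\<lambda>i. (i, j)) ` {i. (i, j) \<in> D}"
    by auto
  moreover have "inj_on (\<lambda>i. (i, j)) {i. (i, j) \<in> D}"
    by (rule inj_onI) simp
  ultimately show ?thesis
    unfolding distribution_seq_def by (simp only: card_image)
qed

lemma square_cylinder:
  assumes "\<omega> \<in> codes D"
  shows "{s \<in> space code_measure. square k (snth s) = square k \<omega>}
    = {s \<in> space code_measure. \<forall>l<k. s !! l \<in> (if l < lv k then {\<omega> l} else {d. snd d = snd (\<omega> l)})}"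
proof (intro Collect_cong conj_cong refl)
  fix s assume s: "s \<in> space code_measure"
  have "s !! l \<in> (if l < lv k then {\<omega> l} else {d. snd d = snd (\<omega> l)})
      \<longleftrightarrow> snd (s !! l) = snd (\<omega> l) \<and> (l < lv k \<longrightarrow> s !! l = \<omega> l)" for l
    by (cases "l < lv k") auto
  then show "square k (snth s) = square k \<omega>
      \<longleftrightarrow> (\<forall>l<k. s !! l \<in> (if l < lv k then {\<omega> l} else {d. snd d = snd (\<omega> l)}))"
    unfolding square_eq_iff[OF snth_codes[OF s] assms] by (simp only:)
qed

lemma measurable_square: "{s \<in> space code_measure. square k (snth s) = Q} \<in> sets code_measure"
proof (cases "\<exists>\<omega>\<in>codes D. square k \<omega> = Q")
  case True
  then obtain \<omega> where "\<omega> \<in> codes D" "Q = square k \<omega>"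
    by blast
  then show ?thesis
    by (simp only: square_cylinder measurable_cylinder)
next
  case False
  then have "{s \<in> space code_measure. square k (snth s) = Q} = {}"
    using snth_codes by blast
  then show ?thesis
    by (simp only: sets.empty_sets)
qed

lemma square_mass_weight:
  assumes "\<omega> \<in> codes D"
  shows "square_mass k (square k \<omega>) = weight k \<omega>"
proof -
  have "card ((if l < lv k then {\<omega> l} else {d. snd d = snd (\<omega> l)}) \<inter> D)
      = (if l < lv k then 1 else distribution_seq D (snd (\<omega> l)))" for l
    using codesD[OF assms, of l] distribution_seq_row by simp
  then show ?thesis
    unfolding square_mass_def square_cylinder[OF assms] measure_cylinder weight_def
    by (simp add: prod_dividef if_distrib[of real] cong: if_cong)
qed

lemma row_pos: "d \<in> D \<Longrightarrow> 0 < distribution_seq D (snd d)"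
proof -
  assume "d \<in> D"
  then have "d \<in> {d'. snd d' = snd d} \<inter> D"
    by simp
  then have "{d'. snd d' = snd d} \<inter> D \<noteq> {}"
    by blast
  moreover have "finite ({d'. snd d' = snd d} \<inter> D)"
    using finite_D by blast
  ultimately show ?thesis
    unfolding distribution_seq_row[symmetric] by (simp only: card_gt_0_iff simp_thms)
qed

lemma weight_pos:
  assumes "\<omega> \<in> codes D"
  shows "0 < weight k \<omega>"
  unfolding weight_def using row_pos[OF codesD[OF assms]] card_D_pos
  by (intro divide_pos_pos prod_pos) auto

lemma
  assumes "saturated k A"
  shows measurable_saturated: "{s \<in> space code_measure. pt (snth s) \<in> A} \<in> sets code_measure"
    and mass_saturated: "mass A = (\<Sum>Q\<in>square k ` {\<omega> \<in> codes D. pt \<omega> \<in> A}. square_mass k Q)"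
proof -
  let ?S = "square k ` {\<omega> \<in> codes D. pt \<omega> \<in> A}"
  let ?B = "\<lambda>Q. {s \<in> space code_measure. square k (snth s) = Q}"
  have eq: "{s \<in> space code_measure. pt (snth s) \<in> A} = (\<Union>Q\<in>?S. ?B Q)"
  proof (intro equalityI subsetI)
    fix s assume "s \<in> (\<Union>Q\<in>?S. ?B Q)"
    then obtain \<omega> where \<omega>: "\<omega> \<in> codes D" "pt \<omega> \<in> A" "square k \<omega> = square k (snth s)" "s \<in> space code_measure"
      by auto
    then show "s \<in> {s \<in> space code_measure. pt (snth s) \<in> A}"
      using assms snth_codes[of s] unfolding saturated_def by blast
  qed (use snth_codes in auto)
  have fin: "finite ?S"
    by (intro finite_squares) auto
  show "{s \<in> space code_measure. pt (snth s) \<in> A} \<in> sets code_measure"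
    unfolding eq using fin measurable_square by (intro sets.finite_UN) auto
  have "measure code_measure (\<Union>Q\<in>?S. ?B Q) = (\<Sum>Q\<in>?S. measure code_measure (?B Q))"
    by (intro code.finite_measure_finite_Union fin) (auto simp: disjoint_family_on_def measurable_square)
  then show "mass A = (\<Sum>Q\<in>?S. square_mass k Q)"
    unfolding mass_def eq square_mass_def .
qed

end

section \<open>Counting approximate squares\<close>

lemma prod_sum_PiE:
  fixes f :: "'a \<Rightarrow> 'b \<Rightarrow> real"
  assumes "finite A" "\<And>x. x \<in> A \<Longrightarrow> finite (B x)"
  shows "(\<Sum>g\<in>PiE A B. \<Prod>x\<in>A. f x (g x)) = (\<Prod>x\<in>A. \<Sum>y\<in>B x. f x y)"
proof -
  have "infsetsum (\<lambda>g. \<Prod>x\<in>A. f x (g x)) (PiE A B) = (\<Prod>x\<in>A. infsetsum (f x) (B x))"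
    using assms by (intro infsetsum_prod_PiE) (auto simp: countable_finite abs_summable_on_finite)
  then show ?thesis
    using assms by (simp add: finite_PiE)
qed

lemma prod_if_less:
  fixes x y :: "'a::comm_monoid_mult"
  assumes "p \<le> k"
  shows "(\<Prod>l<k. if l < p then x else y) = x ^ p * y ^ (k - p)"
  using assms
proof (induction k rule: dec_induct)
  case base
  have "(\<Prod>l<p. if l < p then x else y) = (\<Prod>l<p. x)"
    by (intro prod.cong) auto
  then show ?case
    by simp
next
  case (step k)
  then show ?case
    by (simp add: Suc_diff_le mult.assoc mult.commute mult.left_commute)
qed

context carpet_digits
begin

definition rows :: "nat set" where
  "rows = snd ` D"

definition row_digit :: "nat \<Rightarrow> nat \<times> nat" where
  "row_digit j = (SOME d. d \<in> D \<and> snd d = j)"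

lemma row_digit: 
  assumes "j \<in> rows"
  shows "row_digit j \<in> D" "snd (row_digit j) = j"
proof -
  have "\<exists>d. d \<in> D \<and> snd d = j"
    using assms unfolding rows_def by blast
  then have "row_digit j \<in> D \<and> snd (row_digit j) = j"
    unfolding row_digit_def by (rule someI_ex)
  then show "row_digit j \<in> D" "snd (row_digit j) = j"
    by blast+
qed

lemma snd_rows: "d \<in> D \<Longrightarrow> snd d \<in> rows"
  by (simp add: rows_def)

lemma finite_rows: "finite rows"
  using finite_D by (simp add: rows_def)

lemma rows_less: "j \<in> rows \<Longrightarrow> j < m"
  using D_bounds by (auto simp: rows_def)

lemma rows_nonempty: "rows \<noteq> {}"
  using D_nonempty by (simp add: rows_def)

lemma rows_iff: "j \<in> rows \<longleftrightarrow> distribution_seq D j \<noteq> 0"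
proof
  assume "j \<in> rows"
  then show "distribution_seq D j \<noteq> 0"
    using row_digit[of j] row_pos[of "row_digit j"] by simp
next
  assume "distribution_seq D j \<noteq> 0"
  then have "{i. (i, j) \<in> D} \<noteq> {}"
    unfolding distribution_seq_def by (intro notI) simp
  then show "j \<in> rows"
    unfolding rows_def by force
qed

lemma inj_row_digit: "inj_on row_digit rows"
  using row_digit(2) by (rule inj_on_inverseI)

text \<open>An approximate square records a digit at the first \<open>lv k\<close> places and only a row at the
  later ones; replacing each such row by one fixed digit of it gives every square a canonical word.\<close>

definition canonical :: "nat \<Rightarrow> (nat \<Rightarrow> nat \<times> nat) \<Rightarrow> nat \<Rightarrow> nat \<times> nat" where
  "canonical k \<omega> l = (if l < lv k then \<omega> l else row_digit (snd (\<omega> l)))"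

lemma square_cong:
  assumes "\<And>l. l < k \<Longrightarrow> snd (\<omega> l) = snd (\<omega>' l)" "\<And>l. l < lv k \<Longrightarrow> fst (\<omega> l) = fst (\<omega>' l)"
  shows "square k \<omega> = square k \<omega>'"
  unfolding square_def x_index_def y_index_def using assms
  by (intro arg_cong2[where f = Pair] place_value_cong) auto

context
  fixes k :: nat and C :: "nat \<Rightarrow> (nat \<times> nat) set"
  assumes C: "\<And>l. l < k \<Longrightarrow> C l \<subseteq> (if l < lv k then D else row_digit ` rows)"
begin

lemma C_digit:
  assumes "l < k" "d \<in> C l"
  shows "d \<in> D" "\<not> l < lv k \<Longrightarrow> row_digit (snd d) = d"
proof -
  have *: "d \<in> (if l < lv k then D else row_digit ` rows)"
    using C[OF assms(1)] assms(2) by blast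
  then show "d \<in> D"
    using row_digit(1) by (auto split: if_splits)
  assume "\<not> l < lv k"
  then obtain j where "j \<in> rows" "d = row_digit j"
    using * by auto
  then show "row_digit (snd d) = d"
    using row_digit(2) by simp
qed

lemma inj_square_words: "inj_on (square k) (PiE {..<k} C)"
proof (rule inj_onI)
  fix g g' assume g: "g \<in> PiE {..<k} C" and g': "g' \<in> PiE {..<k} C" and eq: "square k g = square k g'"
  have D: "g l \<in> D" "g' l \<in> D" if "l < k" for l
    using C_digit(1)[OF that] PiE_mem[OF g, of l] PiE_mem[OF g', of l] that by auto
  have snd: "snd (g l) = snd (g' l)" if "l < k" for l
    by (rule place_value_inj[of k "\<lambda>l. snd (g l)" m "\<lambda>l. snd (g' l)", OF _ _ _ that])
       (use D D_bounds eq in \<open>auto simp: square_def y_index_def\<close>)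
  have fst: "fst (g l) = fst (g' l)" if "l < lv k" for l
    by (rule place_value_inj[of "lv k" "\<lambda>l. fst (g l)" n "\<lambda>l. fst (g' l)", OF _ _ _ that])
       (use D D_bounds eq lv_le[of k] in \<open>auto simp: square_def x_index_def\<close>)
  show "g = g'"
  proof (rule PiE_ext[OF g g'])
    fix l assume "l \<in> {..<k}"
    then have l: "l < k" "g l \<in> C l" "g' l \<in> C l"
      using PiE_mem[OF g, of l] PiE_mem[OF g', of l] by auto
    show "g l = g' l"
    proof (cases "l < lv k")
      case True
      then show ?thesis
        using snd[OF l(1)] fst by (simp add: prod_eq_iff)
    next
      case False
      have "g l = row_digit (snd (g l))"
        by (rule C_digit(2)[OF l(1,2) False, symmetric])
      also have "\<dots> = row_digit (snd (g' l))"
        by (simp only: snd[OF l(1)])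
      also have "\<dots> = g' l"
        by (rule C_digit(2)[OF l(1,3) False])
      finally show ?thesis .
    qed
  qed
qed

lemma image_square_words:
  "square k ` PiE {..<k} C = square k ` {\<omega> \<in> codes D. \<forall>l<k. canonical k \<omega> l \<in> C l}"
proof (intro equalityI subsetI)
  fix Q assume "Q \<in> square k ` PiE {..<k} C"
  then obtain g where g: "g \<in> PiE {..<k} C" "Q = square k g"
    by blast
  obtain d where d: "d \<in> D"
    using D_nonempty by blast
  define \<omega> where "\<omega> l = (if l < k then g l else d)" for l
  have mem: "g l \<in> C l" if "l < k" for l
    using PiE_mem[OF g(1), of l] that by simp
  have "\<omega> \<in> codes D"
    using C_digit(1) mem d by (auto simp: codes_def \<omega>_def)
  moreover have "canonical k \<omega> l \<in> C l" if "l < k" for l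
    using C_digit(2)[OF that mem[OF that]] mem[OF that] that by (simp add: canonical_def \<omega>_def)
  moreover have "square k \<omega> = Q"
    unfolding g(2) using lv_le[of k] by (intro square_cong) (auto simp: \<omega>_def)
  ultimately show "Q \<in> square k ` {\<omega> \<in> codes D. \<forall>l<k. canonical k \<omega> l \<in> C l}"
    by blast
next
  fix Q assume "Q \<in> square k ` {\<omega> \<in> codes D. \<forall>l<k. canonical k \<omega> l \<in> C l}"
  then obtain \<omega> where \<omega>: "\<omega> \<in> codes D" "\<And>l. l < k \<Longrightarrow> canonical k \<omega> l \<in> C l" "Q = square k \<omega>"
    by blast
  define g where "g = restrict (canonical k \<omega>) {..<k}"
  have "g \<in> PiE {..<k} C"
    unfolding g_def using \<omega>(2) by (intro restrict_PiE_iff[THEN iffD2]) auto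
  moreover have "square k g = Q"
    unfolding \<omega>(3) using lv_le[of k] row_digit(2)[OF snd_rows[OF codesD[OF \<omega>(1)]]]
    by (intro square_cong) (auto simp: g_def canonical_def)
  ultimately show "Q \<in> square k ` PiE {..<k} C"
    by blast
qed

end

definition level_count :: "nat \<Rightarrow> real" where
  "level_count k = real (card D) ^ lv k * real (card rows) ^ (k - lv k)"

lemma card_row_digits: "card (row_digit ` rows) = card rows"
  by (rule card_image[OF inj_row_digit])

lemma level_count_pos: "0 < level_count k"
  using card_D_pos finite_rows rows_nonempty by (simp add: level_count_def card_gt_0_iff)

text \<open>This is what ties the measure to the metric: at fine levels, the measure of a square is the
  proportion of approximate squares that it contains.\<close>

lemma card_subsquares:
  assumes \<omega>: "\<omega> \<in> codes D" and K: "k \<le> lv K"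
  shows "real (card (square K ` {\<omega>' \<in> codes D. square k \<omega>' = square k \<omega>})) = weight k \<omega> * level_count K"
proof -
  define C where "C l = (if l < k then (if l < lv k then {\<omega> l} else {d. snd d = snd (\<omega> l)} \<inter> D)
      else if l < lv K then D else row_digit ` rows)" for l
  have k: "lv k \<le> k" "k \<le> K" "lv K \<le> K"
    using lv_le[of k] lv_le[of K] K by auto
  have C: "C l \<subseteq> (if l < lv K then D else row_digit ` rows)" if "l < K" for l
    using codesD[OF \<omega>] K by (auto simp: C_def)
  have "{\<omega>' \<in> codes D. square k \<omega>' = square k \<omega>} = {\<omega>' \<in> codes D. \<forall>l<K. canonical K \<omega>' l \<in> C l}"
  proof (intro Collect_cong conj_cong refl)
    fix \<omega>' assume \<omega>': "\<omega>' \<in> codes D"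
    have "canonical K \<omega>' l \<in> C l
        \<longleftrightarrow> (l < k \<longrightarrow> snd (\<omega>' l) = snd (\<omega> l) \<and> (l < lv k \<longrightarrow> \<omega>' l = \<omega> l))" for l
      using codesD[OF \<omega>', of l] snd_rows[OF codesD[OF \<omega>', of l]] K k
      by (cases "l < k"; cases "l < lv k"; cases "l < lv K") (auto simp: canonical_def C_def)
    then show "square k \<omega>' = square k \<omega> \<longleftrightarrow> (\<forall>l<K. canonical K \<omega>' l \<in> C l)"
      unfolding square_eq_iff[OF \<omega>' \<omega>] using k by auto
  qed
  then have "card (square K ` {\<omega>' \<in> codes D. square k \<omega>' = square k \<omega>}) = card (PiE {..<K} C)"
    by (simp only: image_square_words[of K C, OF C, symmetric] card_image[OF inj_square_words[of K C, OF C]])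
  also have "\<dots> = (\<Prod>l<K. card (C l))"
    by (simp add: card_PiE)
  also have "{..<K} = {..<k} \<union> {k..<K}"
    using k by auto
  also have "(\<Prod>l\<in>{..<k} \<union> {k..<K}. card (C l)) = (\<Prod>l<k. card (C l)) * (\<Prod>l\<in>{k..<K}. card (C l))"
    by (intro prod.union_disjoint) auto
  also have "(\<Prod>l<k. card (C l)) = (\<Prod>l<k. if l < lv k then 1 else distribution_seq D (snd (\<omega> l)))"
    by (intro prod.cong) (auto simp: C_def distribution_seq_row)
  also have "(\<Prod>l\<in>{k..<K}. card (C l)) = card D ^ (lv K - k) * card rows ^ (K - lv K)"
  proof -
    have "(\<Prod>l\<in>{k..<K}. card (C l)) = (\<Prod>l<K - k. card (C (k + l)))"
      using k by (intro prod.reindex_bij_witness[of _ "\<lambda>l. k + l" "\<lambda>l. l - k"]) auto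
    also have "\<dots> = (\<Prod>l<K - k. if l < lv K - k then card D else card rows)"
      using K by (intro prod.cong) (auto simp: C_def card_row_digits)
    also have "\<dots> = card D ^ (lv K - k) * card rows ^ (K - k - (lv K - k))"
      using k K by (intro prod_if_less) auto
    finally show ?thesis
      using K by simp
  qed
  finally have "real (card (square K ` {\<omega>' \<in> codes D. square k \<omega>' = square k \<omega>}))
      = (\<Prod>l<k. if l < lv k then 1 else real (distribution_seq D (snd (\<omega> l))))
        * (real (card D) ^ (lv K - k) * real (card rows) ^ (K - lv K))"
    by (simp add: if_distrib[of real] cong: if_cong)
  also have "real (card D) ^ (lv K - k) = real (card D) ^ lv K / real (card D) ^ k"
    using card_D_pos K by (simp add: power_diff)
  finally show ?thesis
    by (simp add: weight_def level_count_def)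
qed

lemma card_level_squares: "real (card (square K ` codes D)) = level_count K"
proof -
  obtain \<omega> where \<omega>: "\<omega> \<in> codes D"
    using codes_nonempty by blast
  have "lv 0 = 0"
    by (simp add: x_level_def)
  then have "square 0 \<omega>' = square 0 \<omega>" for \<omega>'
    by (simp add: square_def x_index_def y_index_def)
  then show ?thesis
    using card_subsquares[OF \<omega>, of 0 K] by (simp add: weight_def)
qed

lemma sum_square_mass_powers:
  "(\<Sum>Q\<in>square k ` codes D. square_mass k Q ^ e)
     = real (card D) ^ lv k * (\<Sum>j\<in>rows. real (distribution_seq D j) ^ e) ^ (k - lv k) / real (card D) ^ (k * e)"
proof -
  define C where "C l = (if l < lv k then D else row_digit ` rows)" for l
  have C: "C l \<subseteq> (if l < lv k then D else row_digit ` rows)" if "l < k" for l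
    by (simp add: C_def)
  let ?f = "\<lambda>l d. if l < lv k then 1 else real (distribution_seq D (snd d)) ^ e"
  have "canonical k \<omega> l \<in> C l" if "\<omega> \<in> codes D" for \<omega> l
    using codesD[OF that, of l] snd_rows by (simp add: canonical_def C_def)
  then have "{\<omega> \<in> codes D. \<forall>l<k. canonical k \<omega> l \<in> C l} = codes D"
    by blast
  then have image: "square k ` codes D = square k ` PiE {..<k} C"
    by (simp only: image_square_words[of k C, OF C])
  have mass: "square_mass k (square k g) ^ e = (\<Prod>l<k. ?f l (g l)) / real (card D) ^ (k * e)"
    if g: "g \<in> PiE {..<k} C" for g
  proof -
    obtain d where d: "d \<in> D"
      using D_nonempty by blast
    define \<omega> where "\<omega> l = (if l < k then g l else d)" for l
    have "\<omega> \<in> codes D"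
      using C_digit(1)[of k C, OF C] PiE_mem[OF g] d by (auto simp: codes_def \<omega>_def)
    moreover have "square k g = square k \<omega>"
      using lv_le[of k] by (intro square_cong) (auto simp: \<omega>_def)
    ultimately have "square_mass k (square k g) = weight k \<omega>"
      using square_mass_weight by simp
    also have "\<dots> ^ e = (\<Prod>l<k. (if l < lv k then 1 else real (distribution_seq D (snd (\<omega> l)))) ^ e) / real (card D) ^ (k * e)"
      unfolding weight_def by (simp add: power_divide prod_power_distrib power_mult)
    also have "(\<Prod>l<k. (if l < lv k then 1 else real (distribution_seq D (snd (\<omega> l)))) ^ e) = (\<Prod>l<k. ?f l (g l))"
      by (intro prod.cong) (auto simp: \<omega>_def)
    finally show ?thesis .
  qed
  have "(\<Sum>Q\<in>square k ` codes D. square_mass k Q ^ e) = (\<Sum>g\<in>PiE {..<k} C. square_mass k (square k g) ^ e)"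
    unfolding image by (simp add: sum.reindex[OF inj_square_words[of k C, OF C]])
  also have "\<dots> = (\<Sum>g\<in>PiE {..<k} C. \<Prod>l<k. ?f l (g l)) / real (card D) ^ (k * e)"
    by (simp add: mass sum_divide_distrib)
  also have "(\<Sum>g\<in>PiE {..<k} C. \<Prod>l<k. ?f l (g l)) = (\<Prod>l<k. \<Sum>d\<in>C l. ?f l d)"
    using finite_D finite_rows by (intro prod_sum_PiE) (auto simp: C_def)
  also have "\<dots> = (\<Prod>l<k. if l < lv k then real (card D) else \<Sum>j\<in>rows. real (distribution_seq D j) ^ e)"
  proof (intro prod.cong refl)
    fix l
    have "(\<Sum>d\<in>row_digit ` rows. real (distribution_seq D (snd d)) ^ e) = (\<Sum>j\<in>rows. real (distribution_seq D j) ^ e)"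
      by (simp add: sum.reindex[OF inj_row_digit] row_digit(2))
    then show "(\<Sum>d\<in>C l. ?f l d) = (if l < lv k then real (card D) else \<Sum>j\<in>rows. real (distribution_seq D j) ^ e)"
      by (simp add: C_def)
  qed
  also have "\<dots> = real (card D) ^ lv k * (\<Sum>j\<in>rows. real (distribution_seq D j) ^ e) ^ (k - lv k)"
    by (rule prod_if_less[OF lv_le])
  finally show ?thesis .
qed

end

section \<open>The uniform Bernoulli measure\<close>

definition uniform_self_affine :: "nat \<Rightarrow> nat \<Rightarrow> (nat \<times> nat) set \<Rightarrow> (real \<times> real) measure \<Rightarrow> bool" where
  "uniform_self_affine n m D M \<longleftrightarrow> prob_space M \<and> sets M = sets (restrict_space borel (carpet n m D)) \<and>
     (\<forall>A\<in>sets M. emeasure M A =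
        (\<Sum>d\<in>D. ennreal (1 / real (card D)) * emeasure M (affine_contraction n m d -` A \<inter> space M)))"

context carpet_digits
begin

lemma uniform_self_affineD:
  assumes "uniform_self_affine n m D M"
  shows "space M = carpet n m D" "emeasure M (space M) = 1"
    and "A \<in> sets borel \<Longrightarrow> A \<inter> carpet n m D \<in> sets M"
    and "A \<in> sets M \<Longrightarrow> A \<subseteq> carpet n m D"
    and "A \<in> sets M \<Longrightarrow> affine_contraction n m d -` A \<inter> carpet n m D \<in> sets M"
    and "A \<in> sets M \<Longrightarrow> emeasure M A =
        (\<Sum>d\<in>D. ennreal (1 / real (card D)) * emeasure M (affine_contraction n m d -` A \<inter> carpet n m D))"
proof -
  have M: "prob_space M" "sets M = sets (restrict_space borel (carpet n m D))"
    using assms by (auto simp: uniform_self_affine_def)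
  show space: "space M = carpet n m D"
    using sets_eq_imp_space_eq[OF M(2)] by (simp add: space_restrict_space)
  show "emeasure M (space M) = 1"
    using prob_space.emeasure_space_1[OF M(1)] .
  have sets: "A \<in> sets M \<longleftrightarrow> (\<exists>B\<in>sets borel. A = B \<inter> carpet n m D)" for A
    unfolding M(2) sets_restrict_space by auto
  then show "A \<in> sets borel \<Longrightarrow> A \<inter> carpet n m D \<in> sets M" "A \<in> sets M \<Longrightarrow> A \<subseteq> carpet n m D"
    by auto
  show "A \<in> sets M \<Longrightarrow> emeasure M A =
        (\<Sum>d\<in>D. ennreal (1 / real (card D)) * emeasure M (affine_contraction n m d -` A \<inter> carpet n m D))"
    using assms space unfolding uniform_self_affine_def by simp
  assume "A \<in> sets M"
  then obtain B where B: "B \<in> sets borel" "A = B \<inter> carpet n m D"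
    using sets by blast
  have [measurable]: "affine_contraction n m d \<in> borel_measurable borel"
    by (rule borel_measurable_continuous_onI[OF continuous_on_affine_contraction])
  have "closed (carpet n m D)"
    using carpet_compact compact_imp_closed by blast
  then have "A \<in> sets borel"
    using B by (auto intro: borel_closed)
  then have "affine_contraction n m d -` A \<inter> space borel \<in> sets borel"
    by measurable
  then show "affine_contraction n m d -` A \<inter> carpet n m D \<in> sets M"
    unfolding sets by auto
qed

lemma affine_contraction_carpet: "d \<in> D \<Longrightarrow> z \<in> carpet n m D \<Longrightarrow> affine_contraction n m d z \<in> carpet n m D"
  using codes_image_self_affine unfolding carpet_eq by blast

lemma dist_affine_contraction: "dist (affine_contraction n m d z) (affine_contraction n m d w) \<le> dist z w / 2"
proof -
  have scale: "\<bar>(u + c) / real b - (v + c) / real b\<bar> \<le> \<bar>u - v\<bar> / 2" if "2 \<le> b" for u v c b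
  proof -
    have "\<bar>(u + c) / real b - (v + c) / real b\<bar> = \<bar>u - v\<bar> / real b"
      by (simp flip: diff_divide_distrib)
    also have "\<dots> \<le> \<bar>u - v\<bar> / 2"
      using that by (intro divide_left_mono) auto
    finally show ?thesis .
  qed
  have 1: "dist (fst (affine_contraction n m d z)) (fst (affine_contraction n m d w)) \<le> dist (fst z) (fst w) / 2"
    unfolding affine_contraction_def dist_real_def fst_conv by (rule scale[OF n])
  have 2: "dist (snd (affine_contraction n m d z)) (snd (affine_contraction n m d w)) \<le> dist (snd z) (snd w) / 2"
    unfolding affine_contraction_def dist_real_def snd_conv by (rule scale[OF m])
  have "dist (affine_contraction n m d z) (affine_contraction n m d w)
      \<le> sqrt ((dist (fst z) (fst w) / 2)\<^sup>2 + (dist (snd z) (snd w) / 2)\<^sup>2)"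
    unfolding dist_prod_def by (intro real_sqrt_le_mono add_mono power_mono 1 2) auto
  also have "\<dots> = sqrt (((dist (fst z) (fst w))\<^sup>2 + (dist (snd z) (snd w))\<^sup>2) / 2\<^sup>2)"
    by (simp add: power_divide add_divide_distrib)
  also have "\<dots> = dist z w / 2"
    unfolding dist_prod_def real_sqrt_divide by simp
  finally show ?thesis .
qed

text \<open>The common self-affinity relation is iterated until the contracted carpets are smaller
  than the neighbourhood that separates \<open>A\<close> from the complement of \<open>A'\<close>.\<close>

lemma self_affine_neighbourhood_le:
  assumes M: "uniform_self_affine n m D M" and M': "uniform_self_affine n m D M'"
    and "A \<in> sets M" "A' \<in> sets M'"
    and "\<And>x y. x \<in> A \<Longrightarrow> y \<in> carpet n m D \<Longrightarrow> dist x y \<le> 2 / 2 ^ k \<Longrightarrow> y \<in> A'"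
  shows "emeasure M A \<le> emeasure M' A'"
  using assms(3-)
proof (induction k arbitrary: A A')
  case 0
  show ?case
  proof (cases "A = {}")
    case False
    then obtain x where x: "x \<in> A" "x \<in> carpet n m D"
      using uniform_self_affineD(4)[OF M 0(1)] by blast
    have "y \<in> A'" if y: "y \<in> carpet n m D" for y
    proof -
      have "dist x y \<le> \<bar>fst x - fst y\<bar> + \<bar>snd x - snd y\<bar>"
        by (rule dist_coordinates(3))
      also have "\<dots> \<le> 2"
        using x(2) y pt_bounds unfolding carpet_eq by (smt (verit) imageE)
      finally show ?thesis
        using 0(3)[OF x(1) y] by simp
    qed
    then have "A' = space M'"
      using uniform_self_affineD(4)[OF M' 0(2)] uniform_self_affineD(1)[OF M'] by blast
    then show ?thesis
      using uniform_self_affineD(2)[OF M'] uniform_self_affineD(2)[OF M] emeasure_space[of M A] by simp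
  qed simp
next
  case (Suc k)
  have "emeasure M (affine_contraction n m d -` A \<inter> carpet n m D)
      \<le> emeasure M' (affine_contraction n m d -` A' \<inter> carpet n m D)" if d: "d \<in> D" for d
  proof (rule Suc.IH)
    fix x y assume x: "x \<in> affine_contraction n m d -` A \<inter> carpet n m D" and y: "y \<in> carpet n m D"
      and xy: "dist x y \<le> 2 / 2 ^ k"
    have "dist (affine_contraction n m d x) (affine_contraction n m d y) \<le> 2 / 2 ^ Suc k"
      using dist_affine_contraction[of d x y] xy by simp
    then show "y \<in> affine_contraction n m d -` A' \<inter> carpet n m D"
      using Suc.prems(3)[of "affine_contraction n m d x" "affine_contraction n m d y"] x y
        affine_contraction_carpet[OF d y] by auto
  qed (use uniform_self_affineD(5)[OF M Suc.prems(1)] uniform_self_affineD(5)[OF M' Suc.prems(2)] in auto)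
  then show ?case
    unfolding uniform_self_affineD(6)[OF M Suc.prems(1)] uniform_self_affineD(6)[OF M' Suc.prems(2)]
    by (intro sum_mono mult_left_mono) auto
qed

text \<open>A closed set is the intersection of its closed neighbourhoods.\<close>

lemma self_affine_closed_le:
  assumes M: "uniform_self_affine n m D M" and M': "uniform_self_affine n m D M'" and C: "closed C"
  shows "emeasure M (C \<inter> carpet n m D) \<le> emeasure M' (C \<inter> carpet n m D)"
proof (cases "C \<inter> carpet n m D = {}")
  case False
  let ?E = "carpet n m D"
  define U where "U k = {y. infdist y (C \<inter> ?E) \<le> 2 / 2 ^ k}" for k :: nat
  have CE: "closed (C \<inter> ?E)"
    using C carpet_compact compact_imp_closed by blast
  have [measurable]: "U k \<in> sets borel" for k
    unfolding U_def by (intro borel_closed closed_Collect_le continuous_intros)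
  have "(\<Inter>k. U k \<inter> ?E) = C \<inter> ?E"
  proof (intro equalityI subsetI)
    fix y assume y: "y \<in> (\<Inter>k. U k \<inter> ?E)"
    have "infdist y (C \<inter> ?E) \<le> e" if "e > 0" for e
    proof -
      obtain k where "2 / e < 2 ^ k"
        using real_arch_pow[of 2 "2 / e"] by auto
      then have "2 / 2 ^ k < e"
        using that by (simp add: field_simps)
      moreover have "infdist y (C \<inter> ?E) \<le> 2 / 2 ^ k"
        using y by (auto simp: U_def)
      ultimately show ?thesis
        by simp
    qed
    then have "infdist y (C \<inter> ?E) \<le> 0"
      by (rule field_le_epsilon) simp
    then have "infdist y (C \<inter> ?E) = 0"
      using infdist_nonneg[of y "C \<inter> ?E"] by linarith
    then show "y \<in> C \<inter> ?E"
      using in_closed_iff_infdist_zero[OF CE False] by blast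
  qed (auto simp: U_def)
  then have "emeasure M' (C \<inter> ?E) = emeasure M' (\<Inter>k. U k \<inter> ?E)"
    by simp
  also have "\<dots> = (INF k. emeasure M' (U k \<inter> ?E))"
  proof (rule INF_emeasure_decseq[symmetric])
    show "range (\<lambda>k. U k \<inter> ?E) \<subseteq> sets M'"
      using uniform_self_affineD(3)[OF M'] by auto
    show "decseq (\<lambda>k. U k \<inter> ?E)"
    proof (rule decseq_SucI)
      fix k :: nat
      have "2 / 2 ^ Suc k \<le> (2 / 2 ^ k :: real)"
        by (simp add: field_simps)
      then show "U (Suc k) \<inter> ?E \<subseteq> U k \<inter> ?E"
        unfolding U_def by (auto intro: order_trans)
    qed
    show "emeasure M' (U k \<inter> ?E) \<noteq> \<infinity>" for k
      using emeasure_space[of M' "U k \<inter> ?E"] uniform_self_affineD(2)[OF M'] by (auto simp: top_unique)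
  qed
  also have "\<dots> \<ge> emeasure M (C \<inter> ?E)"
  proof (rule INF_greatest)
    fix k :: nat
    show "emeasure M (C \<inter> ?E) \<le> emeasure M' (U k \<inter> ?E)"
    proof (rule self_affine_neighbourhood_le[OF M M', where k = k])
      fix x y assume "x \<in> C \<inter> ?E" "y \<in> ?E" "dist x y \<le> 2 / 2 ^ k"
      then show "y \<in> U k \<inter> ?E"
        using infdist_le[of x "C \<inter> ?E" y] by (auto simp: U_def dist_commute)
    qed (use uniform_self_affineD(3)[OF M] uniform_self_affineD(3)[OF M'] C in auto)
  qed
  finally show ?thesis .
qed simp

lemma uniform_self_affine_unique:
  assumes M: "uniform_self_affine n m D M" and M': "uniform_self_affine n m D M'"
  shows "M = M'"
proof -
  let ?E = "carpet n m D"
  have sets: "sets M = sets (restrict_space borel ?E)" "sets M' = sets (restrict_space borel ?E)"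
    using M M' by (auto simp: uniform_self_affine_def)
  have id: "(\<lambda>x. x) \<in> measurable M borel" "(\<lambda>x. x) \<in> measurable M' borel"
    unfolding measurable_cong_sets[OF sets(1) refl] measurable_cong_sets[OF sets(2) refl]
    by (rule measurable_restrict_space1, simp)+
  have vimage: "(\<lambda>x. x) -` A \<inter> ?E = A \<inter> ?E" for A :: "(real \<times> real) set"
    by auto
  have "distr M borel (\<lambda>x. x) = distr M' borel (\<lambda>x. x)"
  proof (rule measure_eqI_generator_eq[where E = "Collect closed" and \<Omega> = UNIV and A = "\<lambda>_. UNIV"])
    show "Int_stable (Collect closed)"
      by (auto simp: Int_stable_def)
    show "sets (distr M borel (\<lambda>x. x)) = sigma_sets UNIV (Collect closed)"
      "sets (distr M' borel (\<lambda>x. x)) = sigma_sets UNIV (Collect closed)"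
      by (simp_all add: borel_eq_closed)
    show "emeasure (distr M borel (\<lambda>x. x)) X = emeasure (distr M' borel (\<lambda>x. x)) X" if "X \<in> Collect closed" for X
      using that self_affine_closed_le[OF M M', of X] self_affine_closed_le[OF M' M, of X]
      by (simp add: emeasure_distr id uniform_self_affineD(1)[OF M] uniform_self_affineD(1)[OF M'] vimage)
    show "emeasure (distr M borel (\<lambda>x. x)) UNIV \<noteq> \<infinity>"
      using uniform_self_affineD(2)[OF M] by (simp add: emeasure_distr id)
  qed auto
  then have same: "emeasure (distr M borel (\<lambda>x. x)) A = emeasure (distr M' borel (\<lambda>x. x)) A" for A
    by simp
  have eq: "emeasure M (A \<inter> ?E) = emeasure M' (A \<inter> ?E)" if "A \<in> sets borel" for A
    using same[of A] that
    by (simp add: emeasure_distr id uniform_self_affineD(1)[OF M] uniform_self_affineD(1)[OF M'] vimage)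
  show ?thesis
  proof (rule measure_eqI)
    show "sets M = sets M'"
      using sets by simp
    fix A assume "A \<in> sets M"
    then obtain B where "B \<in> sets borel" "A = B \<inter> ?E"
      unfolding sets sets_restrict_space by auto
    then show "emeasure M A = emeasure M' A"
      using eq by simp
  qed
qed

lemma measurable_pt: "(\<lambda>s. pt (snth s)) \<in> borel_measurable code_measure"
proof -
  have digit: "(\<lambda>s. real (fst (s !! l))) \<in> borel_measurable code_measure"
    "(\<lambda>s. real (snd (s !! l))) \<in> borel_measurable code_measure" for l
  proof -
    have "(\<lambda>s. s !! l) \<in> measurable code_measure (uniform_count_measure D)"
      unfolding code_measure_def by measurable
    moreover have "(\<lambda>d. real (fst d)) \<in> borel_measurable (uniform_count_measure D)"
      "(\<lambda>d. real (snd d)) \<in> borel_measurable (uniform_count_measure D)"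
      unfolding measurable_def by (auto simp: sets_uniform_count_measure space_uniform_count_measure)
    ultimately show "(\<lambda>s. real (fst (s !! l))) \<in> borel_measurable code_measure"
      "(\<lambda>s. real (snd (s !! l))) \<in> borel_measurable code_measure"
      using measurable_compose by blast+
  qed
  show ?thesis
    unfolding coding_map_def expansion_def
    by (intro borel_measurable_Pair borel_measurable_suminf borel_measurable_divide digit borel_measurable_const)
qed

lemma measurable_pt_carpet: "(\<lambda>s. pt (snth s)) \<in> measurable code_measure (restrict_space borel (carpet n m D))"
  using measurable_pt snth_codes by (intro measurable_restrict_space2) (auto simp: carpet_eq)

lemma uniform_self_affine_code_measure:
  "uniform_self_affine n m D (distr code_measure (restrict_space borel (carpet n m D)) (\<lambda>s. pt (snth s)))"
  (is "uniform_self_affine n m D ?M")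
proof -
  have prob: "prob_space ?M"
    by (rule code.prob_space_distr[OF measurable_pt_carpet])
  have "emeasure ?M A = (\<Sum>d\<in>D. ennreal (1 / real (card D)) * emeasure ?M (affine_contraction n m d -` A \<inter> space ?M))"
    if A: "A \<in> sets ?M" for A
  proof -
    have A': "A \<in> sets (restrict_space borel (carpet n m D))"
      using A by simp
    have meas: "affine_contraction n m d -` A \<inter> carpet n m D \<in> sets (restrict_space borel (carpet n m D))" if "d \<in> D" for d
    proof -
      have "affine_contraction n m d \<in> measurable (restrict_space borel (carpet n m D)) (restrict_space borel (carpet n m D))"
        using affine_contraction_carpet[OF that]
        by (intro measurable_restrict_space3 borel_measurable_continuous_onI continuous_on_affine_contraction) auto
      from measurable_sets[OF this A'] show ?thesis
        by (simp add: space_restrict_space)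
    qed
    let ?X = "(\<lambda>s. pt (snth s)) -` A \<inter> space code_measure"
    have X: "?X \<in> sets code_measure"
      by (rule measurable_sets[OF measurable_pt_carpet A'])
    have "emeasure ?M A = emeasure code_measure ?X"
      by (rule emeasure_distr[OF measurable_pt_carpet A'])
    also have "\<dots> = (\<integral>\<^sup>+t. emeasure code_measure {s \<in> space code_measure. t ## s \<in> ?X} \<partial>uniform_count_measure D)"
      using digit.emeasure_stream_space[folded code_measure_def, OF X] .
    also have "\<dots> = (\<Sum>d\<in>D. ennreal (1 / real (card D)) * emeasure code_measure {s \<in> space code_measure. d ## s \<in> ?X})"
      unfolding uniform_count_measure_def by (rule nn_integral_point_measure_finite[OF finite_D])
    also have "\<dots> = (\<Sum>d\<in>D. ennreal (1 / real (card D)) * emeasure ?M (affine_contraction n m d -` A \<inter> space ?M))"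
    proof (intro sum.cong refl arg_cong2[where f = times])
      fix d assume d: "d \<in> D"
      have tail: "pt (snth (d ## s)) = affine_contraction n m d (pt (snth s))" if "s \<in> space code_measure" for s
      proof -
        have "snth (d ## s) = case_nat d (snth s)"
          by (rule ext) (simp add: Stream_snth)
        then show ?thesis
          using pt_case_nat[OF d snth_codes[OF that]] by simp
      qed
      have "{s \<in> space code_measure. d ## s \<in> ?X}
          = (\<lambda>s. pt (snth s)) -` (affine_contraction n m d -` A \<inter> carpet n m D) \<inter> space code_measure"
        using d tail snth_codes by (auto simp: space_code_measure streams_Stream carpet_eq)
      then show "emeasure code_measure {s \<in> space code_measure. d ## s \<in> ?X}
          = emeasure ?M (affine_contraction n m d -` A \<inter> space ?M)"
        using emeasure_distr[OF measurable_pt_carpet meas[OF d]] by (simp add: space_restrict_space)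
    qed
    finally show ?thesis .
  qed
  then show ?thesis
    unfolding uniform_self_affine_def using prob by simp
qed

lemma uniform_Bernoulli_measure_eq:
  "uniform_Bernoulli_measure n m D = distr code_measure (restrict_space borel (carpet n m D)) (\<lambda>s. pt (snth s))"
  unfolding uniform_Bernoulli_measure_def uniform_self_affine_def[symmetric]
  using uniform_self_affine_code_measure uniform_self_affine_unique by (intro the_equality) auto

lemma emeasure_uniform_Bernoulli_measure:
  assumes "A \<in> sets borel"
  shows "emeasure (uniform_Bernoulli_measure n m D) (A \<inter> space (uniform_Bernoulli_measure n m D)) = ennreal (mass A)"
proof -
  have "A \<inter> carpet n m D \<in> sets (restrict_space borel (carpet n m D))"
    using assms by (auto simp: sets_restrict_space)
  moreover have "(\<lambda>s. pt (snth s)) -` (A \<inter> carpet n m D) \<inter> space code_measure = {s \<in> space code_measure. pt (snth s) \<in> A}"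
    using snth_codes by (auto simp: carpet_eq)
  ultimately show ?thesis
    unfolding uniform_Bernoulli_measure_eq mass_def
    by (simp add: space_restrict_space emeasure_distr[OF measurable_pt_carpet] code.emeasure_eq_measure)
qed

end

section \<open>What doubling says about the digit set\<close>

lemma power_growth_le:
  fixes u v c :: real
  assumes "0 \<le> u" "0 < v" and le: "\<And>t0. \<exists>t\<ge>t0. u ^ t \<le> c * v ^ t"
  shows "u \<le> v"
proof (rule ccontr)
  assume "\<not> u \<le> v"
  then have q: "1 < u / v"
    using assms(2) by simp
  obtain t0 where t0: "c < (u / v) ^ t0"
    using real_arch_pow[OF q] by blast
  obtain t where t: "t0 \<le> t" "u ^ t \<le> c * v ^ t"
    using le by blast
  have "(u / v) ^ t0 \<le> (u / v) ^ t"
    using q t(1) by (intro power_increasing) auto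
  moreover have "(u / v) ^ t \<le> c"
    using t(2) assms(2) by (simp add: power_divide pos_divide_le_eq)
  ultimately show False
    using t0 by linarith
qed

lemma place_value_carry:
  assumes b: "1 \<le> b" and pre: "\<And>l. l < p \<Longrightarrow> f l = g l" and "f p = Suc (g p)"
    and "\<And>l. p < l \<Longrightarrow> l \<le> p + t \<Longrightarrow> f l = 0 \<and> g l = b - 1"
  shows "place_value b f (Suc (p + t)) = Suc (place_value b g (Suc (p + t)))"
  using assms(4)
proof (induction t)
  case 0
  then show ?case
    using assms(3) place_value_cong[of p f g b] pre by simp
next
  case (Suc t)
  then have "f (Suc (p + t)) = 0" "g (Suc (p + t)) = b - 1"
    by auto
  moreover have "place_value b f (Suc (p + t)) = Suc (place_value b g (Suc (p + t)))"
    using Suc by simp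
  ultimately show ?case
    using b by (simp del: place_value.simps add: place_value.simps(2)[of b _ "Suc (p + t)"])
qed

context carpet_digits
begin

lemma weight_rows_cong:
  assumes "\<And>l. l < k \<Longrightarrow> snd (\<omega> l) = snd (\<omega>' l)"
  shows "weight k \<omega> = weight k \<omega>'"
  unfolding weight_def using assms by (intro arg_cong2[where f = "(/)"] prod.cong) auto

lemma square_mass_nonneg: "0 \<le> square_mass k Q"
  by (simp add: square_mass_def)

lemma mass_mono_squares:
  assumes "finite S" "\<And>\<omega>. \<omega> \<in> codes D \<Longrightarrow> pt \<omega> \<in> A \<Longrightarrow> square k \<omega> \<in> S"
  shows "mass A \<le> (\<Sum>Q\<in>S. square_mass k Q)"
proof -
  let ?B = "\<lambda>Q. {s \<in> space code_measure. square k (snth s) = Q}"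
  have "mass A \<le> measure code_measure (\<Union>Q\<in>S. ?B Q)"
    unfolding mass_def
  proof (rule code.finite_measure_mono)
    show "{s \<in> space code_measure. pt (snth s) \<in> A} \<subseteq> (\<Union>Q\<in>S. ?B Q)"
      using assms(2) snth_codes by blast
    show "(\<Union>Q\<in>S. ?B Q) \<in> sets code_measure"
      by (intro sets.finite_UN assms(1) measurable_square)
  qed
  also have "\<dots> = (\<Sum>Q\<in>S. square_mass k Q)"
    unfolding square_mass_def
    by (intro code.finite_measure_finite_Union assms(1)) (auto simp: disjoint_family_on_def measurable_square)
  finally show ?thesis .
qed

lemma weight_le_mass_ball:
  assumes "\<omega> \<in> codes D" "\<And>\<omega>'. \<omega>' \<in> codes D \<Longrightarrow> square k \<omega>' = square k \<omega> \<Longrightarrow> dist z (pt \<omega>') < r"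
  shows "weight k \<omega> \<le> mass (ball z r)"
  unfolding square_mass_weight[OF assms(1), symmetric] square_mass_def mass_def
proof (rule code.finite_measure_mono)
  show "{s \<in> space code_measure. square k (snth s) = square k \<omega>} \<subseteq> {s \<in> space code_measure. pt (snth s) \<in> ball z r}"
    using assms(2) snth_codes by auto
  have "(\<lambda>s. pt (snth s)) -` ball z r \<inter> space code_measure \<in> sets code_measure"
    using measurable_pt by (rule measurable_sets) simp
  then show "{s \<in> space code_measure. pt (snth s) \<in> ball z r} \<in> sets code_measure"
    by (simp add: vimage_def Int_def conj_commute)
qed

end

locale doubling_carpet = carpet_digits +
  assumes doubling: "doubling_measure (uniform_Bernoulli_measure n m D)"
begin

lemma mass_ball_doubling: "\<exists>C\<ge>1. \<forall>\<omega>\<in>codes D. \<forall>r>0. mass (ball (pt \<omega>) (2 * r)) \<le> C * mass (ball (pt \<omega>) r)"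
proof -
  have space: "pt \<omega> \<in> space (uniform_Bernoulli_measure n m D)" if "\<omega> \<in> codes D" for \<omega>
    using that by (simp add: uniform_Bernoulli_measure_eq space_restrict_space carpet_eq)
  obtain C where C: "1 \<le> C" "\<And>x r. x \<in> space (uniform_Bernoulli_measure n m D) \<Longrightarrow> 0 < r \<Longrightarrow>
      ennreal (mass (ball x (2 * r))) \<le> ennreal C * ennreal (mass (ball x r))"
    using doubling unfolding doubling_measure_def by (auto simp: emeasure_uniform_Bernoulli_measure)
  have "mass (ball (pt \<omega>) (2 * r)) \<le> C * mass (ball (pt \<omega>) r)" if "\<omega> \<in> codes D" "0 < r" for \<omega> r
  proof -
    have nonneg: "0 \<le> mass (ball (pt \<omega>) r)"
      by (simp add: mass_def)
    then show ?thesis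
      using C(2)[OF space[OF that(1)] that(2)] C(1)
      by (simp add: ennreal_mult[symmetric])
  qed
  then show ?thesis
    using C(1) by blast
qed

text \<open>A point deep inside its row of approximate squares sees, at small radius, at most three
  approximate squares, all of the mass of its own; at a comparable larger radius it sees the
  vertically neighbouring square as well.\<close>

lemma neighbour_weight_le:
  "\<exists>K>0. \<forall>k. \<forall>\<omega>\<in>codes D. \<forall>\<omega>'\<in>codes D. x_index k \<omega> = x_index k \<omega>' \<longrightarrow>
     \<bar>real (y_index k \<omega>) - real (y_index k \<omega>')\<bar> \<le> 1 \<longrightarrow>
     real (y_index k \<omega>) + 1 / (real m)\<^sup>2 \<le> real m ^ k * snd (pt \<omega>) \<longrightarrow>
     real m ^ k * snd (pt \<omega>) \<le> real (y_index k \<omega>) + 1 - 1 / (real m)\<^sup>2 \<longrightarrow>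
     weight k \<omega>' \<le> K * weight k \<omega>"
proof -
  obtain C where C: "1 \<le> C" "\<And>\<omega> r. \<omega> \<in> codes D \<Longrightarrow> 0 < r \<Longrightarrow> mass (ball (pt \<omega>) (2 * r)) \<le> C * mass (ball (pt \<omega>) r)"
    using mass_ball_doubling by blast
  have iter: "mass (ball (pt \<omega>) (2 ^ p * r)) \<le> C ^ p * mass (ball (pt \<omega>) r)" if "\<omega> \<in> codes D" "0 < r" for \<omega> r p
  proof (induction p)
    case (Suc p)
    have "mass (ball (pt \<omega>) (2 * (2 ^ p * r))) \<le> C * mass (ball (pt \<omega>) (2 ^ p * r))"
      using that by (intro C(2)) auto
    also have "\<dots> \<le> C * (C ^ p * mass (ball (pt \<omega>) r))"
      using Suc C(1) by (intro mult_left_mono) auto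
    finally show ?case
      by (simp add: mult.assoc)
  qed simp
  \<comment> \<open>A ball of radius \<open>2 ^ p\<close> times the small radius covers the neighbouring square.\<close>
  obtain p where p: "2 * (real n + 1) * (real m)\<^sup>2 < 2 ^ p"
    using real_arch_pow[of 2] by auto
  have "weight k \<omega>' \<le> C ^ p * 3 * weight k \<omega>"
    if \<omega>: "\<omega> \<in> codes D" and \<omega>': "\<omega>' \<in> codes D" and x: "x_index k \<omega> = x_index k \<omega>'"
      and y: "\<bar>real (y_index k \<omega>) - real (y_index k \<omega>')\<bar> \<le> 1"
      and low: "real (y_index k \<omega>) + 1 / (real m)\<^sup>2 \<le> real m ^ k * snd (pt \<omega>)"
      and up: "real m ^ k * snd (pt \<omega>) \<le> real (y_index k \<omega>) + 1 - 1 / (real m)\<^sup>2" for k \<omega> \<omega>'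
  proof -
    define r where "r = 1 / ((real m)\<^sup>2 * real m ^ k)"
    have r: "0 < r"
      using m by (simp add: r_def)
    have pos: "0 < real m ^ k" "0 < (real m)\<^sup>2"
      using m by simp_all
    have "weight k \<omega>' \<le> mass (ball (pt \<omega>) (2 ^ p * r))"
    proof (rule weight_le_mass_ball[OF \<omega>'])
      fix \<omega>'' assume \<omega>'': "\<omega>'' \<in> codes D" "square k \<omega>'' = square k \<omega>'"
      have "dist (pt \<omega>) (pt \<omega>'') \<le> (1 + 1) * (real n + 1) / real m ^ k"
        using \<omega>''(2) x y by (intro dist_index[OF \<omega> \<omega>''(1)]) (auto simp: square_def)
      also have "\<dots> < 2 ^ p * r"
        using p pos by (simp add: r_def divide_simps)
      finally show "dist (pt \<omega>) (pt \<omega>'') < 2 ^ p * r" .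
    qed
    also have "\<dots> \<le> C ^ p * mass (ball (pt \<omega>) r)"
      by (rule iter[OF \<omega> r])
    also have "mass (ball (pt \<omega>) r) \<le> 3 * weight k \<omega>"
    proof -
      define S where "S = (\<lambda>X. (X, y_index k \<omega>)) ` {x_index k \<omega> - 1..x_index k \<omega> + 1}"
      have "mass (ball (pt \<omega>) r) \<le> (\<Sum>Q\<in>S. square_mass k Q)"
      proof (rule mass_mono_squares)
        fix \<omega>'' assume \<omega>'': "\<omega>'' \<in> codes D" "pt \<omega>'' \<in> ball (pt \<omega>) r"
        have "\<bar>snd (pt \<omega>) - snd (pt \<omega>'')\<bar> < r" "\<bar>fst (pt \<omega>) - fst (pt \<omega>'')\<bar> < r"
          using \<omega>''(2) dist_coordinates[of "pt \<omega>" "pt \<omega>''"] by auto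
        then have "real m ^ k * \<bar>snd (pt \<omega>) - snd (pt \<omega>'')\<bar> < real m ^ k * r"
          using pos by (intro mult_strict_left_mono)
        also have "real m ^ k * r = 1 / (real m)\<^sup>2"
          using pos by (simp add: r_def)
        finally have "\<bar>real m ^ k * snd (pt \<omega>) - real m ^ k * snd (pt \<omega>'')\<bar> < 1 / (real m)\<^sup>2"
          unfolding abs_mult_diff_pos[OF pos(1)] .
        then have "y_index k \<omega>'' = y_index k \<omega>"
          using low up y_index_bounds[OF \<omega>''(1), of k] by linarith
        moreover have "dist (pt \<omega>) (pt \<omega>'') \<le> (1 / 2) / real m ^ k"
        proof -
          have "4 \<le> (real m)\<^sup>2"
            using m power_mono[of 2 "real m" 2] by simp
          then have "r \<le> (1 / 2) / real m ^ k"
            using pos by (simp add: r_def divide_simps)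
          then show ?thesis
            using \<omega>''(2) by simp
        qed
        then have "\<bar>real (x_index k \<omega>) - real (x_index k \<omega>'')\<bar> \<le> 1 / 2 + 1"
          by (rule index_dist(1)[OF \<omega> \<omega>''(1)])
        then have "x_index k \<omega> - 1 \<le> x_index k \<omega>''" "x_index k \<omega>'' \<le> x_index k \<omega> + 1"
          by linarith+
        ultimately show "square k \<omega>'' \<in> S"
          by (simp add: S_def square_def)
      qed (simp add: S_def)
      also have "\<dots> \<le> (\<Sum>Q\<in>S. weight k \<omega>)"
      proof (rule sum_mono)
        fix Q assume Q: "Q \<in> S"
        show "square_mass k Q \<le> weight k \<omega>"
        proof (cases "\<exists>\<omega>''\<in>codes D. square k \<omega>'' = Q")
          case True
          then obtain \<omega>'' where \<omega>'': "\<omega>'' \<in> codes D" "square k \<omega>'' = Q"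
            by blast
          then have "y_index k \<omega>'' = y_index k \<omega>"
            using Q by (auto simp: S_def square_def)
          then have "\<forall>l<k. snd (\<omega>'' l) = snd (\<omega> l)"
            unfolding y_index_def using place_value_eq_iff[OF codes_bounds(2)[OF \<omega>''(1)] codes_bounds(2)[OF \<omega>]] by blast
          then have "weight k \<omega>'' = weight k \<omega>"
            by (intro weight_rows_cong) auto
          then show ?thesis
            using square_mass_weight[OF \<omega>''(1), of k] \<omega>''(2) by simp
        next
          case False
          then have "{s \<in> space code_measure. square k (snth s) = Q} = {}"
            using snth_codes by blast
          then have "square_mass k Q = 0"
            unfolding square_mass_def by (simp only: measure_empty)
          then show ?thesis
            using weight_pos[OF \<omega>, of k] by simp
        qed
      qed
      also have "\<dots> = real (card S) * weight k \<omega>"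
        by simp
      also have "\<dots> \<le> 3 * weight k \<omega>"
      proof (rule mult_right_mono)
        have "card S \<le> card {x_index k \<omega> - 1..x_index k \<omega> + 1}"
          unfolding S_def by (rule card_image_le) simp
        then show "real (card S) \<le> 3"
          by simp
      qed (use weight_pos[OF \<omega>, of k] in simp)
      finally show ?thesis .
    qed
    finally show ?thesis
      using C(1) by (simp add: mult.assoc)
  qed
  then show ?thesis
    using C(1) by (intro exI[of _ "C ^ p * 3"]) auto
qed

text \<open>Squares on the two sides of a carry are neighbours; their masses differ by powers of the
  counts of the bottom and top rows, so these counts agree as soon as a carry can occur.\<close>

theorem extreme_rows_eq:
  assumes j: "j \<in> rows" "Suc j \<in> rows" and ends: "0 \<in> rows" "m - 1 \<in> rows"
  shows "distribution_seq D 0 = distribution_seq D (m - 1)"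
proof -
  let ?a = "\<lambda>j. real (distribution_seq D j)"
  have a_pos: "0 < ?a i" if "i \<in> rows" for i
    using that rows_iff by simp
  obtain K where K: "K > 0" "\<And>k \<omega> \<omega>'. \<omega> \<in> codes D \<Longrightarrow> \<omega>' \<in> codes D \<Longrightarrow> x_index k \<omega> = x_index k \<omega>' \<Longrightarrow>
     \<bar>real (y_index k \<omega>) - real (y_index k \<omega>')\<bar> \<le> 1 \<Longrightarrow>
     real (y_index k \<omega>) + 1 / (real m)\<^sup>2 \<le> real m ^ k * snd (pt \<omega>) \<Longrightarrow>
     real m ^ k * snd (pt \<omega>) \<le> real (y_index k \<omega>) + 1 - 1 / (real m)\<^sup>2 \<Longrightarrow>
     weight k \<omega>' \<le> K * weight k \<omega>"
    using neighbour_weight_le by blast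
  \<comment> \<open>The rows \<open>j\<close> and \<open>Suc j\<close> at the places \<open>k\<close> and \<open>Suc k\<close> keep the point away from the horizontal
    boundary of its square.\<close>
  define word where "word k u v l = (if l < lv k then row_digit j else if l = lv k then row_digit u
      else if l < k then row_digit v else if l = k then row_digit j else row_digit (Suc j))" for k u v l
  have codes: "word k u v \<in> codes D" if "u \<in> rows" "v \<in> rows" for k u v
    using that j row_digit(1) by (auto simp: codes_def word_def)
  have weight: "weight k (word k u v) = ?a u * ?a v ^ (k - Suc (lv k)) / real (card D) ^ k"
    if "u \<in> rows" "v \<in> rows" "0 < k" for k u v
  proof -
    have lv: "lv k < k"
      by (rule lv_less[OF that(3)])
    have "(\<Prod>l<k. if l < lv k then 1 else ?a (snd (word k u v l)))
        = (\<Prod>l<k. if l < Suc (lv k) then (if l = lv k then ?a u else 1) else ?a v)"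
      using that row_digit(2) by (intro prod.cong) (auto simp: word_def)
    also have "\<dots> = (\<Prod>l<k. if l = lv k then ?a u else 1) * (\<Prod>l<k. if l < Suc (lv k) then 1 else ?a v)"
      by (subst prod.distrib[symmetric]) (intro prod.cong, auto)
    also have "(\<Prod>l<k. if l < Suc (lv k) then 1 else ?a v) = ?a v ^ (k - Suc (lv k))"
      using prod_if_less[of "Suc (lv k)" k 1 "?a v"] lv by simp
    also have "(\<Prod>l<k. if l = lv k then ?a u else 1) = ?a u"
      using lv by (simp add: prod.delta)
    finally show ?thesis
      by (simp add: weight_def)
  qed
  have inner: "real (y_index k (word k u v)) + 1 / (real m)\<^sup>2 \<le> real m ^ k * snd (pt (word k u v))"
    "real m ^ k * snd (pt (word k u v)) \<le> real (y_index k (word k u v)) + 1 - 1 / (real m)\<^sup>2"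
    if uv: "u \<in> rows" "v \<in> rows" and "0 < k" for k u v
  proof -
    let ?t = "\<lambda>l. snd (word k u v (l + k))"
    have t: "\<forall>l. ?t l < m"
      using codes_bounds(2)[OF codes[OF uv]] by simp
    have "?t 0 = j" "?t 1 = Suc j"
      using j row_digit(2) lv_less[OF \<open>0 < k\<close>] by (auto simp: word_def)
    then have "place_value m ?t 2 = m * j + Suc j"
      by (simp add: numeral_2_eq_2)
    then have e: "real (m * j + Suc j) \<le> (real m)\<^sup>2 * expansion m ?t"
      "(real m)\<^sup>2 * expansion m ?t \<le> real (m * j + Suc j) + 1"
      using expansion_bounds[OF m t, of 2] by auto
    have "Suc j < m"
      using j(2) rows_less by blast
    then have "m * (j + 2) \<le> m * m"
      by (intro mult_left_mono) auto
    then have "m * j + Suc j + 2 \<le> m * m"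
      using \<open>Suc j < m\<close> unfolding distrib_left by linarith
    then have "real (m * j + Suc j) + 2 \<le> (real m)\<^sup>2"
      by (metis of_nat_add of_nat_le_iff of_nat_mult of_nat_numeral power2_eq_square)
    then have e': "1 \<le> (real m)\<^sup>2 * expansion m ?t" "(real m)\<^sup>2 * expansion m ?t \<le> (real m)\<^sup>2 - 1"
      using e by linarith+
    have pos: "0 < (real m)\<^sup>2"
      using m by simp
    have "1 / (real m)\<^sup>2 \<le> expansion m ?t"
      using e'(1) pos by (simp add: pos_divide_le_eq mult.commute)
    moreover have "expansion m ?t \<le> 1 - 1 / (real m)\<^sup>2"
    proof -
      have "expansion m ?t \<le> ((real m)\<^sup>2 - 1) / (real m)\<^sup>2"
        using e'(2) pos by (simp add: pos_le_divide_eq mult.commute)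
      then show ?thesis
        using pos by (simp add: diff_divide_distrib)
    qed
    moreover have "real m ^ k * snd (pt (word k u v)) = real (y_index k (word k u v)) + expansion m ?t"
      using expansion_shift[OF m codes_bounds(2)[OF codes[OF uv]], of k k]
      by (simp add: coding_map_def y_index_def)
    ultimately show "real (y_index k (word k u v)) + 1 / (real m)\<^sup>2 \<le> real m ^ k * snd (pt (word k u v))"
      "real m ^ k * snd (pt (word k u v)) \<le> real (y_index k (word k u v)) + 1 - 1 / (real m)\<^sup>2"
      by linarith+
  qed
  have x: "x_index k (word k u v) = x_index k (word k u' v')" for k u v u' v'
    unfolding x_index_def by (rule place_value_cong) (simp add: word_def)
  have y: "y_index k (word k (Suc j) 0) = Suc (y_index k (word k j (m - 1)))" if "0 < k" for k
  proof -
    have "Suc (lv k + (k - Suc (lv k))) = k"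
      using lv_less[OF that] by simp
    then show ?thesis
      using place_value_carry[of m "lv k" "\<lambda>l. snd (word k (Suc j) 0 l)" "\<lambda>l. snd (word k j (m - 1) l)" "k - Suc (lv k)"]
        m j ends row_digit(2) lv_less[OF that] by (simp add: y_index_def word_def)
  qed
  have "?a (m - 1) \<le> ?a 0"
  proof (rule power_growth_le)
    fix t0
    obtain k where k: "Suc t0 \<le> k - lv k"
      using gap_unbounded by blast
    then have "0 < k"
      by simp
    have "weight k (word k j (m - 1)) \<le> K * weight k (word k (Suc j) 0)"
      using j ends \<open>0 < k\<close> by (intro K(2) codes x inner) (simp_all add: y)
    then have "?a j * ?a (m - 1) ^ (k - Suc (lv k)) \<le> K * (?a (Suc j) * ?a 0 ^ (k - Suc (lv k)))"
      using j ends \<open>0 < k\<close> card_D_pos by (simp add: weight divide_right_mono pos_divide_le_eq)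
    then have "?a (m - 1) ^ (k - Suc (lv k)) \<le> K * ?a (Suc j) / ?a j * ?a 0 ^ (k - Suc (lv k))"
      using a_pos[OF j(1)] by (simp add: pos_le_divide_eq mult_ac)
    then show "\<exists>t\<ge>t0. ?a (m - 1) ^ t \<le> K * ?a (Suc j) / ?a j * ?a 0 ^ t"
      using k by (intro exI[of _ "k - Suc (lv k)"]) simp
  qed (use a_pos[OF ends(1)] in auto)
  moreover have "?a 0 \<le> ?a (m - 1)"
  proof (rule power_growth_le)
    fix t0
    obtain k where k: "Suc t0 \<le> k - lv k"
      using gap_unbounded by blast
    then have "0 < k"
      by simp
    have "weight k (word k (Suc j) 0) \<le> K * weight k (word k j (m - 1))"
      using j ends \<open>0 < k\<close> by (intro K(2) codes x inner) (simp_all add: y)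
    then have "?a (Suc j) * ?a 0 ^ (k - Suc (lv k)) \<le> K * (?a j * ?a (m - 1) ^ (k - Suc (lv k)))"
      using j ends \<open>0 < k\<close> card_D_pos by (simp add: weight divide_right_mono pos_divide_le_eq)
    then have "?a 0 ^ (k - Suc (lv k)) \<le> K * ?a j / ?a (Suc j) * ?a (m - 1) ^ (k - Suc (lv k))"
      using a_pos[OF j(2)] by (simp add: pos_le_divide_eq mult_ac)
    then show "\<exists>t\<ge>t0. ?a 0 ^ t \<le> K * ?a j / ?a (Suc j) * ?a (m - 1) ^ t"
      using k by (intro exI[of _ "k - Suc (lv k)"]) simp
  qed (use a_pos[OF ends(2)] in auto)
  ultimately show ?thesis
    by simp
qed

end

section \<open>Nearby squares have finitely many mass ratios\<close>

text \<open>Products and sums of boundedly many members of a finite set; written with lists of bounded length,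
  their finiteness is that of the set of these lists.\<close>

definition short_products :: "real set \<Rightarrow> nat \<Rightarrow> real set" where
  "short_products G r = prod_list ` {xs. set xs \<subseteq> G \<and> length xs \<le> r}"

definition short_sums :: "real set \<Rightarrow> nat \<Rightarrow> real set" where
  "short_sums G r = sum_list ` {xs. set xs \<subseteq> G \<and> length xs \<le> r}"

lemma finite_short_products: "finite G \<Longrightarrow> finite (short_products G r)"
  by (simp add: short_products_def finite_lists_length_le)

lemma finite_short_sums: "finite G \<Longrightarrow> finite (short_sums G r)"
  by (simp add: short_sums_def finite_lists_length_le)

lemma short_products_one: "1 \<in> short_products G r"
  unfolding short_products_def by (rule image_eqI[of _ _ "[]"]) auto

lemma short_products_single: "g \<in> G \<Longrightarrow> g \<in> short_products G 1"
  unfolding short_products_def by (rule image_eqI[of _ _ "[g]"]) auto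

lemma short_products_mult:
  assumes "x \<in> short_products G r" "y \<in> short_products G s"
  shows "x * y \<in> short_products G (r + s)"
proof -
  obtain xs ys where "set xs \<subseteq> G" "length xs \<le> r" "x = prod_list xs" "set ys \<subseteq> G" "length ys \<le> s" "y = prod_list ys"
    using assms unfolding short_products_def by blast
  then show ?thesis
    unfolding short_products_def by (intro image_eqI[of _ _ "xs @ ys"]) auto
qed

lemma short_products_mono: "x \<in> short_products G r \<Longrightarrow> r \<le> s \<Longrightarrow> x \<in> short_products G s"
  unfolding short_products_def by fastforce

lemma short_products_prod:
  assumes "finite A" "\<And>l. l \<in> A \<Longrightarrow> f l \<in> G"
  shows "(\<Prod>l\<in>A. f l) \<in> short_products G (card A)"
  using assms
proof (induction A)
  case (insert l A)
  then have "f l * (\<Prod>l\<in>A. f l) \<in> short_products G (1 + card A)"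
    by (intro short_products_mult short_products_single) auto
  then show ?case
    using insert by simp
qed (simp add: short_products_one)

lemma short_products_pos:
  assumes "\<And>g. g \<in> G \<Longrightarrow> 0 < g" "x \<in> short_products G r"
  shows "0 < x"
proof -
  obtain xs where "set xs \<subseteq> G" "x = prod_list xs"
    using assms(2) unfolding short_products_def by blast
  then show ?thesis
    using assms(1) by (induction xs arbitrary: x) auto
qed

lemma short_sums_sum:
  assumes "finite A" "\<And>l. l \<in> A \<Longrightarrow> f l \<in> G" "card A \<le> r"
  shows "(\<Sum>l\<in>A. f l) \<in> short_sums G r"
proof -
  obtain xs where xs: "set xs = A" "distinct xs"
    using finite_distinct_list[OF assms(1)] by blast
  then have "(\<Sum>l\<in>A. f l) = sum_list (map f xs)"
    by (simp add: sum_list_distinct_conv_sum_set)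
  moreover have "length (map f xs) \<le> r"
    using xs assms(3) distinct_card[of xs] by simp
  ultimately show ?thesis
    unfolding short_sums_def using xs assms(2) by (intro image_eqI[of _ _ "map f xs"]) auto
qed

lemma div_diff_le_one:
  fixes A B q :: nat
  assumes "A < B + q" "B < A + q"
  shows "A div q = B div q \<or> A div q = Suc (B div q) \<or> B div q = Suc (A div q)"
proof -
  have q: "0 < q"
    using assms by linarith
  have "A div q \<le> (B + q) div q" "B div q \<le> (A + q) div q"
    using assms by (simp_all only: div_le_mono less_imp_le_nat)
  then show ?thesis
    using q by auto
qed

lemma digit_unique:
  fixes b :: nat
  assumes "b * u + x = b * v + y" "x < b" "y < b"
  shows "u = v \<and> x = y"
proof -
  have "(b * u + x) div b = u" "(b * v + y) div b = v"
    using assms(2,3) by simp_all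
  then have "u = v"
    using assms(1) by simp
  then show ?thesis
    using assms(1) by simp
qed

context carpet_digits
begin

definition row_product :: "nat \<Rightarrow> nat \<Rightarrow> (nat \<Rightarrow> nat \<times> nat) \<Rightarrow> real" where
  "row_product p k \<omega> = (\<Prod>l<k. if l < p then 1 else real (distribution_seq D (snd (\<omega> l))))"

definition ratios :: "real set" where
  "ratios = (\<lambda>(i, j). real (distribution_seq D i) / real (distribution_seq D j)) ` (rows \<times> rows)"

definition factors :: "real set" where
  "factors = insert 1 (insert (1 / real (card D)) (ratios \<union>
     (\<lambda>j. real (distribution_seq D j)) ` rows \<union> (\<lambda>j. 1 / real (distribution_seq D j)) ` rows))"

lemma finite_factors: "finite factors"
  using finite_rows by (simp add: factors_def ratios_def)

lemma factors_pos: "g \<in> factors \<Longrightarrow> 0 < g"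
  using card_D_pos rows_iff unfolding factors_def ratios_def by auto

lemma row_count_pos: "\<omega> \<in> codes D \<Longrightarrow> 0 < real (distribution_seq D (snd (\<omega> l)))"
  using row_pos codesD by simp

lemma row_product_pos: "\<omega> \<in> codes D \<Longrightarrow> 0 < row_product p k \<omega>"
  using row_count_pos unfolding row_product_def by (intro prod_pos) auto

lemma row_product_Suc:
  "row_product p (Suc k) \<omega> = row_product p k \<omega> * (if k < p then 1 else real (distribution_seq D (snd (\<omega> k))))"
  by (simp add: row_product_def)

lemma weight_row_product: "weight k \<omega> = row_product (lv k) k \<omega> / real (card D) ^ k"
  by (simp add: weight_def row_product_def)

lemma code_row: "\<omega> \<in> codes D \<Longrightarrow> snd (\<omega> l) \<in> rows"
  using codesD snd_rows by blast

lemma ratios_one: "1 \<in> ratios"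
proof -
  obtain j where "j \<in> rows"
    using rows_nonempty by blast
  then show ?thesis
    using rows_iff unfolding ratios_def by (intro image_eqI[of _ _ "(j, j)"]) auto
qed

lemma ratios_inverse: "x / y \<in> ratios \<Longrightarrow> y / x \<in> ratios"
proof -
  assume "x / y \<in> ratios"
  then obtain i j where "i \<in> rows" "j \<in> rows" "x / y = real (distribution_seq D i) / real (distribution_seq D j)"
    unfolding ratios_def by auto
  then have "inverse (x / y) = real (distribution_seq D j) / real (distribution_seq D i)"
    by simp
  then have "y / x = real (distribution_seq D j) / real (distribution_seq D i)"
    by simp
  then show ?thesis
    unfolding ratios_def using \<open>i \<in> rows\<close> \<open>j \<in> rows\<close> by (intro image_eqI[of _ _ "(j, i)"]) auto
qed

lemma weight_Suc_ratio:
  assumes "\<omega> \<in> codes D"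
  shows "weight (Suc k) \<omega> / weight k \<omega> \<in> short_products factors 3"
proof -
  let ?a = "\<lambda>l. real (distribution_seq D (snd (\<omega> l)))"
  have fac: "?a l \<in> factors" "1 / ?a l \<in> factors" "1 \<in> factors" "1 / real (card D) \<in> factors" for l
    using code_row[OF assms] by (auto simp: factors_def)
  have "lv (Suc k) = lv k \<or> lv (Suc k) = Suc (lv k)"
    using lv_mono[of k "Suc k"] lv_add_le[of k 1] by auto
  then have "row_product (lv (Suc k)) k \<omega> = row_product (lv k) k \<omega> * 1
      \<or> row_product (lv (Suc k)) k \<omega> = row_product (lv k) k \<omega> * (1 / ?a (lv k))"
  proof
    assume *: "lv (Suc k) = Suc (lv k)"
    have split: "(if l < lv k then 1 else ?a l) = (if l < Suc (lv k) then 1 else ?a l) * (if l = lv k then ?a l else 1)" for l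
      by auto
    have "row_product (lv k) k \<omega> = row_product (Suc (lv k)) k \<omega> * (\<Prod>l<k. if l = lv k then ?a l else 1)"
      unfolding row_product_def by (subst split) (rule prod.distrib)
    also have "(\<Prod>l<k. if l = lv k then ?a l else 1) = (if lv k < k then ?a (lv k) else 1)"
      by (simp add: prod.delta)
    finally show ?thesis
      using * row_count_pos[OF assms, of "lv k"] by (auto split: if_splits)
  qed simp
  then obtain x where x: "x \<in> factors" "row_product (lv (Suc k)) k \<omega> = row_product (lv k) k \<omega> * x"
    using fac by blast
  define y where "y = (if k < lv (Suc k) then 1 else ?a k)"
  have "weight (Suc k) \<omega> / weight k \<omega> = x * y * (1 / real (card D))"
    unfolding weight_row_product row_product_Suc x(2) y_def[symmetric]
    using row_product_pos[OF assms, of "lv k" k] card_D_pos by (simp add: field_simps)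
  moreover have "y \<in> factors"
    using fac by (simp add: y_def)
  ultimately show ?thesis
    using short_products_mult[OF short_products_mult[OF short_products_single[OF x(1)] short_products_single]
        short_products_single[OF fac(4)]] by (simp add: numeral_3_eq_3)
qed

lemma weight_add_ratio:
  assumes "\<omega> \<in> codes D"
  shows "weight (k + c) \<omega> / weight k \<omega> \<in> short_products factors (3 * c)"
proof (induction c)
  case 0
  then show ?case
    using weight_pos[OF assms, of k] by (simp add: short_products_one)
next
  case (Suc c)
  have "weight (k + c) \<omega> / weight k \<omega> * (weight (Suc (k + c)) \<omega> / weight (k + c) \<omega>) \<in> short_products factors (3 * c + 3)"
    by (rule short_products_mult[OF Suc weight_Suc_ratio[OF assms]])
  then show ?case
    using weight_pos[OF assms, of "k + c"] by (simp add: add.commute)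
qed

lemma card_near_squares:
  assumes \<omega>: "\<omega> \<in> codes D"
  shows "card (square k ` {\<omega>' \<in> codes D. dist (pt \<omega>) (pt \<omega>') \<le> C / real m ^ k}) \<le> (2 * nat \<lceil>C + 1\<rceil> + 1)\<^sup>2"
proof -
  define b where "b = nat \<lceil>C + 1\<rceil>"
  define X Y where "X = x_index k \<omega>" and "Y = y_index k \<omega>"
  have "square k ` {\<omega>' \<in> codes D. dist (pt \<omega>) (pt \<omega>') \<le> C / real m ^ k} \<subseteq> {X - b..X + b} \<times> {Y - b..Y + b}"
  proof (rule image_subsetI)
    fix \<omega>' assume "\<omega>' \<in> {\<omega>' \<in> codes D. dist (pt \<omega>) (pt \<omega>') \<le> C / real m ^ k}"
    then have \<omega>': "\<omega>' \<in> codes D" "dist (pt \<omega>) (pt \<omega>') \<le> C / real m ^ k"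
      by auto
    have "\<bar>real X - real (x_index k \<omega>')\<bar> \<le> real b" "\<bar>real Y - real (y_index k \<omega>')\<bar> \<le> real b"
      using index_dist[OF \<omega> \<omega>'] unfolding X_def Y_def b_def by linarith+
    then have "X \<le> x_index k \<omega>' + b" "x_index k \<omega>' \<le> X + b" "Y \<le> y_index k \<omega>' + b" "y_index k \<omega>' \<le> Y + b"
      by linarith+
    then show "square k \<omega>' \<in> {X - b..X + b} \<times> {Y - b..Y + b}"
      unfolding square_def by auto
  qed
  then have "card (square k ` {\<omega>' \<in> codes D. dist (pt \<omega>) (pt \<omega>') \<le> C / real m ^ k})
      \<le> card ({X - b..X + b} \<times> {Y - b..Y + b})"
    by (intro card_mono) auto
  also have "\<dots> \<le> (2 * b + 1)\<^sup>2"
    unfolding power2_eq_square card_cartesian_product card_atLeastAtMost by (intro mult_mono) simp_all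
  finally show ?thesis
    unfolding b_def .
qed

end

context doubling_carpet
begin

text \<open>Consecutive row indices differ by a carry: below the digit that is raised, one word has only
  bottom rows and the other only top rows, which contribute equally.\<close>

lemma consecutive_row_product_ratio:
  assumes "\<omega> \<in> codes D" "\<omega>' \<in> codes D" "y_index k \<omega>' = Suc (y_index k \<omega>)"
  shows "(\<exists>q. snd (\<omega>' q) = Suc (snd (\<omega> q))) \<and> row_product p k \<omega> / row_product p k \<omega>' \<in> ratios"
  using assms(3)
proof (induction k)
  case (Suc k)
  let ?y = "snd (\<omega> k)" and ?y' = "snd (\<omega>' k)" and ?Y = "y_index k \<omega>" and ?Y' = "y_index k \<omega>'"
  have less: "?y < m" "?y' < m"
    using codes_bounds assms(1,2) by auto
  have eq: "m * ?Y' + ?y' = m * ?Y + ?y + 1"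
    using Suc.prems by (simp add: y_index_def)
  show ?case
  proof (cases "Suc ?y = m")
    case True
    then have "m * ?Y' + ?y' = m * Suc ?Y + 0"
      using eq by simp
    then have "?Y' = Suc ?Y \<and> ?y' = 0"
      using less(2) by (rule digit_unique) (use m in simp)
    then have carry: "?Y' = Suc ?Y" "?y' = 0" "?y = m - 1"
      using True by auto
    then obtain q where q: "snd (\<omega>' q) = Suc (snd (\<omega> q))" "row_product p k \<omega> / row_product p k \<omega>' \<in> ratios"
      using Suc.IH by blast
    have "distribution_seq D ?y = distribution_seq D ?y'"
      using extreme_rows_eq[of "snd (\<omega> q)"] code_row[OF assms(1), of q] code_row[OF assms(2), of q]
        code_row[OF assms(1), of k] code_row[OF assms(2), of k] q(1) carry by simp
    then have "row_product p (Suc k) \<omega> / row_product p (Suc k) \<omega>' = row_product p k \<omega> / row_product p k \<omega>'"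
      using row_count_pos[OF assms(2), of k] by (simp add: row_product_Suc)
    then show ?thesis
      using q by auto
  next
    case False
    then have "Suc ?y < m"
      using less by simp
    then have "?Y' = ?Y \<and> ?y' = Suc ?y"
      using eq less(2) by (intro digit_unique) simp_all
    then have step: "?Y' = ?Y" "?y' = Suc ?y"
      by auto
    have "\<forall>l<k. snd (\<omega>' l) = snd (\<omega> l)"
      using step(1) place_value_eq_iff[OF codes_bounds(2)[OF assms(2)] codes_bounds(2)[OF assms(1)]]
      unfolding y_index_def by blast
    then have "row_product p k \<omega>' = row_product p k \<omega>"
      unfolding row_product_def by (intro prod.cong) auto
    then have "row_product p (Suc k) \<omega> / row_product p (Suc k) \<omega>'
        = (if k < p then 1 else real (distribution_seq D ?y) / real (distribution_seq D ?y'))"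
      using row_product_pos[OF assms(1), of p k] by (simp add: row_product_Suc)
    also have "\<dots> \<in> ratios"
      using ratios_one code_row[OF assms(1), of k] code_row[OF assms(2), of k]
      by (auto simp: ratios_def intro!: image_eqI[of _ _ "(snd (\<omega> k), snd (\<omega>' k))"])
    finally show ?thesis
      using step(2) by blast
  qed
qed (simp add: y_index_def)

text \<open>After the last \<open>p\<close> digits are removed, nearby row indices differ by at most one; the removed
  digits contribute boundedly many factors and the others a single ratio of two counts.\<close>

lemma weight_ratio:
  assumes \<omega>: "\<omega> \<in> codes D" and \<omega>': "\<omega>' \<in> codes D"
    and near: "\<bar>real (y_index k \<omega>) - real (y_index k \<omega>')\<bar> < real m ^ p"
  shows "weight k \<omega> / weight k \<omega>' \<in> short_products factors (1 + (p + p))"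
proof -
  define v where "v = k - p"
  have v: "v \<le> k" "k - v \<le> p"
    by (auto simp: v_def)
  have div: "y_index k \<omega>1 div m ^ (k - v) = y_index v \<omega>1" if "\<omega>1 \<in> codes D" for \<omega>1
    unfolding y_index_def using place_value_div[OF codes_bounds(2)[OF that] v(1)] .
  have "y_index v \<omega> = y_index v \<omega>' \<or> y_index v \<omega> = Suc (y_index v \<omega>') \<or> y_index v \<omega>' = Suc (y_index v \<omega>)"
  proof (cases "k \<le> p")
    case True
    then show ?thesis
      by (simp add: v_def y_index_def)
  next
    case False
    then have "k - v = p"
      by (simp add: v_def)
    moreover have "y_index k \<omega> < y_index k \<omega>' + m ^ p" "y_index k \<omega>' < y_index k \<omega> + m ^ p"
      using near unfolding of_nat_power[symmetric] by linarith+
    ultimately show ?thesis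
      using div_diff_le_one[of "y_index k \<omega>" "y_index k \<omega>'" "m ^ p"] div[OF \<omega>] div[OF \<omega>'] by simp
  qed
  then have high: "row_product (lv k) v \<omega> / row_product (lv k) v \<omega>' \<in> ratios"
  proof (elim disjE)
    assume "y_index v \<omega> = y_index v \<omega>'"
    then have "\<forall>l<v. snd (\<omega> l) = snd (\<omega>' l)"
      using place_value_eq_iff[OF codes_bounds(2)[OF \<omega>] codes_bounds(2)[OF \<omega>']] unfolding y_index_def by blast
    then have "row_product (lv k) v \<omega> = row_product (lv k) v \<omega>'"
      unfolding row_product_def by (intro prod.cong) auto
    then show ?thesis
      using ratios_one row_product_pos[OF \<omega>', of "lv k" v] by simp
  next
    assume "y_index v \<omega> = Suc (y_index v \<omega>')"
    then show ?thesis
      using consecutive_row_product_ratio[OF \<omega>' \<omega>] ratios_inverse by blast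
  next
    assume "y_index v \<omega>' = Suc (y_index v \<omega>)"
    then show ?thesis
      using consecutive_row_product_ratio[OF \<omega> \<omega>'] by blast
  qed
  define low where "low \<omega>1 = (\<Prod>l\<in>{v..<k}. if l < lv k then 1 else real (distribution_seq D (snd (\<omega>1 l))))"
    for \<omega>1 :: "nat \<Rightarrow> nat \<times> nat"
  have split: "row_product (lv k) k \<omega>1 = row_product (lv k) v \<omega>1 * low \<omega>1" for \<omega>1
  proof -
    have union: "{..<v} \<union> {v..<k} = {..<k}"
      using v(1) by auto
    show ?thesis
      unfolding row_product_def low_def by (subst prod.union_disjoint[symmetric]) (simp_all add: union ivl_disj_int)
  qed
  have low: "low \<omega> \<in> short_products factors p"
  proof -
    have "low \<omega> \<in> short_products factors (card {v..<k})"
      unfolding low_def using code_row[OF \<omega>] by (intro short_products_prod) (auto simp: factors_def)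
    then show ?thesis
      using v(2) by (auto intro: short_products_mono)
  qed
  have low': "1 / low \<omega>' \<in> short_products factors p"
  proof -
    have "1 / low \<omega>' = (\<Prod>l\<in>{v..<k}. 1 / (if l < lv k then 1 else real (distribution_seq D (snd (\<omega>' l)))))"
      unfolding low_def by (simp add: prod_dividef)
    also have "\<dots> \<in> short_products factors (card {v..<k})"
      using code_row[OF \<omega>'] by (intro short_products_prod) (auto simp: factors_def)
    finally show ?thesis
      using v(2) by (auto intro: short_products_mono)
  qed
  have "weight k \<omega> / weight k \<omega>' = row_product (lv k) v \<omega> / row_product (lv k) v \<omega>' * (low \<omega> * (1 / low \<omega>'))"
    unfolding weight_row_product split using card_D_pos by simp
  also have "\<dots> \<in> short_products factors (1 + (p + p))"
    using high by (intro short_products_mult short_products_single low low') (simp add: factors_def)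
  finally show ?thesis .
qed

lemma near_weight_ratio:
  "\<exists>\<Theta>. finite \<Theta> \<and> (\<forall>t\<in>\<Theta>. 0 < t) \<and> (\<forall>k. \<forall>\<omega>\<in>codes D. \<forall>\<omega>'\<in>codes D.
     dist (pt \<omega>) (pt \<omega>') \<le> C / real m ^ k \<longrightarrow> weight (k + c) \<omega>' / weight k \<omega> \<in> \<Theta>)"
proof -
  obtain p where p: "C + 1 < real m ^ p"
    using real_arch_pow[of "real m" "C + 1"] m by auto
  have "weight (k + c) \<omega>' / weight k \<omega> \<in> short_products factors (1 + (p + p) + 3 * c)"
    if \<omega>: "\<omega> \<in> codes D" and \<omega>': "\<omega>' \<in> codes D" and d: "dist (pt \<omega>) (pt \<omega>') \<le> C / real m ^ k" for k \<omega> \<omega>'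
  proof -
    have "\<bar>real (y_index k \<omega>') - real (y_index k \<omega>)\<bar> < real m ^ p"
      using index_dist(2)[OF \<omega> \<omega>' d] p by linarith
    then have "weight k \<omega>' / weight k \<omega> * (weight (k + c) \<omega>' / weight k \<omega>') \<in> short_products factors (1 + (p + p) + 3 * c)"
      by (intro short_products_mult weight_ratio weight_add_ratio \<omega> \<omega>')
    then show ?thesis
      using weight_pos[OF \<omega>', of k] by simp
  qed
  then show ?thesis
    using finite_short_products[OF finite_factors] short_products_pos[OF factors_pos]
    by (intro exI[of _ "short_products factors (1 + (p + p) + 3 * c)"]) blast
qed

text \<open>A set that is adapted to the scale \<open>k\<close> consists of boundedly many squares, and each of them has
  one of finitely many masses relative to a given square nearby.\<close>

lemma saturated_mass_ratio:
  "\<exists>\<Theta>. finite \<Theta> \<and> (\<forall>k A. \<forall>\<omega>\<in>codes D. saturated (k + c) A \<longrightarrow>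
     (\<forall>\<omega>'\<in>codes D. pt \<omega>' \<in> A \<longrightarrow> dist (pt \<omega>) (pt \<omega>') \<le> C / real m ^ k) \<longrightarrow> mass A / weight k \<omega> \<in> \<Theta>)"
proof -
  obtain \<Theta> where \<Theta>: "finite \<Theta>" "\<And>k \<omega> \<omega>'. \<omega> \<in> codes D \<Longrightarrow> \<omega>' \<in> codes D \<Longrightarrow>
     dist (pt \<omega>) (pt \<omega>') \<le> C / real m ^ k \<Longrightarrow> weight (k + c) \<omega>' / weight k \<omega> \<in> \<Theta>"
    using near_weight_ratio[of C c] by blast
  define r where "r = (2 * nat \<lceil>C * real m ^ c + 1\<rceil> + 1)\<^sup>2"
  have "mass A / weight k \<omega> \<in> short_sums \<Theta> r"
    if \<omega>: "\<omega> \<in> codes D" and sat: "saturated (k + c) A"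
      and near: "\<And>\<omega>'. \<omega>' \<in> codes D \<Longrightarrow> pt \<omega>' \<in> A \<Longrightarrow> dist (pt \<omega>) (pt \<omega>') \<le> C / real m ^ k" for k A \<omega>
  proof -
    define S where "S = square (k + c) ` {\<omega>' \<in> codes D. pt \<omega>' \<in> A}"
    have "S \<subseteq> square (k + c) ` {\<omega>' \<in> codes D. dist (pt \<omega>) (pt \<omega>') \<le> (C * real m ^ c) / real m ^ (k + c)}"
      unfolding S_def using near m by (intro image_mono) (auto simp: power_add)
    then have "card S \<le> card (square (k + c) ` {\<omega>' \<in> codes D. dist (pt \<omega>) (pt \<omega>') \<le> (C * real m ^ c) / real m ^ (k + c)})"
      by (intro card_mono finite_squares) auto
    also have "\<dots> \<le> r"
      unfolding r_def by (rule card_near_squares[OF \<omega>])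
    finally have card: "card S \<le> r" .
    have "mass A / weight k \<omega> = (\<Sum>Q\<in>S. square_mass (k + c) Q / weight k \<omega>)"
      unfolding mass_saturated[OF sat] S_def by (rule sum_divide_distrib)
    also have "\<dots> \<in> short_sums \<Theta> r"
    proof (rule short_sums_sum[OF _ _ card])
      show "finite S"
        unfolding S_def by (intro finite_squares) auto
      fix Q assume "Q \<in> S"
      then obtain \<omega>' where \<omega>': "\<omega>' \<in> codes D" "pt \<omega>' \<in> A" "Q = square (k + c) \<omega>'"
        by (auto simp: S_def)
      then show "square_mass (k + c) Q / weight k \<omega> \<in> \<Theta>"
        using \<Theta>(2)[OF \<omega> \<omega>'(1) near[OF \<omega>'(1,2)]] square_mass_weight by simp
    qed
    finally show ?thesis .
  qed
  then show ?thesis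
    using finite_short_sums[OF \<Theta>(1)] by (intro exI[of _ "short_sums \<Theta> r"]) blast
qed

end

section \<open>Clusters\<close>

definition chains :: "'a::metric_space set \<Rightarrow> real \<Rightarrow> 'a rel" where
  "chains E \<delta> = {(x, y). x \<in> E \<and> y \<in> E \<and> dist x y < \<delta>}\<^sup>*"

definition cluster :: "'a::metric_space set \<Rightarrow> real \<Rightarrow> 'a \<Rightarrow> 'a set" where
  "cluster E \<delta> x = {y. (x, y) \<in> chains E \<delta>}"

lemma cluster_refl: "x \<in> cluster E \<delta> x"
  by (simp add: cluster_def chains_def)

lemma cluster_subset:
  assumes "x \<in> E"
  shows "cluster E \<delta> x \<subseteq> E"
proof
  fix y assume "y \<in> cluster E \<delta> x"
  then have "(x, y) \<in> {(x, y). x \<in> E \<and> y \<in> E \<and> dist x y < \<delta>}\<^sup>*"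
    by (simp add: cluster_def chains_def)
  then show "y \<in> E"
    by (cases rule: rtranclE) (use assms in auto)
qed

lemma cluster_eq:
  assumes "y \<in> cluster E \<delta> x"
  shows "cluster E \<delta> y = cluster E \<delta> x"
proof -
  have "sym {(x, y). x \<in> E \<and> y \<in> E \<and> dist x y < \<delta>}"
    by (auto simp: sym_def dist_commute)
  then have "sym (chains E \<delta>)"
    unfolding chains_def by (rule sym_rtrancl)
  then have "(x, y) \<in> chains E \<delta>" "(y, x) \<in> chains E \<delta>"
    using assms by (auto simp: cluster_def dest: symD)
  moreover have "trans (chains E \<delta>)"
    unfolding chains_def by (rule trans_rtrancl)
  ultimately show ?thesis
    unfolding cluster_def by (auto dest: transD)
qed

lemma cluster_mono:
  assumes "\<delta>' \<le> \<delta>"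
  shows "cluster E \<delta>' x \<subseteq> cluster E \<delta> x"
proof -
  have "chains E \<delta>' \<subseteq> chains E \<delta>"
    unfolding chains_def using assms by (intro rtrancl_mono) auto
  then show ?thesis
    by (auto simp: cluster_def)
qed

lemma cluster_near:
  assumes "y \<in> cluster E \<delta> x" "y \<in> E" "z \<in> E" "dist y z < \<delta>"
  shows "z \<in> cluster E \<delta> x"
  using assms unfolding cluster_def chains_def by (auto intro: rtrancl_into_rtrancl)

locale scattered_carpet = doubling_carpet +
  assumes vacant_row: "\<exists>j<m. j \<notin> rows"
    and rows_not_full: "\<And>j. distribution_seq D j < n"
begin

lemma cluster_code_invariant:
  assumes step: "\<And>\<omega>1 \<omega>2. \<omega>1 \<in> codes D \<Longrightarrow> \<omega>2 \<in> codes D \<Longrightarrow> dist (pt \<omega>1) (pt \<omega>2) < \<delta> \<Longrightarrow> R \<omega>1 \<Longrightarrow> R \<omega>2"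
    and \<omega>: "\<omega> \<in> codes D" "R \<omega>" and "0 < \<delta>"
    and \<omega>': "\<omega>' \<in> codes D" "pt \<omega>' \<in> cluster (carpet n m D) \<delta> (pt \<omega>)"
  shows "R \<omega>'"
proof -
  have "(pt \<omega>, pt \<omega>') \<in> {(x, y). x \<in> carpet n m D \<and> y \<in> carpet n m D \<and> dist x y < \<delta>}\<^sup>*"
    using \<omega>'(2) by (simp add: cluster_def chains_def)
  then have "\<forall>\<omega>2\<in>codes D. pt \<omega>2 = pt \<omega>' \<longrightarrow> R \<omega>2"
  proof (induction rule: rtrancl_induct)
    case base
    show ?case
      using step[OF \<omega>(1)] \<omega>(2) \<open>0 < \<delta>\<close> by simp
  next
    case (step y z)
    then obtain \<omega>1 where "\<omega>1 \<in> codes D" "y = pt \<omega>1"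
      unfolding carpet_eq by blast
    then show ?case
      using step.IH step.hyps(2) assms(1)[of \<omega>1] by auto
  qed
  then show ?thesis
    using \<omega>'(1) by blast
qed

text \<open>A row index whose last digit is vacant is never taken; two points closer than the height of
  the squares cannot lie on different sides of this empty strip.\<close>

lemma cluster_y_index:
  assumes \<omega>: "\<omega> \<in> codes D" and \<omega>': "\<omega>' \<in> codes D" "pt \<omega>' \<in> cluster (carpet n m D) (1 / real m ^ k) (pt \<omega>)"
  shows "m * (y_index k \<omega> div m - 1) \<le> y_index k \<omega>' \<and> y_index k \<omega>' < m * (y_index k \<omega> div m + 2)"
proof (cases k)
  case 0
  then show ?thesis
    using m by (simp add: y_index_def)
next
  case (Suc k')
  obtain v where v: "v < m" "v \<notin> rows"
    using vacant_row by blast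
  have missing: "y_index k \<omega>1 \<noteq> m * q + v" if "\<omega>1 \<in> codes D" for \<omega>1 q
  proof
    assume "y_index k \<omega>1 = m * q + v"
    then have "m * y_index k' \<omega>1 + snd (\<omega>1 k') = m * q + v"
      by (simp add: y_index_def Suc)
    then have "snd (\<omega>1 k') = v"
      using digit_unique[of m "y_index k' \<omega>1" "snd (\<omega>1 k')" q v] codes_bounds(2)[OF that] v(1) by blast
    then show False
      using code_row[OF that] v(2) by metis
  qed
  have pos: "0 < real m ^ k"
    using m by simp
  have close: "y_index k \<omega>1 < m * q + v \<longleftrightarrow> y_index k \<omega>2 < m * q + v"
    if c: "\<omega>1 \<in> codes D" "\<omega>2 \<in> codes D" and d: "dist (pt \<omega>1) (pt \<omega>2) < 1 / real m ^ k" for \<omega>1 \<omega>2 q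
  proof -
    have "real m ^ k * \<bar>snd (pt \<omega>1) - snd (pt \<omega>2)\<bar> < real m ^ k * (1 / real m ^ k)"
      using dist_coordinates(2)[of "pt \<omega>1" "pt \<omega>2"] d pos by (intro mult_strict_left_mono) auto
    then have "\<bar>real m ^ k * snd (pt \<omega>1) - real m ^ k * snd (pt \<omega>2)\<bar> < 1"
      unfolding abs_mult_diff_pos[OF pos] using m by simp
    then have "real (y_index k \<omega>1) < real (y_index k \<omega>2) + 2" "real (y_index k \<omega>2) < real (y_index k \<omega>1) + 2"
      using y_index_bounds[OF c(1), of k] y_index_bounds[OF c(2), of k] by linarith+
    then show ?thesis
      using missing[OF c(1), of q] missing[OF c(2), of q] by linarith
  qed
  have invariant: "y_index k \<omega>' < m * q + v \<longleftrightarrow> y_index k \<omega> < m * q + v" for q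
  proof -
    define R where "R \<omega>1 \<longleftrightarrow> (y_index k \<omega>1 < m * q + v \<longleftrightarrow> y_index k \<omega> < m * q + v)" for \<omega>1
    have "R \<omega>'"
    proof (rule cluster_code_invariant[where R = R and \<delta> = "1 / real m ^ k", OF _ \<omega> _ _ \<omega>'])
      show "R \<omega>2" if "\<omega>1 \<in> codes D" "\<omega>2 \<in> codes D" "dist (pt \<omega>1) (pt \<omega>2) < 1 / real m ^ k" "R \<omega>1" for \<omega>1 \<omega>2
        using close[OF that(1-3), of q] that(4) unfolding R_def by blast
    qed (use pos in \<open>simp_all add: R_def\<close>)
    then show ?thesis
      unfolding R_def .
  qed
  define q where "q = y_index k \<omega> div m"
  have q: "m * q \<le> y_index k \<omega>" "y_index k \<omega> < m * q + m"
    using m mult_div_mod_eq[of m "y_index k \<omega>"] mod_less_divisor[of m "y_index k \<omega>"] unfolding q_def by linarith+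
  have "y_index k \<omega>' < m * (q + 1) + v"
    using invariant[of "q + 1"] q by simp
  then have "y_index k \<omega>' < m * (q + 2)"
    using v(1) by simp
  moreover have "m * (q - 1) \<le> y_index k \<omega>'"
  proof (cases q)
    case (Suc q')
    then have "\<not> y_index k \<omega> < m * q' + v"
      using q v(1) by simp
    then show ?thesis
      using invariant[of q'] Suc by simp
  qed simp
  ultimately show ?thesis
    unfolding q_def by blast
qed

text \<open>A row that is not full leaves at least one of \<open>n\<close> columns free at each place, so a fixed word of
  rows meets at most \<open>(n - 1) ^ p\<close> of \<open>n ^ p\<close> consecutive columns.\<close>

lemma card_columns_le:
  assumes "p \<le> lv k"
  shows "card {x_index k \<omega> | \<omega>. \<omega> \<in> codes D \<and> y_index k \<omega> = Y \<and> x_index k \<omega> div n ^ p = t} \<le> (n - 1) ^ p"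
proof (cases "\<exists>\<omega>\<in>codes D. y_index k \<omega> = Y")
  case False
  then have "{x_index k \<omega> | \<omega>. \<omega> \<in> codes D \<and> y_index k \<omega> = Y \<and> x_index k \<omega> div n ^ p = t} = {}"
    by blast
  then show ?thesis
    by (simp only: card.empty)
next
  case True
  then obtain \<omega>0 where \<omega>0: "\<omega>0 \<in> codes D" "y_index k \<omega>0 = Y"
    by blast
  define r where "r = lv k - p"
  define S where "S i = {place_value n (\<lambda>l. fst (\<omega> l)) (r + i) | \<omega>. \<omega> \<in> codes D
    \<and> (\<forall>l<k. snd (\<omega> l) = snd (\<omega>0 l)) \<and> place_value n (\<lambda>l. fst (\<omega> l)) r = t}" for i
  have bound: "finite (S i) \<and> card (S i) \<le> (n - 1) ^ i" if "i \<le> p" for i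
    using that
  proof (induction i)
    case 0
    have "S 0 \<subseteq> {t}"
      by (auto simp: S_def)
    then show ?case
      using card_mono[of "{t}" "S 0"] finite_subset[of "S 0" "{t}"] by simp
  next
    case (Suc i)
    define T where "T = {x. (x, snd (\<omega>0 (r + i))) \<in> D}"
    have T: "finite T" "card T \<le> n - 1"
    proof -
      have "T \<subseteq> {..<n}"
        using D_bounds by (auto simp: T_def)
      then show "finite T"
        using finite_subset by blast
      show "card T \<le> n - 1"
        using rows_not_full[of "snd (\<omega>0 (r + i))"] by (simp add: T_def distribution_seq_def)
    qed
    have sub: "S (Suc i) \<subseteq> (\<lambda>(X, x). n * X + x) ` (S i \<times> T)"
    proof
      fix z assume "z \<in> S (Suc i)"
      then obtain \<omega> where \<omega>: "\<omega> \<in> codes D" "\<forall>l<k. snd (\<omega> l) = snd (\<omega>0 l)"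
        "place_value n (\<lambda>l. fst (\<omega> l)) r = t" "z = place_value n (\<lambda>l. fst (\<omega> l)) (r + Suc i)"
        by (auto simp: S_def)
      have "r + i < k"
        using Suc.prems assms lv_le[of k] by (simp add: r_def)
      then have "fst (\<omega> (r + i)) \<in> T"
        using \<omega>(2) codesD[OF \<omega>(1), of "r + i"] unfolding T_def by (metis mem_Collect_eq prod.collapse)
      moreover have "place_value n (\<lambda>l. fst (\<omega> l)) (r + i) \<in> S i"
        using \<omega> by (auto simp: S_def)
      ultimately show "z \<in> (\<lambda>(X, x). n * X + x) ` (S i \<times> T)"
        using \<omega>(4) by (intro image_eqI[of _ _ "(place_value n (\<lambda>l. fst (\<omega> l)) (r + i), fst (\<omega> (r + i)))"]) auto
    qed
    have fin: "finite (S i \<times> T)" "card (S i) \<le> (n - 1) ^ i"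
      using Suc T(1) by auto
    have "card (S (Suc i)) \<le> card (S i \<times> T)"
      using sub fin(1) by (meson card_image_le card_mono finite_imageI le_trans)
    also have "\<dots> = card (S i) * card T"
      by (rule card_cartesian_product)
    also have "\<dots> \<le> (n - 1) ^ i * (n - 1)"
      using fin(2) T(2) by (rule mult_le_mono)
    finally show ?case
      using sub fin(1) finite_subset by (auto simp: mult.commute)
  qed
  have "{x_index k \<omega> | \<omega>. \<omega> \<in> codes D \<and> y_index k \<omega> = Y \<and> x_index k \<omega> div n ^ p = t} \<subseteq> S p"
  proof
    fix z assume "z \<in> {x_index k \<omega> | \<omega>. \<omega> \<in> codes D \<and> y_index k \<omega> = Y \<and> x_index k \<omega> div n ^ p = t}"
    then obtain \<omega> where \<omega>: "z = x_index k \<omega>" "\<omega> \<in> codes D" "y_index k \<omega> = y_index k \<omega>0" "x_index k \<omega> div n ^ p = t"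
      unfolding \<omega>0(2) by blast
    have "\<forall>l<k. snd (\<omega> l) = snd (\<omega>0 l)"
      using \<omega>(3) place_value_eq_iff[OF codes_bounds(2)[OF \<omega>(2)] codes_bounds(2)[OF \<omega>0(1)]] unfolding y_index_def by blast
    moreover have "place_value n (\<lambda>l. fst (\<omega> l)) r = t"
      using place_value_div[OF codes_bounds(1)[OF \<omega>(2)], of r "lv k"] \<omega>(4) assms by (simp add: r_def x_index_def)
    moreover have "r + p = lv k"
      using assms by (simp add: r_def)
    ultimately show "z \<in> S p"
      using \<omega>(1,2) by (auto simp: S_def x_index_def)
  qed
  then show ?thesis
    using bound[OF order_refl] card_mono order_trans by blast
qed

lemma missing_column:
  assumes p: "p \<le> lv k" and count: "card S * (n - 1) ^ p < n ^ p" and "finite S"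
  shows "\<exists>Z. n ^ p * t \<le> Z \<and> Z < n ^ p * (t + 1) \<and> (\<forall>\<omega>\<in>codes D. y_index k \<omega> \<in> S \<longrightarrow> x_index k \<omega> \<noteq> Z)"
proof -
  define A where "A Y = {x_index k \<omega> | \<omega>. \<omega> \<in> codes D \<and> y_index k \<omega> = Y \<and> x_index k \<omega> div n ^ p = t}" for Y
  let ?I = "{n ^ p * t..<n ^ p * (t + 1)}"
  have np: "0 < n ^ p"
    using n by simp
  have I: "Z \<in> ?I \<Longrightarrow> Z div n ^ p = t" for Z
    by (rule div_nat_eqI) (simp_all add: algebra_simps)
  have "card (\<Union>Y\<in>S. A Y) \<le> (\<Sum>Y\<in>S. card (A Y))"
    by (rule card_UN_le[OF \<open>finite S\<close>])
  also have "\<dots> \<le> (\<Sum>Y\<in>S. (n - 1) ^ p)"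
    unfolding A_def by (intro sum_mono card_columns_le p)
  also have "\<dots> < card ?I"
    using count by simp
  finally have less: "card (\<Union>Y\<in>S. A Y) < card ?I" .
  have "finite (A Y)" for Y
  proof (rule finite_subset)
    show "A Y \<subseteq> {..<n ^ p * (t + 1)}"
    proof
      fix X assume "X \<in> A Y"
      then have "X div n ^ p = t"
        by (auto simp: A_def)
      then show "X \<in> {..<n ^ p * (t + 1)}"
        using np dividend_less_times_div[of "n ^ p" X] by simp
    qed
  qed simp
  then have "finite (\<Union>Y\<in>S. A Y)"
    using \<open>finite S\<close> by blast
  then have "\<not> ?I \<subseteq> (\<Union>Y\<in>S. A Y)"
    using less card_mono by (meson linorder_not_less)
  then obtain Z where Z: "Z \<in> ?I" "Z \<notin> (\<Union>Y\<in>S. A Y)"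
    by blast
  then show ?thesis
    using I[OF Z(1)] unfolding A_def by (intro exI[of _ Z]) auto
qed

text \<open>Within the boundedly many rows that a cluster can use, some column of every long block is
  free, and clusters cannot jump over it.\<close>

lemma cluster_diameter:
  "\<exists>K. \<forall>k. \<forall>x\<in>carpet n m D. \<forall>y\<in>cluster (carpet n m D) (1 / real m ^ k) x. dist x y \<le> K / real m ^ k"
proof -
  have "1 < real n / real (n - 1)"
    using n by (simp add: of_nat_diff)
  \<comment> \<open>A cluster meets at most \<open>3 * m\<close> rows of squares, and these must not fill a block of \<open>n ^ p\<close> columns.\<close>
  then obtain p where p: "real (3 * m) < (real n / real (n - 1)) ^ p"
    using real_arch_pow by blast
  have "real (3 * m) * real (n - 1) ^ p < real n ^ p"
    using p n by (simp add: power_divide pos_less_divide_eq)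
  then have count: "3 * m * (n - 1) ^ p < n ^ p"
    unfolding of_nat_power[symmetric] of_nat_mult[symmetric] of_nat_less_iff .
  define c where "c = real (2 * n ^ p + 2 * m)"
  have *: "dist (pt \<omega>) (pt \<omega>') \<le> (c + 1) * (real n + 1) / real m ^ k"
    if \<omega>: "\<omega> \<in> codes D" and \<omega>': "\<omega>' \<in> codes D" "pt \<omega>' \<in> cluster (carpet n m D) (1 / real m ^ k) (pt \<omega>)" for k \<omega> \<omega>'
  proof (rule dist_index[OF \<omega> \<omega>'(1)])
    define q where "q = y_index k \<omega> div m"
    have q: "m * q \<le> y_index k \<omega>" "y_index k \<omega> < m * q + m"
      using m mult_div_mod_eq[of m "y_index k \<omega>"] mod_less_divisor[of m "y_index k \<omega>"] unfolding q_def by linarith+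
    have y: "m * (q - 1) \<le> y_index k \<omega>' \<and> y_index k \<omega>' < m * (q + 2)"
      unfolding q_def by (rule cluster_y_index[OF \<omega> \<omega>'])
    then have "y_index k \<omega>' < y_index k \<omega> + 2 * m" "y_index k \<omega> < y_index k \<omega>' + 2 * m"
      using q by (cases q; simp)+
    then have "\<bar>real (y_index k \<omega>) - real (y_index k \<omega>')\<bar> \<le> real (2 * m)"
      by linarith
    then show "\<bar>real (y_index k \<omega>) - real (y_index k \<omega>')\<bar> \<le> c"
      unfolding c_def by linarith
    have "x_index k \<omega>' < x_index k \<omega> + 2 * n ^ p \<and> x_index k \<omega> < x_index k \<omega>' + 2 * n ^ p"
    proof (cases "p \<le> lv k")
      case False
      have "x_index k \<omega>1 < n ^ p" if "\<omega>1 \<in> codes D" for \<omega>1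
      proof -
        have "x_index k \<omega>1 < n ^ lv k"
          unfolding x_index_def using codes_bounds(1)[OF that] by (intro place_value_less) simp
        also have "\<dots> \<le> n ^ p"
          using False n by (intro power_increasing) auto
        finally show ?thesis .
      qed
      from this[OF \<omega>] this[OF \<omega>'(1)] show ?thesis
        by linarith
    next
      case True
      define S where "S = {m * (q - 1)..<m * (q + 2)}"
      have "card S \<le> 3 * m"
        unfolding S_def by (cases q) (simp_all add: algebra_simps)
      then have "card S * (n - 1) ^ p < n ^ p"
        using count by (meson le_less_trans mult_le_mono1)
      then have missing: "\<exists>Z. n ^ p * t \<le> Z \<and> Z < n ^ p * (t + 1) \<and> (\<forall>\<omega>\<in>codes D. y_index k \<omega> \<in> S \<longrightarrow> x_index k \<omega> \<noteq> Z)" for t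
        by (intro missing_column True) (auto simp: S_def)
      have pos: "0 < real m ^ k" "0 < real n ^ lv k"
        using m n by simp_all
      have close: "x_index k \<omega>1 < Z \<longleftrightarrow> x_index k \<omega>2 < Z"
        if Z: "\<forall>\<omega>\<in>codes D. y_index k \<omega> \<in> S \<longrightarrow> x_index k \<omega> \<noteq> Z"
          and c: "\<omega>1 \<in> codes D" "\<omega>2 \<in> codes D" "y_index k \<omega>1 \<in> S" "y_index k \<omega>2 \<in> S"
          and d: "dist (pt \<omega>1) (pt \<omega>2) < 1 / real m ^ k" for Z \<omega>1 \<omega>2
      proof -
        have "real n ^ lv k * \<bar>fst (pt \<omega>1) - fst (pt \<omega>2)\<bar> \<le> real m ^ k * \<bar>fst (pt \<omega>1) - fst (pt \<omega>2)\<bar>"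
          using lv_le_power by (intro mult_right_mono) auto
        also have "\<dots> < real m ^ k * (1 / real m ^ k)"
          using dist_coordinates(1)[of "pt \<omega>1" "pt \<omega>2"] d pos by (intro mult_strict_left_mono) auto
        finally have "\<bar>real n ^ lv k * fst (pt \<omega>1) - real n ^ lv k * fst (pt \<omega>2)\<bar> < 1"
          unfolding abs_mult_diff_pos[OF pos(2)] using m by simp
        then have "real (x_index k \<omega>1) < real (x_index k \<omega>2) + 2" "real (x_index k \<omega>2) < real (x_index k \<omega>1) + 2"
          using x_index_bounds[OF c(1), of k] x_index_bounds[OF c(2), of k] by linarith+
        moreover have "x_index k \<omega>1 \<noteq> Z" "x_index k \<omega>2 \<noteq> Z"
          using Z c by auto
        ultimately show ?thesis
          by linarith
      qed
      have in_S: "y_index k \<omega>1 \<in> S" if "\<omega>1 \<in> codes D" "pt \<omega>1 \<in> cluster (carpet n m D) (1 / real m ^ k) (pt \<omega>)" for \<omega>1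
        using cluster_y_index[OF \<omega> that] by (simp add: S_def q_def)
      have invariant: "x_index k \<omega>' < Z \<longleftrightarrow> x_index k \<omega> < Z"
        if Z: "\<forall>\<omega>\<in>codes D. y_index k \<omega> \<in> S \<longrightarrow> x_index k \<omega> \<noteq> Z" for Z
      proof -
        define R where "R \<omega>1 \<longleftrightarrow> pt \<omega>1 \<in> cluster (carpet n m D) (1 / real m ^ k) (pt \<omega>)
          \<and> (x_index k \<omega>1 < Z \<longleftrightarrow> x_index k \<omega> < Z)" for \<omega>1
        have "R \<omega>'"
        proof (rule cluster_code_invariant[where R = R and \<delta> = "1 / real m ^ k", OF _ \<omega> _ _ \<omega>'])
          fix \<omega>1 \<omega>2 assume c: "\<omega>1 \<in> codes D" "\<omega>2 \<in> codes D" "dist (pt \<omega>1) (pt \<omega>2) < 1 / real m ^ k" "R \<omega>1"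
          have "pt \<omega>1 \<in> carpet n m D" "pt \<omega>2 \<in> carpet n m D"
            using c(1,2) unfolding carpet_eq by blast+
          then have "pt \<omega>2 \<in> cluster (carpet n m D) (1 / real m ^ k) (pt \<omega>)"
            using c(3,4) cluster_near unfolding R_def by blast
          then show "R \<omega>2"
            using close[OF Z c(1,2) in_S[OF c(1)] in_S[OF c(2)] c(3)] c(4) unfolding R_def by blast
        qed (use pos in \<open>simp_all add: R_def cluster_refl\<close>)
        then show ?thesis
          unfolding R_def by blast
      qed
      define t where "t = x_index k \<omega> div n ^ p"
      have np: "0 < n ^ p"
        using n by simp
      have t: "n ^ p * t \<le> x_index k \<omega>" "x_index k \<omega> < n ^ p * t + n ^ p"
        using mult_div_mod_eq[of "n ^ p" "x_index k \<omega>"] mod_less_divisor[OF np, of "x_index k \<omega>"] unfolding t_def by linarith+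
      obtain Z where Z: "n ^ p * (t + 1) \<le> Z" "Z < n ^ p * (t + 1 + 1)" "\<forall>\<omega>\<in>codes D. y_index k \<omega> \<in> S \<longrightarrow> x_index k \<omega> \<noteq> Z"
        using missing[of "t + 1"] by blast
      have "x_index k \<omega>' < Z"
        using invariant[OF Z(3)] Z(1) t by simp
      then have "x_index k \<omega>' < x_index k \<omega> + 2 * n ^ p"
        using Z(2) t by (simp add: algebra_simps)
      moreover have "x_index k \<omega> < x_index k \<omega>' + 2 * n ^ p"
      proof (cases t)
        case 0
        then show ?thesis
          using t by simp
      next
        case (Suc t')
        obtain Z where Z: "n ^ p * t' \<le> Z" "Z < n ^ p * (t' + 1)" "\<forall>\<omega>\<in>codes D. y_index k \<omega> \<in> S \<longrightarrow> x_index k \<omega> \<noteq> Z"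
          using missing[of t'] by blast
        have "\<not> x_index k \<omega>' < Z"
          using invariant[OF Z(3)] Z(2) t Suc by simp
        then show ?thesis
          using Z(1) t Suc by (simp add: algebra_simps)
      qed
      ultimately show ?thesis
        by blast
    qed
    then have "\<bar>real (x_index k \<omega>) - real (x_index k \<omega>')\<bar> \<le> real (2 * n ^ p)"
      by linarith
    then show "\<bar>real (x_index k \<omega>) - real (x_index k \<omega>')\<bar> \<le> c"
      unfolding c_def by linarith
  qed
  have "dist x y \<le> (c + 1) * (real n + 1) / real m ^ k"
    if x: "x \<in> carpet n m D" and y: "y \<in> cluster (carpet n m D) (1 / real m ^ k) x" for k x y
  proof -
    have "y \<in> carpet n m D"
      using x y cluster_subset by blast
    then obtain \<omega> \<omega>' where "\<omega> \<in> codes D" "x = pt \<omega>" "\<omega>' \<in> codes D" "y = pt \<omega>'"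
      using x unfolding carpet_eq by blast
    then show ?thesis
      using *[of \<omega> \<omega>' k] y by simp
  qed
  then show ?thesis
    by blast
qed

end

section \<open>Bi-Lipschitz maps compare masses\<close>

lemma sum_fibres_le:
  fixes w :: "'b \<Rightarrow> real"
  assumes "finite S" "finite T" "\<And>x. x \<in> S \<Longrightarrow> h x \<in> T" "\<And>t. card {x \<in> S. h x = t} \<le> B" "\<And>t. t \<in> T \<Longrightarrow> 0 \<le> w t"
  shows "(\<Sum>x\<in>S. w (h x)) \<le> real B * (\<Sum>t\<in>T. w t)"
proof -
  have "(\<Sum>x\<in>S. w (h x)) = (\<Sum>t\<in>T. \<Sum>x\<in>{x \<in> S. h x = t}. w (h x))"
    using assms(1-3) by (intro sum.group[symmetric]) auto
  also have "\<dots> = (\<Sum>t\<in>T. real (card {x \<in> S. h x = t}) * w t)"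
    by simp
  also have "\<dots> \<le> (\<Sum>t\<in>T. real B * w t)"
    using assms(4,5) by (intro sum_mono mult_right_mono) auto
  finally show ?thesis
    by (simp add: sum_distrib_left)
qed

locale lipschitz_carpets = E: scattered_carpet n m D + F: scattered_carpet n m D'
  for n m :: nat and D D' :: "(nat \<times> nat) set" +
  fixes f :: "real \<times> real \<Rightarrow> real \<times> real" and C :: real
  assumes f_image: "f ` carpet n m D = carpet n m D'" and C_pos: "0 < C"
    and f_lower: "x \<in> carpet n m D \<Longrightarrow> y \<in> carpet n m D \<Longrightarrow> dist x y \<le> C * dist (f x) (f y)"
    and f_upper: "x \<in> carpet n m D \<Longrightarrow> y \<in> carpet n m D \<Longrightarrow> dist (f x) (f y) \<le> C * dist x y"
begin

abbreviation "pt \<equiv> coding_map n m"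

definition fibre_bound :: nat where
  "fibre_bound = (2 * nat \<lceil>C * (real n + 1) + 1\<rceil> + 1)\<^sup>2"

lemma fibre_bound_pos: "0 < real fibre_bound"
  by (simp add: fibre_bound_def)

lemma pt_E: "\<omega> \<in> codes D \<Longrightarrow> pt \<omega> \<in> carpet n m D"
  unfolding E.carpet_eq by blast

lemma pt_F: "\<omega> \<in> codes D' \<Longrightarrow> pt \<omega> \<in> carpet n m D'"
  unfolding F.carpet_eq by blast

lemma image_code: "x \<in> carpet n m D \<Longrightarrow> \<exists>\<omega>'\<in>codes D'. pt \<omega>' = f x"
  using f_image F.carpet_eq by force

lemma preimage_code: "\<omega>' \<in> codes D' \<Longrightarrow> \<exists>\<omega>\<in>codes D. pt \<omega>' = f (pt \<omega>)"
  using f_image pt_F[of \<omega>'] unfolding E.carpet_eq by blast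

lemma inverse_lipschitz: "\<exists>g. lipschitz_carpets n m D' D g C \<and> (\<forall>x\<in>carpet n m D. g (f x) = x)"
proof -
  define g where "g = inv_into (carpet n m D) f"
  have inj: "inj_on f (carpet n m D)"
  proof (rule inj_onI)
    fix x y assume "x \<in> carpet n m D" "y \<in> carpet n m D" "f x = f y"
    then show "x = y"
      using f_lower[of x y] by simp
  qed
  have g: "g y \<in> carpet n m D" "f (g y) = y" if "y \<in> carpet n m D'" for y
    using that f_image inv_into_into[of y f "carpet n m D"] f_inv_into_f[of y f "carpet n m D"]
    unfolding g_def by auto
  have gf: "g (f x) = x" if "x \<in> carpet n m D" for x
    unfolding g_def using inv_into_f_f[OF inj that] .
  have "g ` carpet n m D' = carpet n m D"
  proof
    show "carpet n m D \<subseteq> g ` carpet n m D'"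
      using gf f_image by force
  qed (use g(1) in blast)
  then have "lipschitz_carpets n m D' D g C"
    using C_pos g f_lower f_upper
    by (intro lipschitz_carpets.intro lipschitz_carpets_axioms.intro E.scattered_carpet_axioms F.scattered_carpet_axioms)
      (simp_all, metis+)
  then show ?thesis
    using gf by blast
qed

text \<open>A bi-Lipschitz map induces maps of squares with bounded fibres, because squares with the same
  image lie close together.\<close>

lemma squares_map:
  assumes A: "A \<subseteq> codes D" and A': "A' \<subseteq> codes D'"
    and related: "\<And>\<omega>. \<omega> \<in> A \<Longrightarrow> \<exists>\<omega>'\<in>A'. pt \<omega>' = f (pt \<omega>)"
  obtains h where
    "\<And>Q. Q \<in> E.square k ` A \<Longrightarrow>
       \<exists>\<omega>\<in>A. \<exists>\<omega>'\<in>A'. pt \<omega>' = f (pt \<omega>) \<and> Q = E.square k \<omega> \<and> h Q = E.square k \<omega>'"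
    "\<And>t. card {Q \<in> E.square k ` A. h Q = t} \<le> fibre_bound"
proof -
  let ?S = "E.square k ` A"
  obtain \<phi> where \<phi>: "\<And>\<omega>. \<omega> \<in> A \<Longrightarrow> \<phi> \<omega> \<in> A' \<and> pt (\<phi> \<omega>) = f (pt \<omega>)"
    using related by metis
  have "\<forall>Q\<in>?S. \<exists>\<omega>. \<omega> \<in> A \<and> E.square k \<omega> = Q"
    by blast
  then obtain rep where rep: "\<And>Q. Q \<in> ?S \<Longrightarrow> rep Q \<in> A \<and> E.square k (rep Q) = Q"
    by (meson bchoice)
  define h where "h Q = E.square k (\<phi> (rep Q))" for Q
  have fibre: "card {Q \<in> ?S. h Q = t} \<le> fibre_bound" for t
  proof (cases "{Q \<in> ?S. h Q = t} = {}")
    case False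
    then obtain Q0 where Q0: "Q0 \<in> ?S" "h Q0 = t"
      by blast
    define near where "near = {\<omega> \<in> codes D. dist (pt (rep Q0)) (pt \<omega>) \<le> (C * (real n + 1)) / real m ^ k}"
    have "{Q \<in> ?S. h Q = t} \<subseteq> E.square k ` near"
    proof
      fix Q assume "Q \<in> {Q \<in> ?S. h Q = t}"
      then have Q: "Q \<in> ?S" "h Q = h Q0"
        using Q0(2) by auto
      have codes: "rep Q \<in> codes D" "rep Q0 \<in> codes D"
        using rep[OF Q(1)] rep[OF Q0(1)] A by blast+
      have image: "\<phi> (rep Q) \<in> codes D'" "\<phi> (rep Q0) \<in> codes D'"
        "pt (\<phi> (rep Q)) = f (pt (rep Q))" "pt (\<phi> (rep Q0)) = f (pt (rep Q0))"
        using \<phi> rep[OF Q(1)] rep[OF Q0(1)] A' by blast+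
      have "dist (pt (rep Q0)) (pt (rep Q)) \<le> C * dist (pt (\<phi> (rep Q0))) (pt (\<phi> (rep Q)))"
        unfolding image(3,4) by (rule f_lower[OF pt_E[OF codes(2)] pt_E[OF codes(1)]])
      also have "\<dots> \<le> C * ((real n + 1) / real m ^ k)"
        using Q(2) C_pos unfolding h_def by (intro mult_left_mono F.square_eq_dist image) auto
      finally show "Q \<in> E.square k ` near"
        using rep[OF Q(1)] codes by (intro image_eqI[of _ _ "rep Q"]) (auto simp: near_def)
    qed
    then have "card {Q \<in> ?S. h Q = t} \<le> card (E.square k ` near)"
      by (intro card_mono E.finite_squares) (auto simp: near_def)
    also have "\<dots> \<le> fibre_bound"
      unfolding fibre_bound_def near_def using rep[OF Q0(1)] A by (intro E.card_near_squares) blast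
    finally show ?thesis .
  next
    case True
    then show ?thesis
      by (simp only: card.empty)
  qed
  have "\<exists>\<omega>\<in>A. \<exists>\<omega>'\<in>A'. pt \<omega>' = f (pt \<omega>) \<and> Q = E.square k \<omega> \<and> h Q = E.square k \<omega>'" if "Q \<in> ?S" for Q
    using \<phi>[of "rep Q"] rep[OF that] unfolding h_def by metis
  then show thesis
    using that[of h] fibre by blast
qed

lemma card_squares_le:
  assumes A: "A \<subseteq> codes D" and A': "A' \<subseteq> codes D'"
    and related: "\<And>\<omega>. \<omega> \<in> A \<Longrightarrow> \<exists>\<omega>'\<in>A'. pt \<omega>' = f (pt \<omega>)"
  shows "real (card (E.square k ` A)) \<le> real fibre_bound * real (card (E.square k ` A'))"
proof -
  obtain h where h: "\<And>Q. Q \<in> E.square k ` A \<Longrightarrow>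
       \<exists>\<omega>\<in>A. \<exists>\<omega>'\<in>A'. pt \<omega>' = f (pt \<omega>) \<and> Q = E.square k \<omega> \<and> h Q = E.square k \<omega>'"
    "\<And>t. card {Q \<in> E.square k ` A. h Q = t} \<le> fibre_bound"
    using squares_map[OF A A' related, of k] by blast
  have "(\<Sum>Q\<in>E.square k ` A. 1) \<le> real fibre_bound * (\<Sum>Q\<in>E.square k ` A'. 1)"
  proof (rule sum_fibres_le[where h = h and w = "\<lambda>_. 1", OF E.finite_squares[OF A] F.finite_squares[OF A'] _ h(2)])
    show "h Q \<in> E.square k ` A'" if "Q \<in> E.square k ` A" for Q
      using h(1)[OF that] by blast
  qed simp
  then show ?thesis
    by simp
qed

lemma level_count_le: "\<exists>c>0. \<forall>k. E.level_count k \<le> c * F.level_count k"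
proof -
  have "real (card (E.square k ` codes D)) \<le> real fibre_bound * real (card (E.square k ` codes D'))" for k
    using image_code pt_E by (intro card_squares_le) auto
  then show ?thesis
    using E.card_level_squares F.card_level_squares fibre_bound_pos by (intro exI[of _ "real fibre_bound"]) simp
qed

text \<open>Both masses are proportions of numbers of fine squares, and a bi-Lipschitz map changes such
  numbers by bounded factors only. The image of a square meets boundedly many squares of its level, all
  of comparable mass.\<close>

lemma weight_le_image_weight:
  "\<exists>c>0. \<forall>k. \<forall>\<omega>\<in>codes D. \<forall>\<omega>'\<in>codes D'. pt \<omega>' = f (pt \<omega>) \<longrightarrow> E.weight k \<omega> \<le> c * F.weight k \<omega>'"
proof -
  obtain g where "lipschitz_carpets n m D' D g C"
    using inverse_lipschitz by blast
  then interpret G: lipschitz_carpets n m D' D g C .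
  obtain c where c: "0 < c" "\<And>k. F.level_count k \<le> c * E.level_count k"
    using G.level_count_le by blast
  define R where "R = C * (real n + 1)"
  obtain \<Theta> where \<Theta>: "finite \<Theta>" "\<forall>t\<in>\<Theta>. 0 < t" "\<And>k \<omega> \<omega>'. \<omega> \<in> codes D' \<Longrightarrow> \<omega>' \<in> codes D' \<Longrightarrow>
     dist (pt \<omega>) (pt \<omega>') \<le> R / real m ^ k \<Longrightarrow> F.weight k \<omega>' / F.weight k \<omega> \<in> \<Theta>"
    using F.near_weight_ratio[of R 0] by auto
  define t where "t = Max (insert 1 \<Theta>)"
  have t: "1 \<le> t" "\<And>x. x \<in> \<Theta> \<Longrightarrow> x \<le> t"
    unfolding t_def using \<Theta>(1) by (auto intro: Max_ge)
  define B where "B = fibre_bound"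
  have "E.weight k \<omega> \<le> (real B * real B * t * c) * F.weight k \<omega>'"
    if \<omega>: "\<omega> \<in> codes D" and \<omega>': "\<omega>' \<in> codes D'" "pt \<omega>' = f (pt \<omega>)" for k \<omega> \<omega>'
  proof -
    obtain K where K: "k \<le> E.lv K"
      using E.lv_unbounded[of k] by blast
    define A where "A = {\<omega>1 \<in> codes D. E.square k \<omega>1 = E.square k \<omega>}"
    define A' where "A' = {\<omega>1' \<in> codes D'. dist (pt \<omega>') (pt \<omega>1') \<le> R / real m ^ k}"
    have 1: "real (card (E.square K ` A)) \<le> real B * real (card (E.square K ` A'))"
      unfolding B_def
    proof (rule card_squares_le)
      fix \<omega>1 assume \<omega>1: "\<omega>1 \<in> A"
      then have "\<omega>1 \<in> codes D"
        by (simp add: A_def)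
      then obtain \<omega>1' where \<omega>1': "\<omega>1' \<in> codes D'" "pt \<omega>1' = f (pt \<omega>1)"
        using image_code[OF pt_E] by blast
      have "dist (pt \<omega>') (pt \<omega>1') \<le> C * dist (pt \<omega>) (pt \<omega>1)"
        unfolding \<omega>'(2) \<omega>1'(2) using \<omega> \<omega>1 by (intro f_upper pt_E) (auto simp: A_def)
      also have "\<dots> \<le> C * ((real n + 1) / real m ^ k)"
        using \<omega> \<omega>1 C_pos by (intro mult_left_mono E.square_eq_dist) (auto simp: A_def)
      finally show "\<exists>\<omega>1'\<in>A'. pt \<omega>1' = f (pt \<omega>1)"
        using \<omega>1' by (auto simp: A'_def R_def)
    qed (auto simp: A_def A'_def)
    let ?Q = "E.square k ` A'"
    have fin: "finite ?Q"
      by (rule F.finite_squares) (auto simp: A'_def)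
    have "E.square K ` A' \<subseteq> (\<Union>Q\<in>?Q. E.square K ` {\<omega>1 \<in> codes D'. E.square k \<omega>1 = Q})"
      by (auto simp: A'_def)
    then have "card (E.square K ` A') \<le> card (\<Union>Q\<in>?Q. E.square K ` {\<omega>1 \<in> codes D'. E.square k \<omega>1 = Q})"
      by (intro card_mono finite_UN_I fin F.finite_squares) auto
    also have "\<dots> \<le> (\<Sum>Q\<in>?Q. card (E.square K ` {\<omega>1 \<in> codes D'. E.square k \<omega>1 = Q}))"
      by (rule card_UN_le[OF fin])
    finally have "real (card (E.square K ` A')) \<le> (\<Sum>Q\<in>?Q. real (card (E.square K ` {\<omega>1 \<in> codes D'. E.square k \<omega>1 = Q})))"
      unfolding of_nat_sum[symmetric] of_nat_le_iff .
    also have "\<dots> \<le> (\<Sum>Q\<in>?Q. t * F.weight k \<omega>' * F.level_count K)"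
    proof (rule sum_mono)
      fix Q assume "Q \<in> ?Q"
      then obtain \<omega>1 where \<omega>1: "\<omega>1 \<in> codes D'" "dist (pt \<omega>') (pt \<omega>1) \<le> R / real m ^ k" "Q = E.square k \<omega>1"
        by (auto simp: A'_def)
      have "F.weight k \<omega>1 / F.weight k \<omega>' \<le> t"
        by (rule t(2)[OF \<Theta>(3)[OF \<omega>'(1) \<omega>1(1,2)]])
      then have "F.weight k \<omega>1 \<le> t * F.weight k \<omega>'"
        using F.weight_pos[OF \<omega>'(1), of k] by (simp add: pos_divide_le_eq)
      then show "real (card (E.square K ` {\<omega>1 \<in> codes D'. E.square k \<omega>1 = Q})) \<le> t * F.weight k \<omega>' * F.level_count K"
        unfolding \<omega>1(3) F.card_subsquares[OF \<omega>1(1) K] using F.level_count_pos[of K] by (intro mult_right_mono) auto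
    qed
    also have "\<dots> = real (card ?Q) * (t * F.weight k \<omega>' * F.level_count K)"
      by simp
    also have "\<dots> \<le> real B * (t * F.weight k \<omega>' * F.level_count K)"
    proof (rule mult_right_mono)
      show "real (card ?Q) \<le> real B"
        unfolding A'_def B_def R_def fibre_bound_def of_nat_le_iff by (rule F.card_near_squares[OF \<omega>'(1)])
      show "0 \<le> t * F.weight k \<omega>' * F.level_count K"
        using t(1) F.weight_pos[OF \<omega>'(1), of k] F.level_count_pos[of K] by simp
    qed
    also have "\<dots> \<le> real B * (t * F.weight k \<omega>' * (c * E.level_count K))"
      using c(2)[of K] t(1) F.weight_pos[OF \<omega>'(1), of k] by (intro mult_left_mono) auto
    finally have 2: "real (card (E.square K ` A')) \<le> real B * (t * F.weight k \<omega>' * (c * E.level_count K))" .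
    have "E.weight k \<omega> * E.level_count K = real (card (E.square K ` A))"
      unfolding A_def by (rule E.card_subsquares[OF \<omega> K, symmetric])
    also have "\<dots> \<le> real B * (real B * (t * F.weight k \<omega>' * (c * E.level_count K)))"
      using 1 2 by (meson mult_left_mono of_nat_0_le_iff order_trans)
    also have "\<dots> = (real B * real B * t * c * F.weight k \<omega>') * E.level_count K"
      by simp
    finally show ?thesis
      using E.level_count_pos[of K] by (simp only: mult_le_cancel_right_pos)
  qed
  moreover have "0 < real B * real B * t * c"
    using t(1) c(1) fibre_bound_pos by (simp add: B_def)
  ultimately show ?thesis
    by blast
qed

lemma mass_power_sum_le:
  "\<exists>c>0. \<forall>k. (\<Sum>Q\<in>E.square k ` codes D. E.square_mass k Q ^ e) \<le> c * (\<Sum>Q\<in>E.square k ` codes D'. F.square_mass k Q ^ e)"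
proof -
  obtain c where c: "0 < c" "\<And>k \<omega> \<omega>'. \<omega> \<in> codes D \<Longrightarrow> \<omega>' \<in> codes D' \<Longrightarrow> pt \<omega>' = f (pt \<omega>) \<Longrightarrow>
      E.weight k \<omega> \<le> c * F.weight k \<omega>'"
    using weight_le_image_weight by blast
  define B where "B = fibre_bound"
  have "(\<Sum>Q\<in>E.square k ` codes D. E.square_mass k Q ^ e)
      \<le> (c ^ e * real B) * (\<Sum>Q\<in>E.square k ` codes D'. F.square_mass k Q ^ e)" for k
  proof -
    obtain h where h: "\<And>Q. Q \<in> E.square k ` codes D \<Longrightarrow>
         \<exists>\<omega>\<in>codes D. \<exists>\<omega>'\<in>codes D'. pt \<omega>' = f (pt \<omega>) \<and> Q = E.square k \<omega> \<and> h Q = E.square k \<omega>'"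
      "\<And>t. card {Q \<in> E.square k ` codes D. h Q = t} \<le> B"
      unfolding B_def using squares_map[of "codes D" "codes D'" k] image_code pt_E by blast
    have "(\<Sum>Q\<in>E.square k ` codes D. E.square_mass k Q ^ e) \<le> (\<Sum>Q\<in>E.square k ` codes D. c ^ e * F.square_mass k (h Q) ^ e)"
    proof (rule sum_mono)
      fix Q assume "Q \<in> E.square k ` codes D"
      then obtain \<omega> \<omega>' where \<omega>: "\<omega> \<in> codes D" "\<omega>' \<in> codes D'" "pt \<omega>' = f (pt \<omega>)" "Q = E.square k \<omega>" "h Q = E.square k \<omega>'"
        using h(1) by blast
      have "E.weight k \<omega> ^ e \<le> (c * F.weight k \<omega>') ^ e"
        using c(2)[OF \<omega>(1-3)] E.weight_pos[OF \<omega>(1), of k] by (intro power_mono) auto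
      then show "E.square_mass k Q ^ e \<le> c ^ e * F.square_mass k (h Q) ^ e"
        using E.square_mass_weight[OF \<omega>(1), of k] F.square_mass_weight[OF \<omega>(2), of k] \<omega>(4,5)
        by (simp add: power_mult_distrib)
    qed
    also have "\<dots> = c ^ e * (\<Sum>Q\<in>E.square k ` codes D. F.square_mass k (h Q) ^ e)"
      by (simp add: sum_distrib_left)
    also have "\<dots> \<le> c ^ e * (real B * (\<Sum>Q\<in>E.square k ` codes D'. F.square_mass k Q ^ e))"
    proof (intro mult_left_mono sum_fibres_le)
      show "h Q \<in> E.square k ` codes D'" if "Q \<in> E.square k ` codes D" for Q
        using h(1)[OF that] by blast
    qed (use c(1) h(2) F.square_mass_nonneg in \<open>auto intro: E.finite_squares F.finite_squares\<close>)
    finally show ?thesis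
      by (simp add: mult.assoc)
  qed
  moreover have "0 < c ^ e * real B"
    using c(1) fibre_bound_pos by (simp add: B_def)
  ultimately show ?thesis
    by blast
qed

end

section \<open>A cluster on which the mass ratio is constant\<close>

text \<open>If \<open>\<rho> x\<close> is close enough to the supremum of \<open>\<rho>\<close>, then multiplying it by the least factor
  above 1 would lead beyond the supremum.\<close>

lemma near_supremum:
  fixes \<rho> :: "'a \<Rightarrow> real"
  assumes "finite \<Phi>" "X \<noteq> {}" "\<And>x. x \<in> X \<Longrightarrow> 0 < \<rho> x \<and> \<rho> x \<le> R"
  obtains x where "x \<in> X" "\<And>y \<phi>. y \<in> X \<Longrightarrow> \<phi> \<in> \<Phi> \<Longrightarrow> \<rho> y = \<phi> * \<rho> x \<Longrightarrow> \<rho> y \<le> \<rho> x"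
proof -
  \<comment> \<open>The element 2 only ensures that the minimum exists and exceeds 1.\<close>
  define \<theta> where "\<theta> = Min (insert 2 {\<phi> \<in> \<Phi>. 1 < \<phi>})"
  have fin: "finite (insert 2 {\<phi> \<in> \<Phi>. 1 < \<phi>})"
    using assms(1) by simp
  have \<theta>: "1 < \<theta>" "\<And>\<phi>. \<phi> \<in> \<Phi> \<Longrightarrow> 1 < \<phi> \<Longrightarrow> \<theta> \<le> \<phi>"
    unfolding \<theta>_def using fin by (auto simp: Min_gr_iff)
  define S where "S = Sup (\<rho> ` X)"
  have bdd: "bdd_above (\<rho> ` X)"
    using assms(3) by (intro bdd_aboveI2[of _ _ R]) blast
  have le_S: "\<rho> x \<le> S" if "x \<in> X" for x
    unfolding S_def using that bdd by (rule cSUP_upper)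
  obtain x0 where x0: "x0 \<in> X"
    using assms(2) by blast
  have "0 < S"
    using le_S[OF x0] assms(3)[OF x0] by linarith
  then have "S / \<theta> < S"
    using \<theta>(1) by (simp add: divide_less_eq)
  then obtain x where x: "x \<in> X" "S / \<theta> < \<rho> x"
    unfolding S_def using less_cSUP_iff[OF assms(2) bdd] by blast
  show thesis
  proof (rule that[OF x(1)])
    fix y \<phi> assume y: "y \<in> X" "\<phi> \<in> \<Phi>" "\<rho> y = \<phi> * \<rho> x"
    show "\<rho> y \<le> \<rho> x"
    proof (rule ccontr)
      assume "\<not> \<rho> y \<le> \<rho> x"
      then have "1 < \<phi>"
        using y(3) assms(3)[OF x(1)] by (simp add: not_le)
      then have "\<theta> * \<rho> x \<le> \<rho> y"
        using \<theta>(2)[OF y(2)] y(3) assms(3)[OF x(1)] by (simp add: mult_right_mono)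
      moreover have "S < \<theta> * \<rho> x"
        using x(2) \<theta>(1) by (simp add: divide_less_eq mult.commute)
      ultimately show False
        using le_S[OF y(1)] by linarith
    qed
  qed
qed

lemma sum_le_imp_eq:
  fixes u v :: "'a \<Rightarrow> real"
  assumes "finite P" "\<And>B. B \<in> P \<Longrightarrow> u B \<le> v B" "(\<Sum>B\<in>P. u B) = (\<Sum>B\<in>P. v B)" "B \<in> P"
  shows "u B = v B"
proof -
  have "(\<Sum>B\<in>P. v B - u B) = 0"
    using assms(3) by (simp add: sum_subtractf)
  then have "\<forall>B\<in>P. v B - u B = 0"
    using sum_nonneg_eq_0_iff[of P "\<lambda>B. v B - u B"] assms(1,2) by auto
  then show ?thesis
    using assms(4) by simp
qed

context carpet_digits
begin

lemma weight_le_saturated_mass: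
  assumes "saturated k A" "\<omega> \<in> codes D" "pt \<omega> \<in> A"
  shows "weight k \<omega> \<le> mass A"
  unfolding mass_saturated[OF assms(1)] square_mass_weight[OF assms(2), symmetric]
proof (rule member_le_sum)
  show "finite (square k ` {\<omega> \<in> codes D. pt \<omega> \<in> A})"
    by (intro finite_squares) auto
  show "square k \<omega> \<in> square k ` {\<omega> \<in> codes D. pt \<omega> \<in> A}"
    using assms by blast
qed (simp add: square_mass_nonneg)

lemma mass_UN_disjoint:
  assumes "finite P" "\<And>B. B \<in> P \<Longrightarrow> saturated k (A B)" "disjoint_family_on A P"
  shows "mass (\<Union>B\<in>P. A B) = (\<Sum>B\<in>P. mass (A B))"
proof -
  let ?X = "\<lambda>B. {s \<in> space code_measure. pt (snth s) \<in> A B}"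
  have "{s \<in> space code_measure. pt (snth s) \<in> (\<Union>B\<in>P. A B)} = (\<Union>B\<in>P. ?X B)"
    by auto
  moreover have "measure code_measure (\<Union>B\<in>P. ?X B) = (\<Sum>B\<in>P. measure code_measure (?X B))"
  proof (rule code.finite_measure_finite_Union[OF assms(1)])
    show "?X ` P \<subseteq> sets code_measure"
      using measurable_saturated[OF assms(2)] by blast
    show "disjoint_family_on ?X P"
      using assms(3) unfolding disjoint_family_on_def by blast
  qed
  ultimately show ?thesis
    unfolding mass_def by simp
qed

lemma fine_squares: "\<exists>c. \<forall>k. \<forall>\<omega>\<in>codes D. \<forall>\<omega>'\<in>codes D. square (k + c) \<omega> = square (k + c) \<omega>' \<longrightarrow>
    L * dist (pt \<omega>) (pt \<omega>') < 1 / real m ^ k" if "0 < L"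
proof -
  obtain c where c: "L * (real n + 1) < real m ^ c"
    using real_arch_pow[of "real m" "L * (real n + 1)"] m by auto
  have "L * dist (pt \<omega>) (pt \<omega>') < 1 / real m ^ k"
    if "\<omega> \<in> codes D" "\<omega>' \<in> codes D" "square (k + c) \<omega> = square (k + c) \<omega>'" for k \<omega> \<omega>'
  proof -
    have pos: "0 < real m ^ k" "0 < real m ^ c"
      using m by simp_all
    have "L * dist (pt \<omega>) (pt \<omega>') \<le> L * ((real n + 1) / real m ^ (k + c))"
      using \<open>0 < L\<close> by (intro mult_left_mono square_eq_dist[OF that]) auto
    also have "\<dots> = (L * (real n + 1) / real m ^ c) / real m ^ k"
      by (simp add: power_add)
    also have "\<dots> < 1 / real m ^ k"
      using c pos by (intro divide_strict_right_mono) (simp_all add: divide_less_eq)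
    finally show ?thesis .
  qed
  then show ?thesis
    by blast
qed

end

context lipschitz_carpets
begin

abbreviation A :: "nat \<Rightarrow> real \<times> real \<Rightarrow> (real \<times> real) set" where
  "A k x \<equiv> cluster (carpet n m D) (1 / real m ^ k) x"

lemma inj_f: "inj_on f (carpet n m D)"
proof (rule inj_onI)
  fix x y assume "x \<in> carpet n m D" "y \<in> carpet n m D" "f x = f y"
  then show "x = y"
    using f_lower[of x y] by simp
qed

lemma cluster_Suc_subset: "A (Suc k) x \<subseteq> A k x"
proof (rule cluster_mono)
  show "1 / real m ^ Suc k \<le> 1 / real m ^ k"
    using E.m by (intro divide_left_mono power_increasing) auto
qed

lemma cluster_saturated: "\<exists>c. \<forall>k. \<forall>x\<in>carpet n m D. E.saturated (k + c) (A k x)"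
proof -
  obtain c where c: "\<And>k \<omega> \<omega>'. \<omega> \<in> codes D \<Longrightarrow> \<omega>' \<in> codes D \<Longrightarrow> E.square (k + c) \<omega> = E.square (k + c) \<omega>' \<Longrightarrow>
    1 * dist (pt \<omega>) (pt \<omega>') < 1 / real m ^ k"
    using E.fine_squares[of 1] by auto
  have "E.saturated (k + c) (A k x)" for k x
    unfolding E.saturated_def
  proof (intro ballI impI)
    fix \<omega> \<omega>' assume \<omega>: "\<omega> \<in> codes D" "\<omega>' \<in> codes D" "E.square (k + c) \<omega> = E.square (k + c) \<omega>'" "pt \<omega> \<in> A k x"
    have "dist (pt \<omega>) (pt \<omega>') < 1 / real m ^ k"
      using c[OF \<omega>(1-3)] by simp
    then show "pt \<omega>' \<in> A k x"
      by (rule cluster_near[OF \<omega>(4) pt_E[OF \<omega>(1)] pt_E[OF \<omega>(2)]])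
  qed
  then show ?thesis
    by blast
qed

lemma image_cluster_saturated: "\<exists>c. \<forall>k. \<forall>x\<in>carpet n m D. F.saturated (k + c) (f ` A k x)"
proof -
  obtain c where c: "\<And>k \<omega> \<omega>'. \<omega> \<in> codes D' \<Longrightarrow> \<omega>' \<in> codes D' \<Longrightarrow> F.square (k + c) \<omega> = F.square (k + c) \<omega>' \<Longrightarrow>
    C * dist (pt \<omega>) (pt \<omega>') < 1 / real m ^ k"
    using F.fine_squares[OF C_pos] by blast
  have "F.saturated (k + c) (f ` A k x)" if x: "x \<in> carpet n m D" for k x
    unfolding F.saturated_def
  proof (intro ballI impI)
    fix \<omega> \<omega>' assume \<omega>: "\<omega> \<in> codes D'" "\<omega>' \<in> codes D'" "F.square (k + c) \<omega> = F.square (k + c) \<omega>'" "pt \<omega> \<in> f ` A k x"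
    then obtain z where z: "z \<in> A k x" "pt \<omega> = f z"
      by blast
    have "z \<in> carpet n m D"
      using z(1) cluster_subset[OF x] by blast
    obtain \<omega>1 where \<omega>1: "\<omega>1 \<in> codes D" "pt \<omega>' = f (pt \<omega>1)"
      using preimage_code[OF \<omega>(2)] by blast
    have "dist z (pt \<omega>1) \<le> C * dist (pt \<omega>) (pt \<omega>')"
      unfolding z(2) \<omega>1(2) by (rule f_lower[OF \<open>z \<in> carpet n m D\<close> pt_E[OF \<omega>1(1)]])
    also have "\<dots> < 1 / real m ^ k"
      by (rule c[OF \<omega>(1-3)])
    finally have "pt \<omega>1 \<in> A k x"
      by (intro cluster_near[OF z(1) \<open>z \<in> carpet n m D\<close> pt_E[OF \<omega>1(1)]])
    then show "pt \<omega>' \<in> f ` A k x"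
      using \<omega>1(2) by blast
  qed
  then show ?thesis
    by blast
qed

lemma cluster_mass_ratio:
  "\<exists>\<Theta>. finite \<Theta> \<and> (\<forall>t\<in>\<Theta>. 0 < t) \<and> (\<forall>k. \<forall>\<omega>\<in>codes D. E.mass (A k (pt \<omega>)) / E.weight k \<omega> \<in> \<Theta>)"
proof -
  obtain c where c: "\<And>k x. x \<in> carpet n m D \<Longrightarrow> E.saturated (k + c) (A k x)"
    using cluster_saturated by blast
  obtain K where K: "\<And>k x y. x \<in> carpet n m D \<Longrightarrow> y \<in> A k x \<Longrightarrow> dist x y \<le> K / real m ^ k"
    using E.cluster_diameter by blast
  obtain \<Theta> where \<Theta>: "finite \<Theta>" "\<And>k A \<omega>. \<omega> \<in> codes D \<Longrightarrow> E.saturated (k + c) A \<Longrightarrow>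
     (\<forall>\<omega>'\<in>codes D. pt \<omega>' \<in> A \<longrightarrow> dist (pt \<omega>) (pt \<omega>') \<le> K / real m ^ k) \<Longrightarrow> E.mass A / E.weight k \<omega> \<in> \<Theta>"
    using E.saturated_mass_ratio[of c K] by blast
  have "E.mass (A k (pt \<omega>)) / E.weight k \<omega> \<in> {t \<in> \<Theta>. 0 < t}" if \<omega>: "\<omega> \<in> codes D" for k \<omega>
  proof -
    have "E.weight (k + c) \<omega> \<le> E.mass (A k (pt \<omega>))"
      by (rule E.weight_le_saturated_mass[OF c[OF pt_E[OF \<omega>]] \<omega> cluster_refl])
    then have "0 < E.mass (A k (pt \<omega>)) / E.weight k \<omega>"
      using E.weight_pos[OF \<omega>, of k] E.weight_pos[OF \<omega>, of "k + c"] by simp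
    then show ?thesis
      using \<Theta>(2)[OF \<omega> c[OF pt_E[OF \<omega>]]] K[OF pt_E[OF \<omega>]] by blast
  qed
  then show ?thesis
    using \<Theta>(1) by (intro exI[of _ "{t \<in> \<Theta>. 0 < t}"]) auto
qed

lemma image_cluster_mass_ratio:
  "\<exists>\<Theta>. finite \<Theta> \<and> (\<forall>t\<in>\<Theta>. 0 < t) \<and> (\<forall>k. \<forall>\<omega>\<in>codes D. \<forall>\<omega>'\<in>codes D'. pt \<omega>' = f (pt \<omega>) \<longrightarrow>
     F.mass (f ` A k (pt \<omega>)) / F.weight k \<omega>' \<in> \<Theta>)"
proof -
  obtain c where c: "\<And>k x. x \<in> carpet n m D \<Longrightarrow> F.saturated (k + c) (f ` A k x)"
    using image_cluster_saturated by blast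
  obtain K where K: "\<And>k x y. x \<in> carpet n m D \<Longrightarrow> y \<in> A k x \<Longrightarrow> dist x y \<le> K / real m ^ k"
    using E.cluster_diameter by blast
  obtain \<Theta> where \<Theta>: "finite \<Theta>" "\<And>k A \<omega>. \<omega> \<in> codes D' \<Longrightarrow> F.saturated (k + c) A \<Longrightarrow>
     (\<forall>\<omega>'\<in>codes D'. pt \<omega>' \<in> A \<longrightarrow> dist (pt \<omega>) (pt \<omega>') \<le> (C * K) / real m ^ k) \<Longrightarrow> F.mass A / F.weight k \<omega> \<in> \<Theta>"
    using F.saturated_mass_ratio[of c "C * K"] by blast
  have "F.mass (f ` A k (pt \<omega>)) / F.weight k \<omega>' \<in> {t \<in> \<Theta>. 0 < t}"
    if \<omega>: "\<omega> \<in> codes D" and \<omega>': "\<omega>' \<in> codes D'" "pt \<omega>' = f (pt \<omega>)" for k \<omega> \<omega>'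
  proof -
    have "pt \<omega>' \<in> f ` A k (pt \<omega>)"
      unfolding \<omega>'(2) by (rule imageI[OF cluster_refl])
    then have "F.weight (k + c) \<omega>' \<le> F.mass (f ` A k (pt \<omega>))"
      by (rule F.weight_le_saturated_mass[OF c[OF pt_E[OF \<omega>]] \<omega>'(1)])
    then have "0 < F.mass (f ` A k (pt \<omega>)) / F.weight k \<omega>'"
      using F.weight_pos[OF \<omega>'(1), of k] F.weight_pos[OF \<omega>'(1), of "k + c"] by simp
    moreover have "F.mass (f ` A k (pt \<omega>)) / F.weight k \<omega>' \<in> \<Theta>"
    proof (rule \<Theta>(2)[OF \<omega>'(1) c[OF pt_E[OF \<omega>]]], intro ballI impI)
      fix \<omega>1 assume "\<omega>1 \<in> codes D'" "pt \<omega>1 \<in> f ` A k (pt \<omega>)"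
      then obtain z where z: "z \<in> A k (pt \<omega>)" "pt \<omega>1 = f z"
        by blast
      then have "dist (pt \<omega>') (pt \<omega>1) \<le> C * dist (pt \<omega>) z"
        unfolding \<omega>'(2) z(2) using cluster_subset[OF pt_E[OF \<omega>]] by (intro f_upper pt_E[OF \<omega>]) blast
      also have "\<dots> \<le> C * (K / real m ^ k)"
        using K[OF pt_E[OF \<omega>] z(1)] C_pos by (intro mult_left_mono) auto
      finally show "dist (pt \<omega>') (pt \<omega>1) \<le> (C * K) / real m ^ k"
        by simp
    qed
    ultimately show ?thesis
      by blast
  qed
  then show ?thesis
    using \<Theta>(1) by (intro exI[of _ "{t \<in> \<Theta>. 0 < t}"]) auto
qed

lemma finite_subclusters: "finite (A (Suc k) ` A k x)" if x: "x \<in> carpet n m D"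
proof -
  obtain c where c: "\<And>k x. x \<in> carpet n m D \<Longrightarrow> E.saturated (k + c) (A k x)"
    using cluster_saturated by blast
  define X where "X = {\<omega> \<in> codes D. pt \<omega> \<in> A k x}"
  have same: "A (Suc k) (pt \<omega>) = A (Suc k) (pt \<omega>')"
    if "\<omega> \<in> X" "\<omega>' \<in> X" "E.square (Suc k + c) \<omega> = E.square (Suc k + c) \<omega>'" for \<omega> \<omega>'
  proof -
    have "pt \<omega>' \<in> A (Suc k) (pt \<omega>)"
      using c[OF pt_E, of \<omega> "Suc k"] that cluster_refl unfolding E.saturated_def X_def by blast
    then show ?thesis
      by (rule cluster_eq[symmetric])
  qed
  have "(\<lambda>\<omega>. A (Suc k) (pt \<omega>)) ` X
      \<subseteq> (\<lambda>Q. A (Suc k) (pt (inv_into X (E.square (Suc k + c)) Q))) ` E.square (Suc k + c) ` X"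
  proof (rule image_subsetI)
    fix \<omega> assume "\<omega> \<in> X"
    then have Q: "E.square (Suc k + c) \<omega> \<in> E.square (Suc k + c) ` X"
      by (rule imageI)
    have "A (Suc k) (pt \<omega>) = A (Suc k) (pt (inv_into X (E.square (Suc k + c)) (E.square (Suc k + c) \<omega>)))"
      by (rule same[OF \<open>\<omega> \<in> X\<close> inv_into_into[OF Q] f_inv_into_f[OF Q, symmetric]])
    then show "A (Suc k) (pt \<omega>)
        \<in> (\<lambda>Q. A (Suc k) (pt (inv_into X (E.square (Suc k + c)) Q))) ` E.square (Suc k + c) ` X"
      by (rule image_eqI[OF _ Q])
  qed
  then have "finite ((\<lambda>\<omega>. A (Suc k) (pt \<omega>)) ` X)"
    by (rule finite_subset) (intro finite_imageI E.finite_squares, simp add: X_def)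
  moreover have "A (Suc k) ` A k x \<subseteq> (\<lambda>\<omega>. A (Suc k) (pt \<omega>)) ` X"
    using cluster_subset[OF x] unfolding X_def E.carpet_eq by blast
  ultimately show ?thesis
    using finite_subset by blast
qed

lemma subclusters_mass:
  assumes x: "x \<in> carpet n m D"
  shows "E.mass (A k x) = (\<Sum>B\<in>A (Suc k) ` A k x. E.mass B)"
    and "F.mass (f ` A k x) = (\<Sum>B\<in>A (Suc k) ` A k x. F.mass (f ` B))"
proof -
  let ?P = "A (Suc k) ` A k x"
  have fin: "finite ?P"
    by (rule finite_subclusters[OF x])
  have union: "\<Union>?P = A k x"
  proof
    show "\<Union>?P \<subseteq> A k x"
      using cluster_Suc_subset cluster_eq by blast
    show "A k x \<subseteq> \<Union>?P"
      using cluster_refl by blast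
  qed
  have disjoint: "B \<inter> B' = {}" if "B \<in> ?P" "B' \<in> ?P" "B \<noteq> B'" for B B'
    using that cluster_eq by blast
  have sub: "B \<subseteq> carpet n m D" if "B \<in> ?P" for B
    using that cluster_subset x by blast
  obtain c where c: "\<And>k x. x \<in> carpet n m D \<Longrightarrow> E.saturated (k + c) (A k x)"
    using cluster_saturated by blast
  have "E.mass (\<Union>B\<in>?P. B) = (\<Sum>B\<in>?P. E.mass B)"
  proof (rule E.mass_UN_disjoint[OF fin])
    show "E.saturated (Suc k + c) B" if "B \<in> ?P" for B
      using that c cluster_subset[OF x] by blast
    show "disjoint_family_on (\<lambda>B. B) ?P"
      using disjoint by (auto simp: disjoint_family_on_def)
  qed
  then show "E.mass (A k x) = (\<Sum>B\<in>?P. E.mass B)"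
    using union by simp
  obtain c' where c': "\<And>k x. x \<in> carpet n m D \<Longrightarrow> F.saturated (k + c') (f ` A k x)"
    using image_cluster_saturated by blast
  have "F.mass (\<Union>B\<in>?P. f ` B) = (\<Sum>B\<in>?P. F.mass (f ` B))"
  proof (rule F.mass_UN_disjoint[OF fin])
    show "F.saturated (Suc k + c') (f ` B)" if "B \<in> ?P" for B
      using that c' cluster_subset[OF x] by blast
    show "disjoint_family_on (\<lambda>B. f ` B) ?P"
      unfolding disjoint_family_on_def
    proof (intro ballI impI)
      fix B B' assume B: "B \<in> ?P" "B' \<in> ?P" "B \<noteq> B'"
      have "f ` B \<inter> f ` B' = f ` (B \<inter> B')"
        using inj_on_image_Int[OF inj_f sub[OF B(1)] sub[OF B(2)]] by simp
      then show "f ` B \<inter> f ` B' = {}"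
        using disjoint[OF B] by simp
    qed
  qed
  moreover have "(\<Union>B\<in>?P. f ` B) = f ` \<Union>?P"
    by (rule image_Union[symmetric])
  ultimately show "F.mass (f ` A k x) = (\<Sum>B\<in>?P. F.mass (f ` B))"
    by (simp only: union)
qed

definition cluster_ratio :: "nat \<Rightarrow> real \<times> real \<Rightarrow> real" where
  "cluster_ratio k x = F.mass (f ` A k x) / E.mass (A k x)"

lemma cluster_mass_pos:
  assumes "x \<in> carpet n m D"
  shows "0 < E.mass (A k x)" "0 < F.mass (f ` A k x)"
proof -
  obtain \<omega> where \<omega>: "\<omega> \<in> codes D" "x = pt \<omega>"
    using assms unfolding E.carpet_eq by blast
  obtain \<omega>' where \<omega>': "\<omega>' \<in> codes D'" "pt \<omega>' = f (pt \<omega>)"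
    using image_code[OF pt_E[OF \<omega>(1)]] by blast
  obtain \<Theta> where "\<forall>t\<in>\<Theta>. 0 < t" "E.mass (A k (pt \<omega>)) / E.weight k \<omega> \<in> \<Theta>"
    using cluster_mass_ratio \<omega>(1) by blast
  then show "0 < E.mass (A k x)"
    using E.weight_pos[OF \<omega>(1), of k] \<omega>(2) by (auto simp: zero_less_divide_iff)
  obtain \<Theta> where "\<forall>t\<in>\<Theta>. 0 < t" "F.mass (f ` A k (pt \<omega>)) / F.weight k \<omega>' \<in> \<Theta>"
    using image_cluster_mass_ratio \<omega>(1) \<omega>' by blast
  then show "0 < F.mass (f ` A k x)"
    using F.weight_pos[OF \<omega>'(1), of k] \<omega>(2) by (auto simp: zero_less_divide_iff)
qed

lemma cluster_ratio_bounded: "\<exists>R. \<forall>k. \<forall>x\<in>carpet n m D. cluster_ratio k x \<le> R"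
proof -
  obtain \<Theta> where \<Theta>: "finite \<Theta>" "\<forall>t\<in>\<Theta>. 0 < t" "\<And>k \<omega>. \<omega> \<in> codes D \<Longrightarrow> E.mass (A k (pt \<omega>)) / E.weight k \<omega> \<in> \<Theta>"
    using cluster_mass_ratio by blast
  obtain \<Theta>' where \<Theta>': "finite \<Theta>'" "\<forall>t\<in>\<Theta>'. 0 < t" "\<And>k \<omega> \<omega>'. \<omega> \<in> codes D \<Longrightarrow> \<omega>' \<in> codes D' \<Longrightarrow> pt \<omega>' = f (pt \<omega>) \<Longrightarrow>
     F.mass (f ` A k (pt \<omega>)) / F.weight k \<omega>' \<in> \<Theta>'"
    using image_cluster_mass_ratio by blast
  obtain g where g: "lipschitz_carpets n m D' D g C" "\<And>x. x \<in> carpet n m D \<Longrightarrow> g (f x) = x"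
    using inverse_lipschitz by blast
  interpret G: lipschitz_carpets n m D' D g C by (rule g(1))
  obtain c where c: "0 < c" "\<And>k \<omega> \<omega>'. \<omega> \<in> codes D' \<Longrightarrow> \<omega>' \<in> codes D \<Longrightarrow> pt \<omega>' = g (pt \<omega>) \<Longrightarrow> F.weight k \<omega> \<le> c * E.weight k \<omega>'"
    using G.weight_le_image_weight by blast
  define R where "R = Max ((\<lambda>(s, t). s * c / t) ` (\<Theta>' \<times> \<Theta>))"
  have "cluster_ratio k x \<le> R" if x: "x \<in> carpet n m D" for k x
  proof -
    obtain \<omega> where \<omega>: "\<omega> \<in> codes D" "x = pt \<omega>"
      using x unfolding E.carpet_eq by blast
    obtain \<omega>' where \<omega>': "\<omega>' \<in> codes D'" "pt \<omega>' = f (pt \<omega>)"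
      using image_code[OF pt_E[OF \<omega>(1)]] by blast
    have pos: "0 < E.weight k \<omega>" "0 < F.weight k \<omega>'"
      using E.weight_pos[OF \<omega>(1)] F.weight_pos[OF \<omega>'(1)] by auto
    obtain s where s: "s \<in> \<Theta>'" "F.mass (f ` A k x) = s * F.weight k \<omega>'"
      using \<Theta>'(3)[OF \<omega>(1) \<omega>', of k] pos \<omega>(2) by (metis nonzero_divide_eq_eq order_less_irrefl)
    obtain t where t: "t \<in> \<Theta>" "E.mass (A k x) = t * E.weight k \<omega>"
      using \<Theta>(3)[OF \<omega>(1), of k] pos \<omega>(2) by (metis nonzero_divide_eq_eq order_less_irrefl)
    have st: "0 < s" "0 < t"
      using s(1) t(1) \<Theta>(2) \<Theta>'(2) by auto
    have "F.weight k \<omega>' \<le> c * E.weight k \<omega>"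
      using g(2)[OF pt_E[OF \<omega>(1)]] \<omega>'(2) by (intro c(2)[OF \<omega>'(1) \<omega>(1)]) simp
    then have "cluster_ratio k x \<le> s * (c * E.weight k \<omega>) / (t * E.weight k \<omega>)"
      unfolding cluster_ratio_def s(2) t(2) using st pos by (intro divide_right_mono mult_left_mono) auto
    also have "\<dots> = s * c / t"
      using pos by simp
    also have "\<dots> \<le> R"
      unfolding R_def using s(1) t(1) \<Theta>(1) \<Theta>'(1) by (intro Max_ge) auto
    finally show ?thesis .
  qed
  then show ?thesis
    by blast
qed

text \<open>Both masses of a cluster are masses of squares up to factors from finite sets, and the masses of
  nested squares of consecutive levels have finitely many ratios.\<close>

lemma cluster_ratio_step:
  "\<exists>\<Phi>. finite \<Phi> \<and> (\<forall>k. \<forall>x\<in>carpet n m D. \<forall>y\<in>A k x. cluster_ratio (Suc k) y / cluster_ratio k x \<in> \<Phi>)"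
proof -
  obtain \<Theta> where \<Theta>: "finite \<Theta>" "\<And>k \<omega>. \<omega> \<in> codes D \<Longrightarrow> E.mass (A k (pt \<omega>)) / E.weight k \<omega> \<in> \<Theta>"
    using cluster_mass_ratio by blast
  obtain \<Theta>' where \<Theta>': "finite \<Theta>'" "\<And>k \<omega> \<omega>'. \<omega> \<in> codes D \<Longrightarrow> \<omega>' \<in> codes D' \<Longrightarrow> pt \<omega>' = f (pt \<omega>) \<Longrightarrow>
     F.mass (f ` A k (pt \<omega>)) / F.weight k \<omega>' \<in> \<Theta>'"
    using image_cluster_mass_ratio by blast
  define S S' where "S = short_products E.factors 3" and "S' = short_products F.factors 3"
  define \<Phi> where "\<Phi> = (\<lambda>(a, b, c, d, e, g). (a * b / c) / (d * e / g)) ` (\<Theta>' \<times> S' \<times> \<Theta>' \<times> \<Theta> \<times> S \<times> \<Theta>)"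
  have "finite \<Phi>"
    unfolding \<Phi>_def S_def S'_def
    by (intro finite_imageI finite_cartesian_product \<Theta>(1) \<Theta>'(1) finite_short_products E.finite_factors F.finite_factors)
  moreover have "cluster_ratio (Suc k) y / cluster_ratio k x \<in> \<Phi>" if x: "x \<in> carpet n m D" and y: "y \<in> A k x" for k x y
  proof -
    have "y \<in> carpet n m D"
      using y cluster_subset[OF x] by blast
    then obtain \<omega> where \<omega>: "\<omega> \<in> codes D" "y = pt \<omega>"
      unfolding E.carpet_eq by blast
    obtain \<omega>' where \<omega>': "\<omega>' \<in> codes D'" "pt \<omega>' = f (pt \<omega>)"
      using image_code[OF pt_E[OF \<omega>(1)]] by blast
    have same: "A k x = A k (pt \<omega>)"
      using cluster_eq[OF y] \<omega>(2) by simp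
    have pos: "0 < E.weight k \<omega>" "0 < F.weight k \<omega>'" "0 < E.weight (Suc k) \<omega>" "0 < F.weight (Suc k) \<omega>'"
      using E.weight_pos[OF \<omega>(1)] F.weight_pos[OF \<omega>'(1)] by auto
    define a b c d e g where "a = F.mass (f ` A (Suc k) (pt \<omega>)) / F.weight (Suc k) \<omega>'"
      and "b = F.weight (Suc k) \<omega>' / F.weight k \<omega>'" and "c = F.mass (f ` A k (pt \<omega>)) / F.weight k \<omega>'"
      and "d = E.mass (A (Suc k) (pt \<omega>)) / E.weight (Suc k) \<omega>"
      and "e = E.weight (Suc k) \<omega> / E.weight k \<omega>" and "g = E.mass (A k (pt \<omega>)) / E.weight k \<omega>"
    have "(a, b, c, d, e, g) \<in> \<Theta>' \<times> S' \<times> \<Theta>' \<times> \<Theta> \<times> S \<times> \<Theta>"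
      unfolding a_def b_def c_def d_def e_def g_def S_def S'_def
      by (intro SigmaI \<Theta>(2) \<Theta>'(2) \<omega> \<omega>' E.weight_Suc_ratio F.weight_Suc_ratio)
    moreover have "cluster_ratio (Suc k) y / cluster_ratio k x = (a * b / c) / (d * e / g)"
      unfolding cluster_ratio_def same \<omega>(2) a_def b_def c_def d_def e_def g_def using pos
      by (simp add: field_simps)
    ultimately show ?thesis
      unfolding \<Phi>_def by (intro image_eqI[where x = "(a, b, c, d, e, g)"]) simp_all
  qed
  ultimately show ?thesis
    by blast
qed

text \<open>Near the supremum of the ratio, no subcluster of the next level has a larger ratio. The
  ratio of a cluster is a weighted average of those of its subclusters, so these all have the same ratio,
  and the argument repeats below each of them.\<close>

lemma cluster_with_constant_ratio:
  "\<exists>k0 x0 \<rho>. x0 \<in> carpet n m D \<and> 0 < \<rho> \<and>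
     (\<forall>k\<ge>k0. \<forall>x\<in>A k0 x0. F.mass (f ` A k x) = \<rho> * E.mass (A k x))"
proof -
  obtain \<Phi> where \<Phi>: "finite \<Phi>" "\<And>k x y. x \<in> carpet n m D \<Longrightarrow> y \<in> A k x \<Longrightarrow> cluster_ratio (Suc k) y / cluster_ratio k x \<in> \<Phi>"
    using cluster_ratio_step by blast
  obtain R where R: "\<And>k x. x \<in> carpet n m D \<Longrightarrow> cluster_ratio k x \<le> R"
    using cluster_ratio_bounded by blast
  have pos: "0 < cluster_ratio k x" if "x \<in> carpet n m D" for k x
    using cluster_mass_pos[OF that] by (simp add: cluster_ratio_def)
  define X where "X = (UNIV :: nat set) \<times> carpet n m D"
  obtain p where p: "p \<in> X" "\<And>q \<phi>. q \<in> X \<Longrightarrow> \<phi> \<in> \<Phi> \<Longrightarrow>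
      cluster_ratio (fst q) (snd q) = \<phi> * cluster_ratio (fst p) (snd p) \<Longrightarrow>
      cluster_ratio (fst q) (snd q) \<le> cluster_ratio (fst p) (snd p)"
  proof (rule near_supremum[of \<Phi> X "\<lambda>q. cluster_ratio (fst q) (snd q)" R])
    show "X \<noteq> {}"
      using E.carpet_nonempty by (simp add: X_def)
    show "0 < cluster_ratio (fst x) (snd x) \<and> cluster_ratio (fst x) (snd x) \<le> R" if "x \<in> X" for x
      using that pos R by (auto simp: X_def)
  qed (use \<Phi>(1) in blast)+
  define k0 x0 where "k0 = fst p" and "x0 = snd p"
  define \<rho> where "\<rho> = cluster_ratio k0 x0"
  have x0: "x0 \<in> carpet n m D"
    using p(1) by (auto simp: X_def x0_def)
  have max: "cluster_ratio k x \<le> \<rho>" if "x \<in> carpet n m D" "\<phi> \<in> \<Phi>" "cluster_ratio k x = \<phi> * \<rho>" for k x \<phi>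
    using p(2)[of "(k, x)" \<phi>] that by (simp add: X_def \<rho>_def k0_def x0_def)
  have "\<forall>x\<in>A k0 x0. cluster_ratio (k0 + j) x = \<rho>" for j
  proof (induction j)
    case 0
    show ?case
      using cluster_eq unfolding \<rho>_def cluster_ratio_def by (metis add.right_neutral)
  next
    case (Suc j)
    show ?case
    proof
      fix x assume x: "x \<in> A k0 x0"
      let ?k = "k0 + j"
      have xE: "x \<in> carpet n m D"
        using x cluster_subset[OF x0] by blast
      have sub: "A ?k x \<subseteq> A k0 x0"
      proof -
        have "1 / real m ^ ?k \<le> 1 / real m ^ k0"
          using E.m by (intro divide_left_mono power_increasing) auto
        then have "A ?k x \<subseteq> A k0 x"
          by (rule cluster_mono)
        then show ?thesis
          using cluster_eq[OF x] by simp
      qed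
      let ?P = "A (Suc ?k) ` A ?k x"
      have "F.mass (f ` B) \<le> \<rho> * E.mass B" if B: "B \<in> ?P" for B
      proof -
        obtain y where y: "y \<in> A ?k x" "B = A (Suc ?k) y"
          using B by blast
        have yE: "y \<in> carpet n m D"
          using y(1) cluster_subset[OF xE] by blast
        have "cluster_ratio (Suc ?k) y / cluster_ratio ?k x \<in> \<Phi>"
          by (rule \<Phi>(2)[OF xE y(1)])
        moreover have "cluster_ratio ?k x = \<rho>"
          using Suc.IH x by blast
        moreover have "\<rho> \<noteq> 0"
          using pos[OF x0, of k0] by (simp add: \<rho>_def)
        ultimately have "cluster_ratio (Suc ?k) y \<le> \<rho>"
          by (intro max[OF yE, of "cluster_ratio (Suc ?k) y / \<rho>"]) simp_all
        then show ?thesis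
          unfolding cluster_ratio_def y(2) using cluster_mass_pos(1)[OF yE, of "Suc ?k"] by (simp add: pos_divide_le_eq)
      qed
      moreover have "(\<Sum>B\<in>?P. F.mass (f ` B)) = (\<Sum>B\<in>?P. \<rho> * E.mass B)"
      proof -
        have "F.mass (f ` A ?k x) = \<rho> * E.mass (A ?k x)"
          using Suc.IH x cluster_mass_pos(1)[OF xE, of ?k] by (auto simp: cluster_ratio_def field_simps)
        then show ?thesis
          using subclusters_mass[OF xE, of ?k] by (simp add: sum_distrib_left)
      qed
      moreover have "A (Suc ?k) x \<in> ?P"
        using cluster_refl by blast
      ultimately have "F.mass (f ` A (Suc ?k) x) = \<rho> * E.mass (A (Suc ?k) x)"
        by (rule sum_le_imp_eq[OF finite_subclusters[OF xE]])
      then show "cluster_ratio (k0 + Suc j) x = \<rho>"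
        using cluster_mass_pos(1)[OF xE, of "Suc ?k"] by (simp add: cluster_ratio_def)
    qed
  qed
  then have "F.mass (f ` A k x) = \<rho> * E.mass (A k x)" if "k0 \<le> k" "x \<in> A k0 x0" for k x
  proof -
    have "cluster_ratio (k0 + (k - k0)) x = \<rho>"
      using \<open>\<And>j. \<forall>x\<in>A k0 x0. cluster_ratio (k0 + j) x = \<rho>\<close> that(2) by blast
    moreover have "x \<in> carpet n m D"
      using that(2) cluster_subset[OF x0] by blast
    ultimately show ?thesis
      using that(1) cluster_mass_pos(1)[of x k] by (auto simp: cluster_ratio_def field_simps)
  qed
  then show ?thesis
    using x0 pos[OF x0, of k0] by (intro exI[of _ k0] exI[of _ x0] exI[of _ \<rho>]) (simp add: \<rho>_def)
qed

end

section \<open>Irrationality\<close>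

text \<open>The logarithm of the given term is \<open>k * \<alpha> + frac (k * \<sigma>) * ln v\<close> with a constant
  \<open>\<alpha>\<close>. Since it is bounded,
  \<open>\<alpha> = 0\<close>; since the fractional parts are pairwise different, finitely many values are possible only if
  \<open>ln v = 0\<close>.\<close>

lemma power_floor_finite_imp_one:
  fixes u v \<sigma> :: real
  assumes uv: "0 < u" "0 < v" and irr: "\<sigma> \<notin> \<rat>" and "0 \<le> \<sigma>" and fin: "finite T"
    and T: "\<And>k. k1 \<le> k \<Longrightarrow> u ^ k * v ^ (k - nat \<lfloor>real k * \<sigma>\<rfloor>) \<in> T"
    and le: "\<And>k. nat \<lfloor>real k * \<sigma>\<rfloor> \<le> k"
  shows "u = 1 \<and> v = 1"
proof -
  define \<alpha> where "\<alpha> = ln u + (1 - \<sigma>) * ln v"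
  have floor: "real (nat \<lfloor>real k * \<sigma>\<rfloor>) = real k * \<sigma> - frac (real k * \<sigma>)" for k
    using \<open>0 \<le> \<sigma>\<close> by (simp add: frac_def)
  have log: "ln (u ^ k * v ^ (k - nat \<lfloor>real k * \<sigma>\<rfloor>)) = real k * \<alpha> + frac (real k * \<sigma>) * ln v" for k
  proof -
    have "ln (u ^ k * v ^ (k - nat \<lfloor>real k * \<sigma>\<rfloor>)) = real k * ln u + real (k - nat \<lfloor>real k * \<sigma>\<rfloor>) * ln v"
      using uv by (simp add: ln_mult ln_realpow)
    also have "real (k - nat \<lfloor>real k * \<sigma>\<rfloor>) = real k - (real k * \<sigma> - frac (real k * \<sigma>))"
      using le[of k] floor[of k] by (simp add: of_nat_diff)
    finally show ?thesis
      by (simp add: \<alpha>_def algebra_simps)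
  qed
  have fin_ln: "finite (ln ` T)"
    using fin by simp
  have in_ln: "real k * \<alpha> + frac (real k * \<sigma>) * ln v \<in> ln ` T" if "k1 \<le> k" for k
    unfolding log[symmetric] using T[OF that] by (rule imageI)
  have "\<alpha> = 0"
  proof (rule ccontr)
    assume "\<alpha> \<noteq> 0"
    obtain B where B: "\<And>x. x \<in> ln ` T \<Longrightarrow> \<bar>x\<bar> \<le> B"
      using finite_imp_bounded[OF fin_ln] bounded_iff[of "ln ` T"] by (auto simp: real_norm_def)
    obtain k where k: "(B + \<bar>ln v\<bar>) / \<bar>\<alpha>\<bar> < real k" "k1 \<le> k"
    proof -
      obtain k where "(B + \<bar>ln v\<bar>) / \<bar>\<alpha>\<bar> < real k"
        using reals_Archimedean2 by blast
      then show thesis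
        by (intro that[of "max k k1"]) (auto simp: less_max_iff_disj of_nat_max)
    qed
    have "\<bar>frac (real k * \<sigma>) * ln v\<bar> \<le> 1 * \<bar>ln v\<bar>"
      unfolding abs_mult using frac_lt_1[of "real k * \<sigma>"] by (intro mult_right_mono) auto
    then have "\<bar>real k * \<alpha>\<bar> \<le> B + \<bar>ln v\<bar>"
      using B[OF in_ln[OF k(2)]] by linarith
    moreover have "B + \<bar>ln v\<bar> < real k * \<bar>\<alpha>\<bar>"
      using k(1) \<open>\<alpha> \<noteq> 0\<close> by (simp add: divide_less_eq)
    ultimately show False
      by (simp add: abs_mult)
  qed
  have inj: "inj (\<lambda>k::nat. frac (real k * \<sigma>))"
  proof (rule injI, rule ccontr)
    fix k k' :: nat
    assume eq: "frac (real k * \<sigma>) = frac (real k' * \<sigma>)" and ne: "k \<noteq> k'"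
    have "(real k - real k') * \<sigma> = of_int (\<lfloor>real k * \<sigma>\<rfloor> - \<lfloor>real k' * \<sigma>\<rfloor>)"
      using eq by (simp add: frac_def left_diff_distrib)
    then have "\<sigma> = of_int (\<lfloor>real k * \<sigma>\<rfloor> - \<lfloor>real k' * \<sigma>\<rfloor>) / of_int (int k - int k')"
      using ne by (simp add: field_simps)
    also have "\<dots> \<in> \<rat>"
      by (intro Rats_divide Rats_of_int)
    finally show False
      using irr by blast
  qed
  have "ln v = 0"
  proof (rule ccontr)
    assume "ln v \<noteq> 0"
    have "inj (\<lambda>k::nat. frac (real k * \<sigma>) * ln v)"
      using inj \<open>ln v \<noteq> 0\<close> unfolding inj_def by simp
    then have "infinite ((\<lambda>k. frac (real k * \<sigma>) * ln v) ` {k1..})"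
      using infinite_Ici[of k1] finite_imageD inj_on_subset by blast
    moreover have "(\<lambda>k. frac (real k * \<sigma>) * ln v) ` {k1..} \<subseteq> ln ` T"
      using in_ln \<open>\<alpha> = 0\<close> by auto
    ultimately show False
      using fin_ln finite_subset by blast
  qed
  then show ?thesis
    using \<open>\<alpha> = 0\<close> uv by (simp add: \<alpha>_def ln_eq_zero_iff)
qed

text \<open>Only few factors can differ from 1 if the product of factors from \<open>G\<close> does not become small.\<close>

lemma finite_large_products:
  fixes G :: "real set"
  assumes G: "finite G" "\<And>g. g \<in> G \<Longrightarrow> 0 < g \<and> g \<le> 1" and "0 < \<epsilon>"
  shows "\<exists>T. finite T \<and> (\<forall>(A :: 'a set) h. finite A \<longrightarrow> h ` A \<subseteq> G \<longrightarrow> \<epsilon> \<le> (\<Prod>l\<in>A. h l) \<longrightarrow> (\<Prod>l\<in>A. h l) \<in> T)"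
proof -
  \<comment> \<open>The element \<open>1 / 2\<close> only ensures that the maximum exists and lies strictly between 0 and 1.\<close>
  define \<kappa> where "\<kappa> = Max (insert (1 / 2) {g \<in> G. g < 1})"
  have fin: "finite (insert (1 / 2) {g \<in> G. g < 1})"
    using G(1) by simp
  have \<kappa>: "0 < \<kappa>" "\<kappa> < 1" "\<And>g. g \<in> G \<Longrightarrow> g < 1 \<Longrightarrow> g \<le> \<kappa>"
    unfolding \<kappa>_def using fin by (auto simp: Max_gr_iff Max_less_iff intro: Max_ge)
  obtain r where r: "\<kappa> ^ r < \<epsilon>"
    using real_arch_pow_inv[OF \<open>0 < \<epsilon>\<close> \<kappa>(2)] by blast
  have "(\<Prod>l\<in>A. h l) \<in> short_products G r"
    if A: "finite A" "h ` A \<subseteq> G" "\<epsilon> \<le> (\<Prod>l\<in>A. h l)" for A :: "'a set" and h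
  proof -
    define A1 where "A1 = {l \<in> A. h l < 1}"
    have A1: "finite A1" "A1 \<subseteq> A"
      using A(1) by (auto simp: A1_def)
    have "h l = 1" if "l \<in> A - A1" for l
      using that A(2) G(2)[of "h l"] by (auto simp: A1_def)
    then have eq: "(\<Prod>l\<in>A. h l) = (\<Prod>l\<in>A1. h l)"
      using A(1) A1(2) by (intro prod.mono_neutral_right) auto
    have "(\<Prod>l\<in>A1. h l) \<le> (\<Prod>l\<in>A1. \<kappa>)"
      using A(2) G(2) \<kappa>(3) by (intro prod_mono) (auto simp: A1_def image_subset_iff less_imp_le)
    then have "\<kappa> ^ r < \<kappa> ^ card A1"
      using A(3) r eq by simp
    then have "card A1 \<le> r"
      using \<kappa>(1,2) by (meson linorder_not_less nat_le_linear power_decreasing less_imp_le)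
    moreover have "(\<Prod>l\<in>A1. h l) \<in> short_products G (card A1)"
      using A(2) A1 by (intro short_products_prod) auto
    ultimately show ?thesis
      unfolding eq using short_products_mono by blast
  qed
  then show ?thesis
    using finite_short_products[OF G(1)] by blast
qed

context carpet_digits
begin

definition max_count :: real where
  "max_count = real (Max (distribution_seq D ` rows))"

definition max_weight :: "nat \<Rightarrow> real" where
  "max_weight k = max_count ^ (k - lv k) / real (card D) ^ k"

lemma count_le_max: "j \<in> rows \<Longrightarrow> real (distribution_seq D j) \<le> max_count"
  unfolding max_count_def using finite_rows by simp

lemma max_row: "\<exists>j\<in>rows. real (distribution_seq D j) = max_count"
proof -
  have "Max (distribution_seq D ` rows) \<in> distribution_seq D ` rows"
    using finite_rows rows_nonempty by (intro Max_in) auto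
  then show ?thesis
    unfolding max_count_def by auto
qed

lemma max_count_pos: "0 < max_count"
  using max_row rows_iff by force

lemma max_weight_pos: "0 < max_weight k"
  using max_count_pos card_D_pos by (simp add: max_weight_def)

lemma weight_max_weight:
  "weight k \<omega> = max_weight k * (\<Prod>l<k. if l < lv k then 1 else real (distribution_seq D (snd (\<omega> l))) / max_count)"
proof -
  have "(\<Prod>l<k. if l < lv k then 1 else real (distribution_seq D (snd (\<omega> l))))
      = (\<Prod>l<k. (if l < lv k then 1 else max_count) * (if l < lv k then 1 else real (distribution_seq D (snd (\<omega> l))) / max_count))"
    using max_count_pos by (intro prod.cong) auto
  also have "\<dots> = max_count ^ (k - lv k) * (\<Prod>l<k. if l < lv k then 1 else real (distribution_seq D (snd (\<omega> l))) / max_count)"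
    unfolding prod.distrib using prod_if_less[OF lv_le[of k], of 1 max_count] by simp
  finally show ?thesis
    by (simp add: weight_def max_weight_def)
qed

lemma relative_count_bounds:
  assumes "\<omega> \<in> codes D"
  shows "0 < real (distribution_seq D (snd (\<omega> l))) / max_count" "real (distribution_seq D (snd (\<omega> l))) / max_count \<le> 1"
  using row_count_pos[OF assms] count_le_max[OF code_row[OF assms]] max_count_pos by auto

lemma weight_le_max_weight:
  assumes "\<omega> \<in> codes D"
  shows "weight k \<omega> \<le> max_weight k"
proof -
  have "(\<Prod>l<k. if l < lv k then 1 else real (distribution_seq D (snd (\<omega> l))) / max_count) \<le> 1"
    using relative_count_bounds[OF assms] by (intro prod_le_1) (auto simp: less_imp_le)
  then show ?thesis
    unfolding weight_max_weight using max_weight_pos[of k] by (simp add: mult_left_le)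
qed

lemma weight_eq_max_weight:
  assumes "\<And>l. lv k \<le> l \<Longrightarrow> real (distribution_seq D (snd (\<omega> l))) = max_count"
  shows "weight k \<omega> = max_weight k"
proof -
  have "(\<Prod>l<k. if l < lv k then 1 else real (distribution_seq D (snd (\<omega> l))) / max_count) = 1"
    using assms max_count_pos by (intro prod.neutral) auto
  then show ?thesis
    unfolding weight_max_weight by simp
qed

lemma relative_weight_finite:
  assumes "0 < \<epsilon>"
  shows "\<exists>T. finite T \<and> (\<forall>k. \<forall>\<omega>\<in>codes D. \<epsilon> \<le> weight k \<omega> / max_weight k \<longrightarrow> weight k \<omega> / max_weight k \<in> T)"
proof -
  define G where "G = insert 1 ((\<lambda>j. real (distribution_seq D j) / max_count) ` rows)"
  have "finite G"
    using finite_rows by (simp add: G_def)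
  moreover have "0 < g \<and> g \<le> 1" if "g \<in> G" for g
    using that rows_iff count_le_max max_count_pos by (auto simp: G_def)
  ultimately obtain T where T: "finite T" "\<And>(A :: nat set) h. finite A \<Longrightarrow> h ` A \<subseteq> G \<Longrightarrow> \<epsilon> \<le> (\<Prod>l\<in>A. h l) \<Longrightarrow> (\<Prod>l\<in>A. h l) \<in> T"
    using finite_large_products[OF _ _ assms, of G] by blast
  have "weight k \<omega> / max_weight k \<in> T" if \<omega>: "\<omega> \<in> codes D" and large: "\<epsilon> \<le> weight k \<omega> / max_weight k" for k \<omega>
  proof -
    have "weight k \<omega> / max_weight k = (\<Prod>l<k. if l < lv k then 1 else real (distribution_seq D (snd (\<omega> l))) / max_count)"
      unfolding weight_max_weight using max_weight_pos[of k] by simp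
    moreover have "(\<lambda>l. if l < lv k then 1 else real (distribution_seq D (snd (\<omega> l))) / max_count) ` {..<k} \<subseteq> G"
      using code_row[OF \<omega>] by (auto simp: G_def)
    ultimately show ?thesis
      using T(2)[of "{..<k}"] large by simp
  qed
  then show ?thesis
    using T(1) by blast
qed

end

context lipschitz_carpets
begin

lemma max_weight_le: "\<exists>c>0. \<forall>k. E.max_weight k \<le> c * F.max_weight k"
proof -
  obtain c where c: "0 < c" "\<And>k \<omega> \<omega>'. \<omega> \<in> codes D \<Longrightarrow> \<omega>' \<in> codes D' \<Longrightarrow> pt \<omega>' = f (pt \<omega>) \<Longrightarrow>
      E.weight k \<omega> \<le> c * F.weight k \<omega>'"
    using weight_le_image_weight by blast
  obtain j where j: "j \<in> E.rows" "real (distribution_seq D j) = E.max_count"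
    using E.max_row by blast
  define \<omega> where "\<omega> = (\<lambda>_::nat. E.row_digit j)"
  have \<omega>: "\<omega> \<in> codes D"
    using E.row_digit(1)[OF j(1)] by (simp add: \<omega>_def codes_def)
  obtain \<omega>' where \<omega>': "\<omega>' \<in> codes D'" "pt \<omega>' = f (pt \<omega>)"
    using image_code[OF pt_E[OF \<omega>]] by blast
  have "E.max_weight k \<le> c * F.max_weight k" for k
  proof -
    have "E.max_weight k = E.weight k \<omega>"
      using j E.row_digit(2) by (intro E.weight_eq_max_weight[symmetric]) (simp add: \<omega>_def)
    also have "\<dots> \<le> c * F.weight k \<omega>'"
      by (rule c(2)[OF \<omega> \<omega>'])
    also have "\<dots> \<le> c * F.max_weight k"
      using c(1) F.weight_le_max_weight[OF \<omega>'(1)] by simp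
    finally show ?thesis .
  qed
  then show ?thesis
    using c(1) by blast
qed

text \<open>A point whose digits eventually lie in a row of maximal count has squares of maximal mass. The
  squares of its image have maximal mass up to a bounded factor, and this factor is a product of
  relative counts, so it takes finitely many values. Inside a cluster of constant mass ratio, the masses
  of the two squares are also related by finitely many factors.\<close>

lemma max_weight_ratio_finite:
  "\<exists>T k1. finite T \<and> (\<forall>k\<ge>k1. F.max_weight k / E.max_weight k \<in> T)"
proof -
  obtain k0 x0 \<rho> where x0: "x0 \<in> carpet n m D" "0 < \<rho>"
    "\<And>k x. k0 \<le> k \<Longrightarrow> x \<in> A k0 x0 \<Longrightarrow> F.mass (f ` A k x) = \<rho> * E.mass (A k x)"
    using cluster_with_constant_ratio by blast
  obtain \<omega>0 where \<omega>0: "\<omega>0 \<in> codes D" "x0 = pt \<omega>0"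
    using x0(1) unfolding E.carpet_eq by blast
  obtain s where s: "E.saturated (k0 + s) (A k0 x0)"
    using cluster_saturated x0(1) by blast
  obtain j where j: "j \<in> E.rows" "real (distribution_seq D j) = E.max_count"
    using E.max_row by blast
  define \<omega> where "\<omega> l = (if l < k0 + s then \<omega>0 l else E.row_digit j)" for l
  have \<omega>: "\<omega> \<in> codes D"
    using codesD[OF \<omega>0(1)] E.row_digit(1)[OF j(1)] by (simp add: \<omega>_def codes_def)
  have "E.square (k0 + s) \<omega>0 = E.square (k0 + s) \<omega>"
    using E.lv_le[of "k0 + s"] by (intro E.square_cong) (auto simp: \<omega>_def)
  then have in_A: "pt \<omega> \<in> A k0 x0"
    using s \<omega> \<omega>0 cluster_refl unfolding E.saturated_def by blast
  obtain \<omega>' where \<omega>': "\<omega>' \<in> codes D'" "pt \<omega>' = f (pt \<omega>)"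
    using image_code[OF pt_E[OF \<omega>]] by blast
  obtain k1 where k1: "\<And>k. k1 \<le> k \<Longrightarrow> k0 + s \<le> E.lv k"
    using E.lv_unbounded by blast
  obtain \<Theta> where \<Theta>: "finite \<Theta>" "\<forall>t\<in>\<Theta>. 0 < t" "\<And>k \<omega>. \<omega> \<in> codes D \<Longrightarrow> E.mass (A k (pt \<omega>)) / E.weight k \<omega> \<in> \<Theta>"
    using cluster_mass_ratio by blast
  obtain \<Theta>' where \<Theta>': "finite \<Theta>'" "\<forall>t\<in>\<Theta>'. 0 < t" "\<And>k \<omega> \<omega>'. \<omega> \<in> codes D \<Longrightarrow> \<omega>' \<in> codes D' \<Longrightarrow> pt \<omega>' = f (pt \<omega>) \<Longrightarrow>
     F.mass (f ` A k (pt \<omega>)) / F.weight k \<omega>' \<in> \<Theta>'"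
    using image_cluster_mass_ratio by blast
  obtain c where c: "0 < c" "\<And>k \<omega> \<omega>'. \<omega> \<in> codes D \<Longrightarrow> \<omega>' \<in> codes D' \<Longrightarrow> pt \<omega>' = f (pt \<omega>) \<Longrightarrow>
      E.weight k \<omega> \<le> c * F.weight k \<omega>'"
    using weight_le_image_weight by blast
  obtain g where "lipschitz_carpets n m D' D g C"
    using inverse_lipschitz by blast
  then interpret G: lipschitz_carpets n m D' D g C .
  obtain c' where c': "0 < c'" "\<And>k. F.max_weight k \<le> c' * E.max_weight k"
    using G.max_weight_le by blast
  define \<epsilon> where "\<epsilon> = 1 / (c * c')"
  have \<epsilon>: "0 < \<epsilon>"
    using c(1) c'(1) by (simp add: \<epsilon>_def)
  obtain S where S: "finite S" "\<And>k \<omega>. \<omega> \<in> codes D' \<Longrightarrow> \<epsilon> \<le> F.weight k \<omega> / F.max_weight k \<Longrightarrow> F.weight k \<omega> / F.max_weight k \<in> S"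
    using F.relative_weight_finite[OF \<epsilon>] by blast
  define T where "T = (\<lambda>(t, t', \<tau>). \<rho> * t / t' / \<tau>) ` (\<Theta> \<times> \<Theta>' \<times> S)"
  have "F.max_weight k / E.max_weight k \<in> T" if k: "max k0 k1 \<le> k" for k
  proof -
    have weight: "E.weight k \<omega> = E.max_weight k"
      using j E.row_digit(2) k1[of k] k by (intro E.weight_eq_max_weight) (auto simp: \<omega>_def)
    have pos: "0 < E.max_weight k" "0 < F.max_weight k" "0 < F.weight k \<omega>'"
      using E.max_weight_pos F.max_weight_pos F.weight_pos[OF \<omega>'(1)] by auto
    have "F.max_weight k \<le> c' * E.max_weight k"
      by (rule c'(2))
    also have "\<dots> \<le> c' * (c * F.weight k \<omega>')"
      using c(2)[OF \<omega> \<omega>', of k] c'(1) weight by (intro mult_left_mono) auto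
    finally have "\<epsilon> * F.max_weight k \<le> \<epsilon> * (c' * (c * F.weight k \<omega>'))"
      using \<epsilon> by (intro mult_left_mono) auto
    also have "\<dots> = F.weight k \<omega>'"
      using c(1) c'(1) by (simp add: \<epsilon>_def)
    finally have "\<epsilon> \<le> F.weight k \<omega>' / F.max_weight k"
      using pos by (simp add: pos_le_divide_eq)
    then have \<tau>: "F.weight k \<omega>' / F.max_weight k \<in> S"
      by (rule S(2)[OF \<omega>'(1)])
    define t t' where "t = E.mass (A k (pt \<omega>)) / E.weight k \<omega>" and "t' = F.mass (f ` A k (pt \<omega>)) / F.weight k \<omega>'"
    have t: "t \<in> \<Theta>" "t' \<in> \<Theta>'"
      unfolding t_def t'_def by (intro \<Theta>(3) \<Theta>'(3) \<omega> \<omega>')+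
    then have t_pos: "0 < t" "0 < t'"
      using \<Theta>(2) \<Theta>'(2) by auto
    have mass: "t' * F.weight k \<omega>' = \<rho> * (t * E.max_weight k)"
      using x0(3)[OF _ in_A, of k] k pos weight by (simp add: t_def t'_def)
    have "\<rho> * t / t' / (F.weight k \<omega>' / F.max_weight k) = \<rho> * t * F.max_weight k / (t' * F.weight k \<omega>')"
      by simp
    also have "\<dots> = (\<rho> * t) * F.max_weight k / ((\<rho> * t) * E.max_weight k)"
      unfolding mass by (simp only: mult.assoc)
    also have "\<dots> = F.max_weight k / E.max_weight k"
      using t_pos x0(2) by (intro mult_divide_mult_cancel_left) simp
    finally have "F.max_weight k / E.max_weight k = \<rho> * t / t' / (F.weight k \<omega>' / F.max_weight k)" ..
    then show ?thesis
      unfolding T_def using t \<tau> by (intro image_eqI[where x = "(t, t', F.weight k \<omega>' / F.max_weight k)"]) simp_all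
  qed
  moreover have "finite T"
    unfolding T_def using \<Theta>(1) \<Theta>'(1) S(1) by simp
  ultimately show ?thesis
    by blast
qed

lemma card_digits_eq:
  assumes irr: "depth_ratio n m \<notin> \<rat>"
  shows "card D = card D'"
proof -
  obtain T k1 where T: "finite T" "\<And>k. k1 \<le> k \<Longrightarrow> F.max_weight k / E.max_weight k \<in> T"
    using max_weight_ratio_finite by blast
  have "real (card D) / real (card D') = 1 \<and> F.max_count / E.max_count = 1"
  proof (rule power_floor_finite_imp_one[OF _ _ irr _ T(1)])
    show "(real (card D) / real (card D')) ^ k * (F.max_count / E.max_count) ^ (k - nat \<lfloor>real k * depth_ratio n m\<rfloor>) \<in> T"
      if "k1 \<le> k" for k
      using T(2)[OF that] by (simp add: E.max_weight_def F.max_weight_def power_divide x_level_def mult.commute)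
    show "nat \<lfloor>real k * depth_ratio n m\<rfloor> \<le> k" for k
      using E.lv_le[of k] by (simp add: x_level_def)
  qed (use E.card_D_pos F.card_D_pos E.max_count_pos F.max_count_pos E.\<sigma>_bounds in auto)
  then show ?thesis
    using F.card_D_pos by simp
qed

text \<open>The power sum of the masses at level \<open>k\<close> is a power of the power sum of the counts with exponent
  \<open>k - lv k\<close>, times a factor that depends only on \<open>k\<close>, \<open>e\<close> and the number of digits. As the exponent is
  unbounded, a bounded quotient forces an inequality between the bases.\<close>

lemma power_sum_le:
  assumes "card D = card D'"
  shows "(\<Sum>j\<in>E.rows. real (distribution_seq D j) ^ e) \<le> (\<Sum>j\<in>F.rows. real (distribution_seq D' j) ^ e)"
proof -
  obtain c where c: "0 < c" "\<And>k. (\<Sum>Q\<in>E.square k ` codes D. E.square_mass k Q ^ e) \<le> c * (\<Sum>Q\<in>E.square k ` codes D'. F.square_mass k Q ^ e)"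
    using mass_power_sum_le by blast
  let ?a = "\<Sum>j\<in>E.rows. real (distribution_seq D j) ^ e" and ?b = "\<Sum>j\<in>F.rows. real (distribution_seq D' j) ^ e"
  have N: "0 < real (card D')"
    using F.card_D_pos by simp
  have le: "?a ^ (k - E.lv k) \<le> c * ?b ^ (k - E.lv k)" for k
  proof -
    have "real (card D') ^ E.lv k * ?a ^ (k - E.lv k) / real (card D') ^ (k * e)
        \<le> c * (real (card D') ^ E.lv k * ?b ^ (k - E.lv k) / real (card D') ^ (k * e))"
      using c(2)[of k] unfolding E.sum_square_mass_powers F.sum_square_mass_powers assms .
    also have "\<dots> = real (card D') ^ E.lv k * (c * ?b ^ (k - E.lv k)) / real (card D') ^ (k * e)"
      by simp
    finally show ?thesis
      using N by (simp add: divide_le_cancel)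
  qed
  show ?thesis
  proof (rule power_growth_le)
    show "0 < ?b"
      using F.finite_rows F.rows_nonempty F.rows_iff by (intro sum_pos) auto
    fix t0
    obtain k where "t0 \<le> k - E.lv k"
      using E.gap_unbounded by blast
    then show "\<exists>t\<ge>t0. ?a ^ t \<le> c * ?b ^ t"
      using le by blast
  qed (simp add: sum_nonneg)
qed

end

section \<open>Power sums determine a finite sequence up to order\<close>

text \<open>A polynomial that vanishes at all values except one turns equal power sums into equal
  multiplicities of that value.\<close>

lemma power_sums_eq_imp_permutes:
  fixes a b :: "nat \<Rightarrow> nat"
  assumes "finite A" and sums: "\<And>e. (\<Sum>j\<in>A. real (a j) ^ e) = (\<Sum>j\<in>A. real (b j) ^ e)"
  shows "\<exists>\<pi>. \<pi> permutes A \<and> (\<forall>j\<in>A. a j = b (\<pi> j))"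
proof -
  have poly: "(\<Sum>j\<in>A. poly p (real (a j))) = (\<Sum>j\<in>A. poly p (real (b j)))" for p :: "real poly"
  proof -
    have "(\<Sum>j\<in>A. poly p (real (c j))) = (\<Sum>i\<le>degree p. coeff p i * (\<Sum>j\<in>A. real (c j) ^ i))" for c :: "nat \<Rightarrow> nat"
      unfolding poly_altdef sum_distrib_left by (rule sum.swap)
    then show ?thesis
      using sums by simp
  qed
  define S where "S = a ` A \<union> b ` A"
  have "finite S"
    using assms(1) by (simp add: S_def)
  have count: "card {j \<in> A. a j = v} = card {j \<in> A. b j = v}" for v
  proof -
    define p where "p = (\<Prod>w\<in>S - {v}. [:- real w, 1:])"
    have p: "poly p (real x) = (\<Prod>w\<in>S - {v}. real x - real w)" for x
      by (simp add: p_def poly_prod)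
    have nz: "poly p (real v) \<noteq> 0"
      unfolding p using \<open>finite S\<close> by simp
    have "(\<Sum>j\<in>A. poly p (real (c j))) = real (card {j \<in> A. c j = v}) * poly p (real v)"
      if "c ` A \<subseteq> S" for c
    proof -
      have "(\<Sum>j\<in>A. poly p (real (c j))) = (\<Sum>j\<in>A. if c j = v then poly p (real v) else 0)"
      proof (rule sum.cong[OF refl])
        fix j assume "j \<in> A"
        then have "c j \<noteq> v \<Longrightarrow> poly p (real (c j)) = 0"
          unfolding p using \<open>finite S\<close> that by (intro prod_zero) auto
        then show "poly p (real (c j)) = (if c j = v then poly p (real v) else 0)"
          by simp
      qed
      also have "\<dots> = (\<Sum>j\<in>{j \<in> A. c j = v}. poly p (real v))"
        using assms(1) by (rule sum.inter_filter[symmetric])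
      finally show ?thesis
        by simp
    qed
    from this[of a] this[of b] poly[of p] nz show ?thesis
      by (simp add: S_def)
  qed
  have "image_mset a (mset_set A) = image_mset b (mset_set A)"
  proof (rule multiset_eqI)
    fix v
    have "count (image_mset c (mset_set A)) v = card {j \<in> A. c j = v}" for c :: "nat \<Rightarrow> nat"
    proof -
      have "count (image_mset c (mset_set A)) v = (\<Sum>j\<in>{j \<in> A. c j = v}. 1)"
        unfolding count_image_mset using assms(1) by (intro sum.cong) (auto simp: vimage_def)
      then show ?thesis
        by simp
    qed
    then show "count (image_mset a (mset_set A)) v = count (image_mset b (mset_set A)) v"
      using count by simp
  qed
  from image_mset_eq_implies_permutes[OF assms(1) this] show ?thesis
    by blast
qed

section \<open>The distribution sequence is a bi-Lipschitz invariant\<close>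

lemma (in lipschitz_carpets) distribution_seq_permutes:
  assumes irr: "depth_ratio n m \<notin> \<rat>"
  shows "\<exists>\<pi>. \<pi> permutes {0..<m} \<and> (\<forall>j\<in>{0..<m}. distribution_seq D j = distribution_seq D' (\<pi> j))"
proof (rule power_sums_eq_imp_permutes)
  obtain g where "lipschitz_carpets n m D' D g C"
    using inverse_lipschitz by blast
  then interpret G: lipschitz_carpets n m D' D g C .
  have eq: "card D = card D'"
    by (rule card_digits_eq[OF irr])
  fix e :: nat
  show "(\<Sum>j\<in>{0..<m}. real (distribution_seq D j) ^ e) = (\<Sum>j\<in>{0..<m}. real (distribution_seq D' j) ^ e)"
  proof (cases e)
    case 0
    then show ?thesis
      by simp
  next
    case (Suc e')
    have "(\<Sum>j\<in>{0..<m}. real (distribution_seq D j) ^ e) = (\<Sum>j\<in>E.rows. real (distribution_seq D j) ^ e)"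
      using E.rows_less E.rows_iff Suc by (intro sum.mono_neutral_right) auto
    also have "\<dots> = (\<Sum>j\<in>F.rows. real (distribution_seq D' j) ^ e)"
      using power_sum_le[OF eq, of e] G.power_sum_le[OF eq[symmetric], of e] by simp
    also have "\<dots> = (\<Sum>j\<in>{0..<m}. real (distribution_seq D' j) ^ e)"
      using F.rows_less F.rows_iff Suc by (intro sum.mono_neutral_left) auto
    finally show ?thesis .
  qed
qed simp

lemma scattered_carpet_if_tvd:
  assumes "2 \<le> m" "m < n" "carpet n m D \<in> carpets_tvd n m" "digit_set n m D"
  shows "scattered_carpet n m D"
proof -
  obtain D1 where D1: "digit_set n m D1" "carpet n m D = carpet n m D1" "totally_disconnected (carpet n m D)"
    "\<exists>j\<in>{0..<m}. distribution_seq D1 j = 0" "doubling_measure (uniform_Bernoulli_measure n m D1)"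
    using assms(3) unfolding carpets_tvd_def by blast
  have "carpet_digits n m D" "carpet_digits n m D1"
    using assms D1(1) by (auto intro: carpet_digits.intro)
  \<comment> \<open>The digit set in the definition of the class is the given one.\<close>
  then have "D = D1"
    by (rule carpet_inj[OF _ _ D1(2)])
  interpret carpet_digits n m D
    by fact
  show ?thesis
  proof unfold_locales
    show "doubling_measure (uniform_Bernoulli_measure n m D)"
      using D1(5) \<open>D = D1\<close> by simp
    show "\<exists>j<m. j \<notin> rows"
      using D1(4) \<open>D = D1\<close> rows_iff by auto
    show "distribution_seq D j < n" for j
    proof (cases "j < m")
      case True
      then show ?thesis
        by (rule totally_disconnected_row_less[OF D1(3)])
    next
      case False
      then have "j \<notin> rows"
        using rows_less by blast
      then show ?thesis
        using rows_iff n by simp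
    qed
  qed
qed

theorem theorem1p4:
  fixes n m :: nat and E F :: "(real \<times> real) set" and D\<^sub>E D\<^sub>F :: "(nat \<times> nat) set"
  assumes "2 \<le> m" and "m < n"
    and "ln (real m) / ln (real n) \<notin> \<rat>"
    and "E \<in> carpets_tvd n m" and "F \<in> carpets_tvd n m"
    and "digit_set n m D\<^sub>E" and "E = carpet n m D\<^sub>E"
    and "digit_set n m D\<^sub>F" and "F = carpet n m D\<^sub>F"
    and "lipschitz_equivalent E F"
  shows "\<exists>\<pi>. \<pi> permutes {0..<m} \<and>
           (\<forall>j\<in>{0..<m}. distribution_seq D\<^sub>E j = distribution_seq D\<^sub>F (\<pi> j))"
proof -
  obtain f C where f: "f ` carpet n m D\<^sub>E = carpet n m D\<^sub>F" "0 < C"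
    "\<And>x y. x \<in> carpet n m D\<^sub>E \<Longrightarrow> y \<in> carpet n m D\<^sub>E \<Longrightarrow> inverse C * dist x y \<le> dist (f x) (f y) \<and> dist (f x) (f y) \<le> C * dist x y"
    using assms(7,9,10) unfolding lipschitz_equivalent_def by blast
  have E: "scattered_carpet n m D\<^sub>E" and F: "scattered_carpet n m D\<^sub>F"
    using assms by (auto intro: scattered_carpet_if_tvd)
  have "lipschitz_carpets n m D\<^sub>E D\<^sub>F f C"
  proof (intro lipschitz_carpets.intro lipschitz_carpets_axioms.intro E F f(1,2))
    fix x y assume xy: "x \<in> carpet n m D\<^sub>E" "y \<in> carpet n m D\<^sub>E"
    show "dist x y \<le> C * dist (f x) (f y)"
      using f(3)[OF xy] f(2) by (simp add: field_simps)
    show "dist (f x) (f y) \<le> C * dist x y"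
      using f(3)[OF xy] by blast
  qed
  then show ?thesis
    using lipschitz_carpets.distribution_seq_permutes assms(3) unfolding depth_ratio_def by blast
qed

end
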